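(* Let $0<\gamma<n$, $1<p<q<\infty$, $\mu\in\Delta_2$ and $b\in\mathrm{BMO}(\mathbb R^n)$. Given a pair of weights $(w,\nu)$ on $\mathbb R^n$, assume that for some $r>1$ there is a constant $C<\infty$ such that for all cubes $Q$ in $\mathbb R^n$, $$|Q|^{\gamma/n+1/q-1/p}\cdot\bigg(\frac{1}{|Q|}\int_Q w(x)^r\,dx\bigg)^{1/(rq)}\big\|\nu^{-1/p}\big\|_{\mathcal A,Q}\leq C,$$ where $\mathcal A(t)=t^{p'}(1+\log^+t)^{p'}$. If $p\leq\alpha<\beta<s\leq\infty$ and $w\in A_\infty$, then the linear commutator $[b,I_\gamma]$ is bounded from $(L^p,L^s)^{\alpha}(\nu,w;\mu)$ into $(WL^q,L^s)^{\beta}(w;\mu)$, where $1/\beta=1/\alpha-(1/p-1/q)$.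
   Context: A weight on $\mathbb R^n$ is a nonnegative locally integrable function; for a weight $w$ and a measurable set $E$, $w(E)=\int_E w(x)\,dx$, and $|E|$ is Lebesgue measure. $p'=p/(p-1)$ and $\log^+t=\max\{\log t,0\}$. All cubes have sides parallel to the coordinate axes; $Q(y,\ell)$ is the cube centered at $y$ with side length $\ell>0$, and for $\lambda>0$, $\lambda Q(y,\ell):=Q(y,\lambda\sqrt n\,\ell)$. $\mu\in\Delta_2$ means: $\mu$ is a weight and there is a finite constant $C>0$ with $\mu(2Q)\le C\,\mu(Q)$ for every cube $Q$. A weight $w$ is in $A_p$ ($1<p<\infty$) if there is $C>0$ with $\big(\frac1{|Q|}\int_Qw\,dx\big)^{1/p}\big(\frac1{|Q|}\int_Qw^{-p'/p}\,dx\big)^{1/p'}\le C$ for every cube $Q$; $A_\infty=\bigcup_{1<p<\infty}A_p$. For a Young function $\mathcal A$ (continuous, convex, strictly increasing on $[0,\infty)$, $\mathcal A(0)=0$, $\mathcal A(t)\to\infty$ as $t\to\infty$) and a cube $Q$, the Luxemburg norm is $$\|f\|_{\mathcal A,Q}:=\inf\Big\{\lambda>0:\frac1{|Q|}\int_Q\mathcal A\Big(\frac{|f(x)|}\lambda\Big)dx\le1\Big\}.$$ $\mathrm{BMO}(\mathbb R^n)$ is the set of $b\in L^1_{loc}(\mathbb R^n)$ with $\|b\|_*:=\sup_Q\frac1{|Q|}\int_Q|b(x)-b_Q|\,dx<\infty$, where $b_Q=\frac1{|Q|}\int_Qb(y)\,dy$ and the supremum is over all cubes $Q$. Fractional integral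 operator and commutator: for $0<\gamma<n$, with $\zeta(\gamma)=\pi^{n/2}2^\gamma\Gamma(\gamma/2)/\Gamma((n-\gamma)/2)$, $$I_\gamma f(x)=\frac1{\zeta(\gamma)}\int_{\mathbb R^n}\frac{f(y)}{|x-y|^{n-\gamma}}\,dy,$$ $$[b,I_\gamma]f(x)=b(x)\cdot I_\gamma f(x)-I_\gamma(bf)(x)=\frac1{\zeta(\gamma)}\int_{\mathbb R^n}\frac{[b(x)-b(y)]f(y)}{|x-y|^{n-\gamma}}\,dy.$$ $\|f\|_{L^p(w)}=(\int_{\mathbb R^n}|f|^pw\,dx)^{1/p}$ and $\|f\|_{WL^p(w)}=\sup_{\lambda>0}\lambda\cdot w(\{x\in\mathbb R^n:|f(x)|>\lambda\})^{1/p}$. Weighted amalgam space: for $1\le p\le\alpha\le s\le\infty$ and weights $\nu,w,\mu$, $(L^p,L^s)^\alpha(\nu,w;\mu)$ is the space of locally integrable $f$ with $$\|f\|_{(L^p,L^s)^\alpha(\nu,w;\mu)}:=\sup_{\ell>0}\Big\|w(Q(y,\ell))^{1/\alpha-1/p-1/s}\|f\cdot\chi_{Q(y,\ell)}\|_{L^p(\nu)}\Big\|_{L^s(\mu)}<\infty,$$ where the $L^s(\mu)$-norm is taken in the variable $y$, i.e. $\|g\|_{L^s(\mu)}=(\int_{\mathbb R^n}|g(y)|^s\mu(y)\,dy)^{1/s}$, with the usual modification when $s=\infty$. Weighted weak amalgam space: for $1\le p\le\alpha\le s\le\infty$ and weights $w,\mu$, $(WL^p,L^s)^\alpha(w;\mu)$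 is the space of measurable $f$ with $$\|f\|_{(WL^p,L^s)^\alpha(w;\mu)}:=\sup_{\ell>0}\Big\|w(Q(y,\ell))^{1/\alpha-1/p-1/s}\|f\cdot\chi_{Q(y,\ell)}\|_{WL^p(w)}\Big\|_{L^s(\mu)}<\infty,$$ with the usual modification when $s=\infty$. An operator $T$ is bounded from $X$ into $Y$ if there is a constant $C$ with $\|Tf\|_Y\le C\|f\|_X$ for all $f\in X$. *)

theory Defs
  imports "HOL-Analysis.Analysis" "HOL-Probability.Essential_Supremum"
begin

text \<open>
  Norms, averages and \<open>w(E)\<close> take values in \<^typ>\<open>ennreal\<close>, with its convention \<open>0 \<cdot> \<infinity> = 0\<close>.
  The power below satisfies \<open>0\<^sup>a = \<infinity>\<close> and \<open>\<infinity>\<^sup>a = 0\<close> for \<open>a < 0\<close>, and \<open>x\<^sup>0 = 1\<close>. Therefore a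
  negative power of a weight is \<open>\<infinity>\<close> where the weight vanishes, whereas \<open>0 powr a = 0\<close> on the reals.
\<close>

definition epowr :: "ennreal \<Rightarrow> real \<Rightarrow> ennreal" where
  "epowr x a =
    (if a = 0 then 1
     else if x = 0 then (if a > 0 then 0 else \<infinity>)
     else if x = \<infinity> then (if a > 0 then \<infinity> else 0)
     else ennreal (enn2real x powr a))"

definition avg :: "'a::euclidean_space set \<Rightarrow> ('a \<Rightarrow> ennreal) \<Rightarrow> ennreal" where
  "avg Q g = (\<integral>\<^sup>+x\<in>Q. g x \<partial>lebesgue) / emeasure lebesgue Q"

definition loc_integrable :: "('a::euclidean_space \<Rightarrow> real) \<Rightarrow> bool" where
  "loc_integrable f \<longleftrightarrow> (\<forall>K. compact K \<longrightarrow> f absolutely_integrable_on K)"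

definition weight :: "('a::euclidean_space \<Rightarrow> real) \<Rightarrow> bool" where
  "weight w \<longleftrightarrow> (\<forall>x. 0 \<le> w x) \<and> loc_integrable w"

definition wmeas :: "('a::euclidean_space \<Rightarrow> real) \<Rightarrow> 'a set \<Rightarrow> ennreal" where
  "wmeas w E = (\<integral>\<^sup>+x\<in>E. ennreal (w x) \<partial>lebesgue)"

definition cube :: "real^'n \<Rightarrow> real \<Rightarrow> (real^'n) set" where
  "cube y l = cbox (y - vec (l / 2)) (y + vec (l / 2))"

text \<open>The dilate \<open>c Q(y,l)\<close> is by convention \<open>Q(y, c \<surd>n l)\<close>, with the additional factor \<open>\<surd>n\<close>.\<close>

definition dilate_cube :: "real \<Rightarrow> real^'n \<Rightarrow> real \<Rightarrow> (real^'n) set" where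
  "dilate_cube c y l = cube y (c * sqrt (real CARD('n)) * l)"

definition doubling :: "(real^'n \<Rightarrow> real) \<Rightarrow> bool" where
  "doubling \<mu> \<longleftrightarrow> weight \<mu> \<and>
     (\<exists>C>0. \<forall>y. \<forall>l>0. wmeas \<mu> (dilate_cube 2 y l) \<le> ennreal C * wmeas \<mu> (cube y l))"

definition conj_exp :: "real \<Rightarrow> real" where
  "conj_exp p = p / (p - 1)"

definition A_class :: "real \<Rightarrow> (real^'n \<Rightarrow> real) \<Rightarrow> bool" where
  "A_class p w \<longleftrightarrow> weight w \<and>
     (\<exists>C>0. \<forall>y. \<forall>l>0.
        epowr (avg (cube y l) (\<lambda>x. ennreal (w x))) (1 / p) *
        epowr (avg (cube y l) (\<lambda>x. epowr (ennreal (w x)) (- (conj_exp p / p)))) (1 / conj_exp p)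
        \<le> ennreal C)"

definition A_infinity :: "(real^'n \<Rightarrow> real) \<Rightarrow> bool" where
  "A_infinity w \<longleftrightarrow> (\<exists>p>1. A_class p w)"

text \<open>The Young function \<open>A\<close> is extended by \<open>A(\<infinity>) = \<infinity>\<close>; the norm is taken of \<open>[0,\<infinity>]\<close>-valued
  functions (i.e. of \<open>|f|\<close>), so that it applies to negative powers of weights.\<close>

definition luxemburg :: "(real \<Rightarrow> real) \<Rightarrow> (real^'n) set \<Rightarrow> (real^'n \<Rightarrow> ennreal) \<Rightarrow> ennreal" where
  "luxemburg A Q f =
     Inf (ennreal ` {t. 0 < t \<and>
       avg Q (\<lambda>x. if f x = \<infinity> then \<infinity> else ennreal (A (enn2real (f x) / t))) \<le> 1})"

definition log_plus :: "real \<Rightarrow> real" where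
  "log_plus t = (if t \<le> 0 then 0 else max (ln t) 0)"

definition log_bump :: "real \<Rightarrow> real \<Rightarrow> real" where
  "log_bump p t = t powr conj_exp p * (1 + log_plus t) powr conj_exp p"

definition mean :: "(real^'n) set \<Rightarrow> (real^'n \<Rightarrow> real) \<Rightarrow> real" where
  "mean Q b = (LINT x:Q|lebesgue. b x) / measure lebesgue Q"

definition bmo_norm :: "(real^'n \<Rightarrow> real) \<Rightarrow> ennreal" where
  "bmo_norm b =
     (SUP (y, l) \<in> UNIV \<times> {0<..}. avg (cube y l) (\<lambda>x. ennreal \<bar>b x - mean (cube y l) b\<bar>))"

definition BMO :: "(real^'n \<Rightarrow> real) set" where
  "BMO = {b. loc_integrable b \<and> bmo_norm b < \<infinity>}"

definition riesz_const :: "'n::finite itself \<Rightarrow> real \<Rightarrow> real" where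
  "riesz_const _ \<gamma> =
     pi powr (real CARD('n) / 2) * 2 powr \<gamma> * Gamma (\<gamma> / 2) / Gamma ((real CARD('n) - \<gamma>) / 2)"

definition riesz_kernel :: "real \<Rightarrow> real^'n \<Rightarrow> real" where
  "riesz_kernel \<gamma> z = 1 / (norm z powr (real CARD('n) - \<gamma>))"

definition frac_integral :: "real \<Rightarrow> (real^'n \<Rightarrow> real) \<Rightarrow> real^'n \<Rightarrow> real" where
  "frac_integral \<gamma> f x =
     1 / riesz_const TYPE('n) \<gamma> * (LINT y|lebesgue. riesz_kernel \<gamma> (x - y) * f y)"

text \<open>
  Isabelle's integral of a non-integrable function is \<open>0\<close>. To prevent this from making a bound on
  the commutator hold by accident, the commutator is given the value \<open>\<infinity>\<close> at the points where its
  integral is not absolutely convergent. A finite (weak) norm then entails absolute convergence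
  almost everywhere with respect to the weight.
\<close>

definition commutator ::
  "(real^'n \<Rightarrow> real) \<Rightarrow> real \<Rightarrow> (real^'n \<Rightarrow> real) \<Rightarrow> real^'n \<Rightarrow> ereal" where
  "commutator b \<gamma> f x =
     (if integrable lebesgue (\<lambda>y. riesz_kernel \<gamma> (x - y) * ((b x - b y) * f y))
      then ereal (1 / riesz_const TYPE('n) \<gamma> *
             (LINT y|lebesgue. riesz_kernel \<gamma> (x - y) * ((b x - b y) * f y)))
      else \<infinity>)"

lemma commutator_eq_frac_integral:
  fixes b f :: "real^'n \<Rightarrow> real"
  assumes f: "integrable lebesgue (\<lambda>y. riesz_kernel \<gamma> (x - y) * f y)"
    and bf: "integrable lebesgue (\<lambda>y. riesz_kernel \<gamma> (x - y) * (b y * f y))"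
  shows "commutator b \<gamma> f x =
           ereal (b x * frac_integral \<gamma> f x - frac_integral \<gamma> (\<lambda>y. b y * f y) x)"
proof -
  have eq: "(\<lambda>y. riesz_kernel \<gamma> (x - y) * ((b x - b y) * f y)) =
      (\<lambda>y. b x * (riesz_kernel \<gamma> (x - y) * f y) - riesz_kernel \<gamma> (x - y) * (b y * f y))"
    by (simp add: fun_eq_iff algebra_simps)
  have int: "integrable lebesgue (\<lambda>y. b x * (riesz_kernel \<gamma> (x - y) * f y))"
    using f by (rule integrable_mult_right)
  show ?thesis
    unfolding commutator_def eq frac_integral_def
      if_P[OF Bochner_Integration.integrable_diff[OF int bf]]
    by (simp only: Bochner_Integration.integral_diff[OF int bf] integral_mult_right_zero)
       (simp add: algebra_simps diff_divide_distrib)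
qed

text \<open>For \<open>s = \<infinity>\<close> the norm is the essential supremum with respect to the measure \<open>v(x) dx\<close>.\<close>

definition Lp_norm :: "ennreal \<Rightarrow> (real^'n \<Rightarrow> real) \<Rightarrow> (real^'n \<Rightarrow> ennreal) \<Rightarrow> ennreal" where
  "Lp_norm s v g =
     (if s = \<infinity> then esssup (density lebesgue (\<lambda>x. ennreal (v x))) g
      else epowr (\<integral>\<^sup>+x. epowr (g x) (enn2real s) * ennreal (v x) \<partial>lebesgue) (1 / enn2real s))"

definition weak_Lp_norm :: "real \<Rightarrow> (real^'n \<Rightarrow> real) \<Rightarrow> (real^'n \<Rightarrow> ereal) \<Rightarrow> ennreal" where
  "weak_Lp_norm p w g =
     (SUP t\<in>{0<..}. ennreal t * epowr (wmeas w {x. \<bar>g x\<bar> > ereal t}) (1 / p))"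

text \<open>In the exponents below, \<^term>\<open>enn2real (1 / s)\<close> is \<open>1/s\<close>, and it is \<open>0\<close> for \<open>s = \<infinity>\<close>.\<close>

definition amalgam_norm ::
  "real \<Rightarrow> ennreal \<Rightarrow> real \<Rightarrow> (real^'n \<Rightarrow> real) \<Rightarrow> (real^'n \<Rightarrow> real) \<Rightarrow> (real^'n \<Rightarrow> real) \<Rightarrow>
   (real^'n \<Rightarrow> real) \<Rightarrow> ennreal" where
  "amalgam_norm p s \<alpha> \<nu> w \<mu> f =
     (SUP l\<in>{0<..}. Lp_norm s \<mu> (\<lambda>y.
        epowr (wmeas w (cube y l)) (1 / \<alpha> - 1 / p - enn2real (1 / s)) *
        Lp_norm (ennreal p) \<nu> (\<lambda>x. ennreal \<bar>f x * indicator (cube y l) x\<bar>)))"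

definition amalgam_space ::
  "real \<Rightarrow> ennreal \<Rightarrow> real \<Rightarrow> (real^'n \<Rightarrow> real) \<Rightarrow> (real^'n \<Rightarrow> real) \<Rightarrow> (real^'n \<Rightarrow> real) \<Rightarrow>
   (real^'n \<Rightarrow> real) set" where
  "amalgam_space p s \<alpha> \<nu> w \<mu> = {f. loc_integrable f \<and> amalgam_norm p s \<alpha> \<nu> w \<mu> f < \<infinity>}"

definition weak_amalgam_norm ::
  "real \<Rightarrow> ennreal \<Rightarrow> real \<Rightarrow> (real^'n \<Rightarrow> real) \<Rightarrow> (real^'n \<Rightarrow> real) \<Rightarrow>
   (real^'n \<Rightarrow> ereal) \<Rightarrow> ennreal" where
  "weak_amalgam_norm p s \<alpha> w \<mu> g =
     (SUP l\<in>{0<..}. Lp_norm s \<mu> (\<lambda>y.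
        epowr (wmeas w (cube y l)) (1 / \<alpha> - 1 / p - enn2real (1 / s)) *
        weak_Lp_norm p w (\<lambda>x. g x * indicator (cube y l) x)))"

definition weak_amalgam_space ::
  "real \<Rightarrow> ennreal \<Rightarrow> real \<Rightarrow> (real^'n \<Rightarrow> real) \<Rightarrow> (real^'n \<Rightarrow> real) \<Rightarrow>
   (real^'n \<Rightarrow> ereal) set" where
  "weak_amalgam_space p s \<alpha> w \<mu> =
     {g. g \<in> borel_measurable lebesgue \<and> weak_amalgam_norm p s \<alpha> w \<mu> g < \<infinity>}"

end

theory Submission
  imports Defs
begin

text \<open>
  The weak norm is estimated by duality: for \<open>E \<subseteq> Q = Q(y,l)\<close> the integral of
  \<open>\<bar>b(x) - b(z)\<bar> \<bar>x - z\<bar>\<^sup>\<gamma>\<^sup>-\<^sup>n \<bar>f(z)\<bar> w(x)\<close> over \<open>x \<in> E\<close> is compared with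
  \<open>w(E)\<^sup>1\<^sup>-\<^sup>1\<^sup>/\<^sup>q\<close>, and \<open>E\<close> is then taken to be a level set of the commutator in \<open>Q\<close>.
  On one cube \<open>P\<close>, the John--Nirenberg inequality and the two bumps give, for every large \<open>m\<close>, the
  bound \<open>\<bar>P\<bar>\<^sup>1\<^sup>-\<^sup>\<gamma>\<^sup>/\<^sup>n w(E \<inter> P)\<^sup>1\<^sup>-\<^sup>1\<^sup>/\<^sup>m w(P)\<^sup>-\<^sup>\<theta> (\<integral>\<^sub>P \<bar>f\<bar>\<^sup>p \<nu>)\<^sup>1\<^sup>/\<^sup>p\<close> with \<open>\<theta> = 1/q - 1/m\<close>.
  Below the scale of \<open>Q\<close>, the gap \<open>p < q\<close> makes this decay geometrically in both directions
  away from the scale where \<open>w(P)\<close> is comparable to \<open>w(E)\<close>, because \<open>w(P)\<close> grows geometrically with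
  \<open>P\<close>; so no maximal function is needed. Above it, only the concentric cubes \<open>2\<^sup>jQ\<close> occur, with a
  factor \<open>(w(Q) / w(2\<^sup>jQ))\<^sup>\<theta>\<close>. After multiplication by \<open>w(Q)\<^sup>1\<^sup>/\<^sup>\<beta>\<^sup>-\<^sup>1\<^sup>/\<^sup>q\<^sup>-\<^sup>1\<^sup>/\<^sup>s\<close> the total
  power of \<open>w(Q) / w(2\<^sup>jQ)\<close> is \<open>1/\<beta> - 1/s - 1/m > 0\<close>, so the sum over \<open>j\<close> converges
  geometrically against the amalgam norm of \<open>f\<close>.
\<close>

section \<open>Extended powers and the Hoelder inequality\<close>

text \<open>The exponent \<open>m\<close> is the price of the unbounded symbol: \<open>b\<close>
  minus its mean on \<open>P\<close> lies in every finite power of integrability against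
  \<open>w\<close>, but it is not bounded, so Hoelder on \<open>E\<close> returns
  \<open>w(E)\<close> only to the power \<open>1 - 1/m\<close>. This loss has to stay below
  \<open>1/\<beta> - 1/s\<close>, which is positive because \<open>\<beta> < s\<close>; that decides
  how large \<open>m\<close> is taken. The obstacle at small scales is that the bound on one cube is
  a product of powers of \<open>w(E \<inter> P)\<close> and of the integral of
  \<open>\<bar>f\<bar>^p \<nu>\<close> over \<open>P\<close>, which cannot be summed over
  overlapping cubes. Young's inequality with a free parameter \<open>L\<close> replaces it by
  \<open>L w(E \<inter> P)\<close> plus \<open>L^(1-p)\<close> times that integral, which is
  additive in \<open>P\<close>. One \<open>L\<close> serves all cubes and all scales, so the sums
  collapse to total masses, and \<open>L\<close> is optimized once, after the summation. With
  \<open>0 * \<infinity> = 0\<close> a weight that vanishes almost everywhere satisfies the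
  Muckenhoupt condition, so this case is separated; otherwise the condition forces
  \<open>w > 0\<close> almost everywhere.\<close>

lemma epowr_0_right [simp]: "epowr x 0 = 1"
  by (simp add: epowr_def)

lemma epowr_0_left [simp]: "a > 0 \<Longrightarrow> epowr 0 a = 0"
  by (simp add: epowr_def)

lemma epowr_1_left [simp]: "epowr 1 a = 1"
  by (simp add: epowr_def)

lemma epowr_top [simp]: "a > 0 \<Longrightarrow> epowr top a = top"
  by (simp add: epowr_def)

lemma epowr_1_right [simp]: "epowr x 1 = x"
  by (cases x) (auto simp: epowr_def)

lemma epowr_ennreal: "x > 0 \<Longrightarrow> epowr (ennreal x) a = ennreal (x powr a)"
  by (auto simp: epowr_def)

lemma epowr_ennreal_pos: "x \<ge> 0 \<Longrightarrow> a > 0 \<Longrightarrow> epowr (ennreal x) a = ennreal (x powr a)"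
  by (cases "x = 0") (auto simp: epowr_ennreal)

lemma epowr_mono: "x \<le> y \<Longrightarrow> a \<ge> 0 \<Longrightarrow> epowr x a \<le> epowr y a"
  by (cases x; cases y; cases "a = 0")
     (auto simp: epowr_ennreal_pos top_unique intro!: ennreal_leI powr_mono2)

lemma epowr_eq_0_iff: "a > 0 \<Longrightarrow> epowr x a = 0 \<longleftrightarrow> x = 0"
  by (cases x) (auto simp: epowr_ennreal_pos)

lemma epowr_epowr_pos: "a > 0 \<Longrightarrow> b > 0 \<Longrightarrow> epowr (epowr x a) b = epowr x (a * b)"
  by (cases x) (auto simp: epowr_ennreal_pos powr_powr)

text \<open>For \<open>a > 0\<close> the product \<open>0 * \<infinity> = 0\<close> is respected on
  both sides, so no finiteness is required. For \<open>a < 0\<close> the two sides would be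
  \<open>\<infinity>\<close> and \<open>0\<close> at this product.\<close>

lemma epowr_mult:
  assumes "a \<ge> 0"
  shows "epowr (x * y) a = epowr x a * epowr y a"
proof (cases "a = 0")
  case False
  then have a: "a > 0" using assms by simp
  show ?thesis
  proof (cases "x = 0 \<or> y = 0")
    case True
    then show ?thesis using a by auto
  next
    case xy: False
    show ?thesis
    proof (cases "x = top \<or> y = top")
      case True
      then show ?thesis using xy a by (auto simp: ennreal_mult_top ennreal_top_mult epowr_eq_0_iff)
    next
      case False
      then obtain x' y' where "x = ennreal x'" "x' \<ge> 0" "y = ennreal y'" "y' \<ge> 0"
        by (cases x; cases y) auto
      then show ?thesis using a
        by (simp add: epowr_ennreal_pos powr_mult flip: ennreal_mult)
    qed
  qed
qed simp

lemma borel_measurable_epowr: "(\<lambda>x. epowr x a) \<in> borel_measurable borel"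
proof -
  have [measurable]: "(\<lambda>x. ennreal (enn2real x powr a)) \<in> borel_measurable borel"
    by (intro measurable_compose[OF _ measurable_ennreal] powr_real_measurable) auto
  have [simp]: "{x. x = (0::ennreal)} = {0}" "{x. x = top} = {top::ennreal}" by auto
  show ?thesis unfolding epowr_def
    by (cases "a = 0"; cases "a > 0") (simp_all add: measurable_If pred_def)
qed
lemma measurable_epowr [measurable]:
  "f \<in> borel_measurable M \<Longrightarrow> (\<lambda>x. epowr (f x) a) \<in> borel_measurable M"
  by (rule measurable_compose[OF _ borel_measurable_epowr])

lemma epowr_indicator: "a > 0 \<Longrightarrow> epowr (x * indicator A y) a = epowr x a * indicator A y"
  by (auto split: split_indicator)

lemma ennreal_Young:
  assumes pq: "p > 1" "q > 1" "1/p + 1/q = (1::real)"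
  shows "x * y \<le> ennreal (1/p) * epowr x p + ennreal (1/q) * epowr y q"
proof (cases "x = top \<or> y = top")
  case True
  then show ?thesis using pq by (auto simp: ennreal_mult_top)
next
  case False
  then obtain x' y' where "x = ennreal x'" "x' \<ge> 0" "y = ennreal y'" "y' \<ge> 0"
    by (cases x; cases y) auto
  then show ?thesis using pq Youngs_inequality[of p q x' y']
    by (simp add: epowr_ennreal_pos flip: ennreal_mult ennreal_plus)
qed

lemma ennreal_Holder:
  assumes pq: "p > 1" "q > 1" "1/p + 1/q = (1::real)"
  and [measurable]: "f \<in> borel_measurable M" "g \<in> borel_measurable M"
  shows "(\<integral>\<^sup>+x. f x * g x \<partial>M) \<le>
     epowr (\<integral>\<^sup>+x. epowr (f x) p \<partial>M) (1/p) * epowr (\<integral>\<^sup>+x. epowr (g x) q \<partial>M) (1/q)"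
proof -
  let ?A = "\<integral>\<^sup>+x. epowr (f x) p \<partial>M" and ?B = "\<integral>\<^sup>+x. epowr (g x) q \<partial>M"
  consider "?A = 0 \<or> ?B = 0" | "?A \<noteq> 0" "?B \<noteq> 0" "?A = top \<or> ?B = top"
    | "?A \<noteq> 0" "?B \<noteq> 0" "?A \<noteq> top" "?B \<noteq> top" by blast
  then show ?thesis
  proof cases
    case 1
    then have "AE x in M. f x * g x = 0"
    proof
      assume "?A = 0"
      then have "AE x in M. epowr (f x) p = 0" by (subst (asm) nn_integral_0_iff_AE) auto
      then show ?thesis using pq by (auto elim!: eventually_mono simp: epowr_eq_0_iff)
    next
      assume "?B = 0"
      then have "AE x in M. epowr (g x) q = 0" by (subst (asm) nn_integral_0_iff_AE) auto
      then show ?thesis using pq by (auto elim!: eventually_mono simp: epowr_eq_0_iff)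
    qed
    then have "(\<integral>\<^sup>+x. f x * g x \<partial>M) = 0" by (subst nn_integral_0_iff_AE) auto
    then show ?thesis by simp
  next
    case 2
    then show ?thesis using pq by (auto simp: ennreal_mult_top ennreal_top_mult epowr_eq_0_iff)
  next
    case 3
    then obtain A B where A: "?A = ennreal A" "A > 0" and B: "?B = ennreal B" "B > 0"
      by (cases ?A; cases ?B) (auto simp: less_le)
    \<comment> \<open>Normalization: Young's inequality is applied to \<open>f / a\<close> and
      \<open>g / b\<close>, whose powers have integral one.\<close>
    define a b where "a = A powr (1/p)" and "b = B powr (1/q)"
    have ab: "a > 0" "b > 0" "(1/a) powr p = 1/A" "(1/b) powr q = 1/B"
      using A B pq by (auto simp: a_def b_def powr_divide powr_powr)
    have [simp]: "ennreal a * ennreal (1/a) = 1" "ennreal b * ennreal (1/b) = 1"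
      using ab by (auto simp flip: ennreal_mult)
    have "f x * g x \<le> ennreal (a*b) * (ennreal (1/p/A) * epowr (f x) p + ennreal (1/q/B) * epowr (g x) q)" for x
    proof -
      have "f x * g x = (ennreal a * ennreal (1/a)) * (ennreal b * ennreal (1/b)) * (f x * g x)"
        by simp
      also have "\<dots> = ennreal (a*b) * ((ennreal (1/a) * f x) * (ennreal (1/b) * g x))"
        using ab by (simp add: ennreal_mult ac_simps del: \<open>ennreal a * ennreal (1/a) = 1\<close> \<open>ennreal b * ennreal (1/b) = 1\<close>)
      also have "\<dots> \<le> ennreal (a*b) * (ennreal (1/p) * epowr (ennreal (1/a) * f x) p + ennreal (1/q) * epowr (ennreal (1/b) * g x) q)"
        by (intro mult_left_mono ennreal_Young pq) auto
      also have "\<dots> = ennreal (a*b) * (ennreal (1/p/A) * epowr (f x) p + ennreal (1/q/B) * epowr (g x) q)"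
        using pq ab A B by (simp add: epowr_mult epowr_ennreal mult.assoc[symmetric] flip: ennreal_mult)
      finally show ?thesis .
    qed
    then have "(\<integral>\<^sup>+x. f x * g x \<partial>M) \<le> (\<integral>\<^sup>+x. ennreal (a*b) * (ennreal (1/p/A) * epowr (f x) p + ennreal (1/q/B) * epowr (g x) q) \<partial>M)"
      by (intro nn_integral_mono)
    also have "\<dots> = ennreal (a*b) * (ennreal (1/p/A) * ?A + ennreal (1/q/B) * ?B)"
      by (subst nn_integral_cmult, measurable) (subst nn_integral_add, auto simp: nn_integral_cmult)
    also have "\<dots> = ennreal (a * b)"
      using A B ab pq by (simp flip: ennreal_mult ennreal_plus)
    finally show ?thesis using A B ab pq
      by (simp add: epowr_ennreal a_def b_def flip: ennreal_mult)
  qed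
qed

lemma ennreal_set_Holder:
  assumes pq: "p > 1" "q > 1" "1/p + 1/q = (1::real)"
  and [measurable]: "f \<in> borel_measurable M" "g \<in> borel_measurable M" "A \<in> sets M"
  shows "(\<integral>\<^sup>+x\<in>A. f x * g x \<partial>M) \<le>
     epowr (\<integral>\<^sup>+x\<in>A. epowr (f x) p \<partial>M) (1/p) * epowr (\<integral>\<^sup>+x\<in>A. epowr (g x) q \<partial>M) (1/q)"
proof -
  have "(\<integral>\<^sup>+x\<in>A. f x * g x \<partial>M) = (\<integral>\<^sup>+x. (f x * indicator A x) * (g x * indicator A x) \<partial>M)"
    by (intro nn_integral_cong) (auto split: split_indicator)
  also have "\<dots> \<le> epowr (\<integral>\<^sup>+x. epowr (f x * indicator A x) p \<partial>M) (1/p) *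
      epowr (\<integral>\<^sup>+x. epowr (g x * indicator A x) q \<partial>M) (1/q)"
    by (intro ennreal_Holder pq) measurable
  finally show ?thesis using pq by (simp add: epowr_indicator)
qed

section \<open>Cubes\<close>

lemma mem_cube: "x \<in> cube c l \<longleftrightarrow> (\<forall>i. \<bar>x $ i - c $ i\<bar> \<le> l / 2)"
proof -
  have "(c $ i - l / 2 \<le> x $ i \<and> x $ i \<le> c $ i + l / 2) \<longleftrightarrow> \<bar>x $ i - c $ i\<bar> \<le> l / 2" for i
    by arith
  then show ?thesis unfolding cube_def mem_box_cart by simp
qed

lemma sets_cube [measurable, simp]: "cube c l \<in> sets lebesgue"
  unfolding cube_def by simp

lemma emeasure_cube:
  fixes c :: "real^'n"
  assumes "l \<ge> 0"
  shows "emeasure lebesgue (cube c l) = ennreal (l ^ CARD('n))"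
proof -
  have vec: "(c + vec (l / 2)) - (c - vec (l / 2)) = vec l"
    by (simp add: vec_eq_iff)
  have le: "(c - vec (l / 2)) \<bullet> b \<le> (c + vec (l / 2)) \<bullet> b" if "b \<in> Basis" for b
    using that assms by (auto simp: Basis_vec_def inner_axis)
  have "emeasure lebesgue (cube c l) = emeasure lborel (cube c l)"
    unfolding cube_def by simp
  also have "\<dots> = ennreal (prod ((\<bullet>) (vec l :: real^'n)) Basis)"
    unfolding cube_def by (subst emeasure_lborel_cbox[OF le]) (auto simp: vec)
  also have "prod ((\<bullet>) (vec l :: real^'n)) Basis = (\<Prod>b\<in>(Basis::(real^'n) set). l)"
    by (intro prod.cong) (auto simp: Basis_vec_def inner_axis)
  also have "\<dots> = l ^ CARD('n)" by simp
  finally show ?thesis .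
qed

lemma cube_subset: "(\<And>i. \<bar>c $ i - d $ i\<bar> \<le> (r - l) / 2) \<Longrightarrow> cube c l \<subseteq> cube d r"
proof
  fix x assume h: "\<And>i. \<bar>c $ i - d $ i\<bar> \<le> (r - l) / 2" and x: "x \<in> cube c l"
  show "x \<in> cube d r" unfolding mem_cube
  proof
    fix i show "\<bar>x $ i - d $ i\<bar> \<le> r / 2"
      using h[of i] x[unfolded mem_cube, rule_format, of i] by argo
  qed
qed

lemma cube_mono: "l \<le> r \<Longrightarrow> cube c l \<subseteq> cube c r"
  by (rule cube_subset) auto

section \<open>Fubini and measurability for the completed Lebesgue measure\<close>

lemma sigma_finite_lebesgue: "sigma_finite_measure (lebesgue :: 'a::euclidean_space measure)"
proof
  show "\<exists>A::'a set set. countable A \<and> A \<subseteq> sets lebesgue \<and> \<Union> A = space lebesgue \<and> (\<forall>a\<in>A. emeasure lebesgue a \<noteq> \<infinity>)"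
    by (rule exI[of _ "range (\<lambda>n::nat. cball 0 (real n))"])
       (use emeasure_lborel_cball_finite[THEN less_imp_neq] in \<open>auto intro: real_arch_simple\<close>)
qed

interpretation lebesgue: sigma_finite_measure "lebesgue :: 'a::euclidean_space measure"
  by (rule sigma_finite_lebesgue)

interpretation lebesgue_pair: pair_sigma_finite "lebesgue :: 'a::euclidean_space measure" "lebesgue :: 'b::euclidean_space measure"
  by unfold_locales

lemma borel_imp_lebesgue: "f \<in> borel_measurable borel \<Longrightarrow> f \<in> borel_measurable lebesgue"
  by (simp add: measurable_completion)

lemma nth_measurable_lebesgue [measurable]: "(\<lambda>x::real^'n. x $ i) \<in> borel_measurable lebesgue"
  by (intro borel_imp_lebesgue borel_measurable_continuous_onI continuous_intros)

text \<open>Incidence between points and centers is measurable on the product of two completed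
  measures, being finitely many inequalities between coordinates. Every later exchange of integrals
  over points and over centers of cubes rests on this.\<close>

lemma cube_pair_measurable [measurable]:
  fixes f g :: "'b \<Rightarrow> real^'n"
  assumes f: "f \<in> M \<rightarrow>\<^sub>M lebesgue" and g: "g \<in> M \<rightarrow>\<^sub>M lebesgue"
  shows "Measurable.pred M (\<lambda>z. f z \<in> cube (g z) l)"
proof -
  have [measurable]: "(\<lambda>z. f z $ i) \<in> borel_measurable M" "(\<lambda>z. g z $ i) \<in> borel_measurable M" for i
    using measurable_compose[OF f nth_measurable_lebesgue] measurable_compose[OF g nth_measurable_lebesgue] by auto
  show ?thesis unfolding mem_cube by measurable
qed

lemma measurable_lebesgue_imp_borel:
  assumes "f \<in> M \<rightarrow>\<^sub>M lebesgue" shows "f \<in> M \<rightarrow>\<^sub>M borel"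
  using measurable_compose[OF assms, of "\<lambda>x. x"] by (simp add: borel_imp_lebesgue)

lemma loc_integrable_measurable:
  assumes "loc_integrable f" shows "f \<in> borel_measurable lebesgue"
proof -
  have "(\<lambda>x. f x * indicator (cball 0 (real n)) x) \<in> borel_measurable lebesgue" for n
  proof -
    have "set_integrable lebesgue (cball 0 (real n)) f"
      using assms by (auto simp: loc_integrable_def)
    then have "integrable lebesgue (\<lambda>x. indicat_real (cball 0 (real n)) x *\<^sub>R f x)"
      unfolding set_integrable_def .
    then show ?thesis by (auto simp: mult.commute dest: borel_measurable_integrable)
  qed
  moreover have "(\<lambda>n. f x * indicator (cball 0 (real n)) x) \<longlonglongrightarrow> f x" for x
  proof (rule tendsto_eventually)
    obtain N where "norm x \<le> real N" using real_arch_simple by blast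
    then show "\<forall>\<^sub>F n in sequentially. f x * indicator (cball 0 (real n)) x = f x"
      by (intro eventually_sequentiallyI[of N]) (auto split: split_indicator)
  qed
  ultimately show ?thesis by (rule borel_measurable_LIMSEQ_real[rotated])
qed

lemma loc_integrable_cube:
  assumes "loc_integrable f" shows "set_integrable lebesgue (cube c l) f"
  using assms unfolding loc_integrable_def cube_def by (simp add: compact_cbox)

lemma loc_integrable_nn_finite:
  assumes "loc_integrable f" shows "(\<integral>\<^sup>+x\<in>cube c l. ennreal \<bar>f x\<bar> \<partial>lebesgue) < top"
proof -
  have "(\<integral>\<^sup>+x\<in>cube c l. ennreal \<bar>f x\<bar> \<partial>lebesgue) = (\<integral>\<^sup>+x. ennreal (norm (indicat_real (cube c l) x *\<^sub>R f x)) \<partial>lebesgue)"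
    by (intro nn_integral_cong) (auto split: split_indicator)
  also have "\<dots> < \<infinity>"
    using loc_integrable_cube[OF assms, of c l] unfolding set_integrable_def integrable_iff_bounded by auto
  finally show ?thesis by simp
qed

section \<open>The John--Nirenberg inequality\<close>

text \<open>The set \<open>\<sigma>\<close> records the directions in which the upper half is taken,
  so the dyadic children are indexed by all sets of coordinates, and any cube can serve as
  root.\<close>

definition child_center :: "real^'n \<Rightarrow> real \<Rightarrow> 'n set \<Rightarrow> real^'n" where
  "child_center c l \<sigma> = (\<chi> i. c $ i + (if i \<in> \<sigma> then l / 4 else - l / 4))"

lemma child_subset: "l \<ge> 0 \<Longrightarrow> cube (child_center c l \<sigma>) (l / 2) \<subseteq> cube c l"
  by (rule cube_subset) (auto simp: child_center_def)

lemma AE_not_hyperplane: "AE x in lebesgue. x $ i \<noteq> (c::real^'n) $ i"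
proof -
  have "{x::real^'n. x $ i = c $ i} \<in> null_sets lebesgue"
    using negligible_standard_hyperplane[of "axis i 1 :: real^'n" "c $ i"]
    by (simp add: cart_eq_inner_axis flip: negligible_iff_null_sets)
  then show ?thesis by (rule AE_I') auto
qed

text \<open>The children are closed and share faces, so the identity can fail on the hyperplanes
  through \<open>c\<close>. Off these null sets a point selects its child by the signs of the
  coordinates of \<open>x - c\<close>.\<close>

lemma sum_indicator_children:
  fixes c :: "real^'n"
  assumes l: "l > 0"
  shows "AE x in lebesgue. (\<Sum>\<sigma>\<in>UNIV. indicator (cube (child_center c l \<sigma>) (l / 2)) x) = (indicator (cube c l) x :: ennreal)"
proof -
  have "AE x in lebesgue. \<forall>i\<in>UNIV. x $ i \<noteq> c $ i"
    by (subst AE_ball_countable) (auto intro: AE_not_hyperplane)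
  then show ?thesis
  proof eventually_elim
    case (elim x)
    define \<tau> where "\<tau> = {i. x $ i > c $ i}"
    have not: "x \<notin> cube (child_center c l \<sigma>) (l / 2)" if ne: "\<sigma> \<noteq> \<tau>" for \<sigma>
    proof -
      obtain i where "i \<in> \<sigma> \<longleftrightarrow> i \<notin> \<tau>" using ne by blast
      moreover have "x $ i \<noteq> c $ i" using elim by auto
      ultimately show ?thesis
        unfolding mem_cube by (auto intro!: exI[of _ i] simp: child_center_def \<tau>_def abs_if)
    qed
    have "\<bar>x $ i - child_center c l \<tau> $ i\<bar> \<le> l / 2 / 2 \<longleftrightarrow> \<bar>x $ i - c $ i\<bar> \<le> l / 2" for i
      using elim[rule_format, of i] l unfolding \<tau>_def child_center_def
      by (cases "x $ i > c $ i") (simp_all only: vec_lambda_beta mem_Collect_eq if_True if_False, argo+)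
    then have "x \<in> cube (child_center c l \<tau>) (l / 2) \<longleftrightarrow> x \<in> cube c l"
      unfolding mem_cube by simp
    then have "indicator (cube c l) x = (indicator (cube (child_center c l \<tau>) (l / 2)) x :: ennreal)"
      by (auto simp: indicator_def)
    also have "\<dots> = (\<Sum>\<sigma>\<in>{\<tau>}. indicator (cube (child_center c l \<sigma>) (l / 2)) x)" by simp
    also have "\<dots> = (\<Sum>\<sigma>\<in>UNIV. indicator (cube (child_center c l \<sigma>) (l / 2)) x)"
      by (intro sum.mono_neutral_left) (auto simp: not)
    finally show ?case by simp
  qed
qed

lemma nn_integral_children:
  fixes c :: "real^'n"
  assumes l: "l > 0" and [measurable]: "g \<in> borel_measurable lebesgue"
  shows "(\<integral>\<^sup>+x\<in>cube c l. g x \<partial>lebesgue) = (\<Sum>\<sigma>\<in>UNIV. \<integral>\<^sup>+x\<in>cube (child_center c l \<sigma>) (l / 2). g x \<partial>lebesgue)"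
proof -
  have "(\<integral>\<^sup>+x\<in>cube c l. g x \<partial>lebesgue) = (\<integral>\<^sup>+x. (\<Sum>\<sigma>\<in>UNIV. g x * indicator (cube (child_center c l \<sigma>) (l / 2)) x) \<partial>lebesgue)"
    using sum_indicator_children[OF l, of c]
    by (intro nn_integral_cong_AE) (auto simp flip: sum_distrib_left elim!: eventually_mono)
  also have "\<dots> = (\<Sum>\<sigma>\<in>UNIV. \<integral>\<^sup>+x\<in>cube (child_center c l \<sigma>) (l / 2). g x \<partial>lebesgue)"
    by (rule nn_integral_sum) measurable
  finally show ?thesis .
qed

lemma sum_children_volume: "(\<Sum>\<sigma>\<in>(UNIV::'n::finite set set). (l / 2) ^ CARD('n)) = (l::real) ^ CARD('n)"
  by (simp add: card_Pow[where A="UNIV::'n set", unfolded Pow_UNIV] power_divide)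

lemma measure_cube: "l \<ge> 0 \<Longrightarrow> measure lebesgue (cube (c::real^'n) l) = l ^ CARD('n)"
  by (simp add: measure_def emeasure_cube del: emeasure_completion)

lemma mean_diff_le:
  fixes c :: "real^'n"
  assumes b: "loc_integrable b" and l: "l > 0"
  shows "ennreal (\<bar>mean (cube c l) b - a\<bar> * l ^ CARD('n)) \<le> (\<integral>\<^sup>+x\<in>cube c l. ennreal \<bar>b x - a\<bar> \<partial>lebesgue)"
proof -
  let ?Q = "cube c l"
  have int: "set_integrable lebesgue ?Q b" by (rule loc_integrable_cube[OF b])
  have inta: "set_integrable lebesgue ?Q (\<lambda>x. a)"
    unfolding set_integrable_def using l by (intro integrable_scaleR_left integrable_real_indicator) (auto simp: emeasure_cube simp del: emeasure_completion)
  have "(LINT x:?Q|lebesgue. a) = a * l ^ CARD('n)"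
    using l by (simp add: set_lebesgue_integral_def measure_cube)
  then have "(LINT x:?Q|lebesgue. b x - a) = (mean ?Q b - a) * l ^ CARD('n)"
    using l by (simp add: set_integral_diff(2)[OF int inta] mean_def measure_cube field_simps)
  moreover have "ennreal (norm (LINT x:?Q|lebesgue. b x - a)) \<le> (\<integral>\<^sup>+x. ennreal (norm (indicat_real ?Q x *\<^sub>R (b x - a))) \<partial>lebesgue)"
    unfolding set_lebesgue_integral_def using set_integral_diff(1)[OF int inta]
    by (intro integral_norm_bound_ennreal) (simp add: set_integrable_def)
  moreover have "(\<integral>\<^sup>+x. ennreal (norm (indicat_real ?Q x *\<^sub>R (b x - a))) \<partial>lebesgue) = (\<integral>\<^sup>+x\<in>?Q. ennreal \<bar>b x - a\<bar> \<partial>lebesgue)"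
    by (intro nn_integral_cong) (auto split: split_indicator)
  ultimately show ?thesis using l by (simp add: abs_mult)
qed

text \<open>This is the distance in \<open>L^1\<close> of the cube between \<open>b\<close> and its
  conditional expectation on the \<open>k\<close>-th dyadic subdivision. Its decay in
  \<open>k\<close> does the work of the Lebesgue differentiation theorem in the stopping
  argument.\<close>

fun dyadic_osc :: "(real^'n \<Rightarrow> real) \<Rightarrow> nat \<Rightarrow> real^'n \<Rightarrow> real \<Rightarrow> ennreal" where
  "dyadic_osc b 0 c l = (\<integral>\<^sup>+x\<in>cube c l. ennreal \<bar>b x - mean (cube c l) b\<bar> \<partial>lebesgue)"
| "dyadic_osc b (Suc k) c l = (\<Sum>\<sigma>\<in>UNIV. dyadic_osc b k (child_center c l \<sigma>) (l / 2))"

text \<open>One copy of the \<open>L^1\<close> distance pays for the change of the values, the other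
  for the change of the mean on each descendant. The bound does not grow with \<open>k\<close>
  because the descendants tile the cube.\<close>

lemma dyadic_osc_approx:
  fixes c :: "real^'n"
  assumes b: "loc_integrable b" and g: "loc_integrable g" and l: "l > 0"
  shows "dyadic_osc b k c l \<le> dyadic_osc g k c l + 2 * (\<integral>\<^sup>+x\<in>cube c l. ennreal \<bar>b x - g x\<bar> \<partial>lebesgue)"
  using l
proof (induction k arbitrary: c l)
  case 0
  let ?Q = "cube c l"
  note [measurable] = loc_integrable_measurable[OF b] loc_integrable_measurable[OF g]
  define d where "d = \<bar>mean ?Q g - mean ?Q b\<bar>"
  have sub: "loc_integrable (\<lambda>x. b x - g x)"
    using b g unfolding loc_integrable_def by (auto intro: set_integral_diff(1))
  have "mean ?Q (\<lambda>x. b x - g x) = mean ?Q b - mean ?Q g"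
    unfolding mean_def set_integral_diff(2)[OF loc_integrable_cube[OF b] loc_integrable_cube[OF g]]
    by (simp add: diff_divide_distrib)
  then have d: "ennreal (d * l ^ CARD('n)) \<le> (\<integral>\<^sup>+x\<in>?Q. ennreal \<bar>b x - g x\<bar> \<partial>lebesgue)"
    using mean_diff_le[OF sub 0, of c 0] by (simp add: d_def abs_minus_commute)
  have "dyadic_osc b 0 c l \<le> (\<integral>\<^sup>+x. (ennreal \<bar>g x - mean ?Q g\<bar> * indicator ?Q x + ennreal \<bar>b x - g x\<bar> * indicator ?Q x) + ennreal d * indicator ?Q x \<partial>lebesgue)"
    by (auto intro!: nn_integral_mono split: split_indicator simp flip: ennreal_plus simp: d_def intro!: ennreal_leI)
  also have "\<dots> = dyadic_osc g 0 c l + (\<integral>\<^sup>+x\<in>?Q. ennreal \<bar>b x - g x\<bar> \<partial>lebesgue) + ennreal d * emeasure lebesgue ?Q"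
    by (simp add: nn_integral_add nn_integral_cmult_indicator del: emeasure_completion)
  also have "ennreal d * emeasure lebesgue ?Q = ennreal (d * l ^ CARD('n))"
    using 0 by (simp add: emeasure_cube d_def ennreal_mult del: emeasure_completion)
  also note d
  finally show ?case by (simp add: mult_2 add.assoc add_left_mono)
next
  case (Suc k)
  note [measurable] = loc_integrable_measurable[OF b] loc_integrable_measurable[OF g]
  have "dyadic_osc b (Suc k) c l \<le> (\<Sum>\<sigma>\<in>UNIV. dyadic_osc g k (child_center c l \<sigma>) (l / 2) +
       2 * (\<integral>\<^sup>+x\<in>cube (child_center c l \<sigma>) (l / 2). ennreal \<bar>b x - g x\<bar> \<partial>lebesgue))"
    using Suc by (auto intro!: sum_mono)
  also have "\<dots> = dyadic_osc g (Suc k) c l + 2 * (\<integral>\<^sup>+x\<in>cube c l. ennreal \<bar>b x - g x\<bar> \<partial>lebesgue)"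
    using Suc.prems by (simp add: sum.distrib sum_distrib_left nn_integral_children[of l _ c])
  finally show ?case .
qed

text \<open>After \<open>k\<close> halvings two points of one descendant differ by at most
  \<open>l / 2 ^ k\<close> in each coordinate, so there \<open>g\<close> is within \<open>d\<close>
  of any of its values and hence of its mean.\<close>

lemma dyadic_osc_uniform:
  fixes c :: "real^'n"
  assumes g: "loc_integrable g" and l: "l > 0" and d: "d \<ge> 0"
    and osc: "\<And>x y. x \<in> cube c l \<Longrightarrow> y \<in> cube c l \<Longrightarrow> (\<And>i. \<bar>x $ i - y $ i\<bar> \<le> l / 2 ^ k) \<Longrightarrow> \<bar>g x - g y\<bar> \<le> d"
  shows "dyadic_osc g k c l \<le> ennreal (d * l ^ CARD('n))"
  using l osc
proof (induction k arbitrary: c l)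
  case 0
  let ?Q = "cube c l"
  have vol: "emeasure lebesgue ?Q = ennreal (l ^ CARD('n))" using 0 by (simp add: emeasure_cube del: emeasure_completion)
  have "\<bar>g x - mean ?Q g\<bar> \<le> d" if x: "x \<in> ?Q" for x
  proof -
    have "ennreal (\<bar>mean ?Q g - g x\<bar> * l ^ CARD('n)) \<le> (\<integral>\<^sup>+y\<in>?Q. ennreal \<bar>g y - g x\<bar> \<partial>lebesgue)"
      by (rule mean_diff_le[OF g 0(1)])
    also have "\<dots> \<le> (\<integral>\<^sup>+y\<in>?Q. ennreal d \<partial>lebesgue)"
    proof (intro nn_integral_mono)
      fix y
      have "\<bar>g y - g x\<bar> \<le> d" if y: "y \<in> ?Q"
      proof (rule 0(2)[OF y x])
        fix i show "\<bar>y $ i - x $ i\<bar> \<le> l / 2 ^ 0"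
          using x[unfolded mem_cube, rule_format, of i] y[unfolded mem_cube, rule_format, of i]
            unfolding power_0 div_by_1 by argo
      qed
      then show "ennreal \<bar>g y - g x\<bar> * indicator ?Q y \<le> ennreal d * indicator ?Q y"
        by (auto split: split_indicator intro: ennreal_leI)
    qed
    also have "\<dots> = ennreal (d * l ^ CARD('n))"
      using d 0 by (simp add: nn_integral_cmult_indicator vol ennreal_mult del: emeasure_completion)
    finally have "\<bar>mean ?Q g - g x\<bar> * l ^ CARD('n) \<le> d * l ^ CARD('n)"
      using d 0 by (simp add: ennreal_le_iff)
    then show ?thesis using 0 by (simp add: abs_minus_commute)
  qed
  then have "dyadic_osc g 0 c l \<le> (\<integral>\<^sup>+y\<in>?Q. ennreal d \<partial>lebesgue)"
    by (auto intro!: nn_integral_mono ennreal_leI split: split_indicator)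
  also have "\<dots> = ennreal (d * l ^ CARD('n))"
    using d 0 by (simp add: nn_integral_cmult_indicator vol ennreal_mult del: emeasure_completion)
  finally show ?case .
next
  case (Suc k)
  have sub: "cube (child_center c l \<sigma>) (l / 2) \<subseteq> cube c l" for \<sigma>
    using Suc.prems by (intro child_subset) auto
  have "dyadic_osc g k (child_center c l \<sigma>) (l / 2) \<le> ennreal (d * (l / 2) ^ CARD('n))" for \<sigma>
  proof (rule Suc.IH)
    show "0 < l / 2" using Suc.prems by simp
    fix x y assume "x \<in> cube (child_center c l \<sigma>) (l / 2)" "y \<in> cube (child_center c l \<sigma>) (l / 2)"
      and "\<And>i. \<bar>x $ i - y $ i\<bar> \<le> l / 2 / 2 ^ k"
    then show "\<bar>g x - g y\<bar> \<le> d" using sub[of \<sigma>] by (intro Suc.prems(2)) auto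
  qed
  then have "dyadic_osc g (Suc k) c l \<le> (\<Sum>\<sigma>\<in>(UNIV::'n set set). ennreal (d * (l / 2) ^ CARD('n)))"
    by (auto intro!: sum_mono simp del: sum_constant)
  also have "\<dots> = ennreal (\<Sum>\<sigma>\<in>(UNIV::'n set set). d * (l / 2) ^ CARD('n))"
    using d Suc.prems by (intro sum_ennreal) auto
  also have "\<dots> = ennreal (d * l ^ CARD('n))"
    using sum_children_volume[of l, where 'n='n] by (simp only: sum_distrib_left[symmetric])
  finally show ?case .
qed

section \<open>Approximation by continuous functions and decay of the dyadic oscillation\<close>

lemma loc_integrable_continuous:
  fixes g :: "real^'n \<Rightarrow> real" 
  assumes "continuous_on UNIV g" shows "loc_integrable g"
  unfolding loc_integrable_def
  using borel_integrable_compact[OF _ continuous_on_subset[OF assms]]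
  by (auto simp: set_integrable_def integrable_completion)

text \<open>Measurability supplies continuous functions that converge almost everywhere, but without
  a majorant. Clamping all functions to \<open>[-k, k]\<close> supplies the majorant
  \<open>2 k\<close> and preserves continuity; the error of clamping \<open>b\<close> itself is
  small for large \<open>k\<close>, again by dominated convergence.\<close>

lemma continuous_L1_approx:
  fixes b :: "real^'n \<Rightarrow> real"
  assumes b: "loc_integrable b" and e: "e > 0"
  obtains g where "continuous_on UNIV g" "(\<integral>\<^sup>+x\<in>cube c l. ennreal \<bar>b x - g x\<bar> \<partial>lebesgue) < ennreal e"
proof -
  let ?Q = "cube c l"
  note [measurable] = loc_integrable_measurable[OF b]
  define cl :: "real \<Rightarrow> real \<Rightarrow> real" where "cl k x = max (- k) (min x k)" for k x
  have [measurable]: "cl k \<in> borel_measurable borel" for k unfolding cl_def by measurable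
  have fin: "(\<integral>\<^sup>+x. ennreal k * indicator ?Q x \<partial>lebesgue) < \<infinity>" for k
    unfolding nn_integral_cmult_indicator[OF sets_cube]
    using emeasure_lborel_cbox_finite[of "c - vec (l / 2)" "c + vec (l / 2)"]
    by (auto simp: cube_def ennreal_mult_less_top)
  have "(\<lambda>k. \<integral>\<^sup>+x\<in>?Q. ennreal \<bar>b x - cl (real k) (b x)\<bar> \<partial>lebesgue) \<longlonglongrightarrow> (\<integral>\<^sup>+x. 0 \<partial>(lebesgue :: (real^'n) measure))"
  proof (rule nn_integral_dominated_convergence[where w="\<lambda>x. ennreal \<bar>b x\<bar> * indicator ?Q x"])
    show "AE x in lebesgue. (\<lambda>k. ennreal \<bar>b x - cl (real k) (b x)\<bar> * indicator ?Q x) \<longlonglongrightarrow> 0"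
    proof (rule AE_I2)
      fix x
      obtain K where "\<bar>b x\<bar> \<le> real K" using real_arch_simple by blast
      then have "\<forall>\<^sub>F k in sequentially. ennreal \<bar>b x - cl (real k) (b x)\<bar> * indicator ?Q x = 0"
        by (intro eventually_sequentiallyI[of K]) (auto simp: cl_def)
      then show "(\<lambda>k. ennreal \<bar>b x - cl (real k) (b x)\<bar> * indicator ?Q x) \<longlonglongrightarrow> 0"
        by (rule tendsto_eventually)
    qed
    show "(\<integral>\<^sup>+x\<in>?Q. ennreal \<bar>b x\<bar> \<partial>lebesgue) < \<infinity>" using loc_integrable_nn_finite[OF b] by simp
    show "AE x in lebesgue. ennreal \<bar>b x - cl (real j) (b x)\<bar> * indicator ?Q x \<le> ennreal \<bar>b x\<bar> * indicator ?Q x" for j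
      by (intro AE_I2) (auto simp: cl_def intro!: ennreal_leI split: split_indicator)
  qed measurable
  then have "\<forall>\<^sub>F k in sequentially. (\<integral>\<^sup>+x\<in>?Q. ennreal \<bar>b x - cl (real k) (b x)\<bar> \<partial>lebesgue) < ennreal (e / 2)"
    using e by (intro order_tendstoD(2)) auto
  then obtain k where k: "(\<integral>\<^sup>+x\<in>?Q. ennreal \<bar>b x - cl (real k) (b x)\<bar> \<partial>lebesgue) < ennreal (e / 2)"
    by (auto dest: eventually_happens)
  have "b measurable_on UNIV" by (rule lebesgue_measurable_imp_measurable_on) auto
  then obtain N g where N: "negligible N" and g: "\<And>n. continuous_on UNIV (g n)"
    and lim: "\<And>x. x \<notin> N \<Longrightarrow> (\<lambda>n. g n x) \<longlonglongrightarrow> b x"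
    unfolding measurable_on_def by auto
  have [measurable]: "g n \<in> borel_measurable lebesgue" for n
    by (intro borel_imp_lebesgue borel_measurable_continuous_onI g)
  have "(\<lambda>n. \<integral>\<^sup>+x\<in>?Q. ennreal \<bar>cl (real k) (b x) - cl (real k) (g n x)\<bar> \<partial>lebesgue) \<longlonglongrightarrow> (\<integral>\<^sup>+x. 0 \<partial>(lebesgue :: (real^'n) measure))"
  proof (rule nn_integral_dominated_convergence[where w="\<lambda>x. ennreal (2 * real k) * indicator ?Q x"])
    show "AE x in lebesgue. (\<lambda>n. ennreal \<bar>cl (real k) (b x) - cl (real k) (g n x)\<bar> * indicator ?Q x) \<longlonglongrightarrow> 0"
    proof (rule AE_I')
      show "N \<in> null_sets lebesgue" using N by (simp add: negligible_iff_null_sets)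
      have "(\<lambda>n. ennreal \<bar>cl (real k) (b x) - cl (real k) (g n x)\<bar> * indicator ?Q x) \<longlonglongrightarrow> 0" if "x \<notin> N" for x
      proof -
        have "(\<lambda>n. \<bar>cl (real k) (b x) - cl (real k) (g n x)\<bar>) \<longlonglongrightarrow> \<bar>cl (real k) (b x) - cl (real k) (b x)\<bar>"
          unfolding cl_def by (intro tendsto_intros lim that)
        then have "(\<lambda>n. ennreal \<bar>cl (real k) (b x) - cl (real k) (g n x)\<bar>) \<longlonglongrightarrow> ennreal 0"
          by (intro tendsto_ennrealI) simp
        then show ?thesis by (auto split: split_indicator)
      qed
      then show "{x \<in> space lebesgue. \<not> (\<lambda>n. ennreal \<bar>cl (real k) (b x) - cl (real k) (g n x)\<bar> * indicator ?Q x) \<longlonglongrightarrow> 0} \<subseteq> N"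
        by blast
    qed
    show "(\<integral>\<^sup>+x. ennreal (2 * real k) * indicator ?Q x \<partial>lebesgue) < \<infinity>" by (rule fin)
    show "AE x in lebesgue. ennreal \<bar>cl (real k) (b x) - cl (real k) (g j x)\<bar> * indicator ?Q x \<le> ennreal (2 * real k) * indicator ?Q x" for j
      by (intro AE_I2) (auto simp: cl_def intro!: ennreal_leI split: split_indicator)
  qed measurable
  then have "\<forall>\<^sub>F n in sequentially. (\<integral>\<^sup>+x\<in>?Q. ennreal \<bar>cl (real k) (b x) - cl (real k) (g n x)\<bar> \<partial>lebesgue) < ennreal (e / 2)"
    using e by (intro order_tendstoD(2)) auto
  then obtain n where n: "(\<integral>\<^sup>+x\<in>?Q. ennreal \<bar>cl (real k) (b x) - cl (real k) (g n x)\<bar> \<partial>lebesgue) < ennreal (e / 2)"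
    by (auto dest: eventually_happens)
  show thesis
  proof
    show "continuous_on UNIV (\<lambda>x. cl (real k) (g n x))"
      unfolding cl_def by (intro continuous_intros g)
    have "(\<integral>\<^sup>+x\<in>?Q. ennreal \<bar>b x - cl (real k) (g n x)\<bar> \<partial>lebesgue) \<le>
        (\<integral>\<^sup>+x. ennreal \<bar>b x - cl (real k) (b x)\<bar> * indicator ?Q x + ennreal \<bar>cl (real k) (b x) - cl (real k) (g n x)\<bar> * indicator ?Q x \<partial>lebesgue)"
      by (intro nn_integral_mono) (auto split: split_indicator simp flip: ennreal_plus intro!: ennreal_leI)
    also have "\<dots> = (\<integral>\<^sup>+x\<in>?Q. ennreal \<bar>b x - cl (real k) (b x)\<bar> \<partial>lebesgue) + (\<integral>\<^sup>+x\<in>?Q. ennreal \<bar>cl (real k) (b x) - cl (real k) (g n x)\<bar> \<partial>lebesgue)"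
      by (rule nn_integral_add) measurable
    also have "\<dots> < ennreal (e / 2) + ennreal (e / 2)" by (rule add_strict_mono[OF k n])
    also have "\<dots> = ennreal e" using e by (simp flip: ennreal_plus)
    finally show "(\<integral>\<^sup>+x\<in>?Q. ennreal \<bar>b x - cl (real k) (g n x)\<bar> \<partial>lebesgue) < ennreal e" .
  qed
qed

lemma norm_le_sup_cart:
  fixes x :: "real^'n"
  assumes "\<And>i. \<bar>x $ i\<bar> \<le> h"
  shows "norm x \<le> real CARD('n) * h"
proof -
  have "norm x \<le> (\<Sum>i\<in>UNIV. \<bar>x $ i\<bar>)" by (rule norm_le_l1_cart)
  also have "\<dots> \<le> (\<Sum>i\<in>(UNIV::'n set). h)" by (intro sum_mono assms)
  finally show ?thesis by simp
qed

lemma dyadic_osc_tendsto_0: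
  fixes b :: "real^'n \<Rightarrow> real"
  assumes b: "loc_integrable b" and l: "l > 0" and e: "e > 0"
  shows "\<exists>k. dyadic_osc b k c l \<le> ennreal e"
proof -
  obtain g where g: "continuous_on UNIV g" and gb: "(\<integral>\<^sup>+x\<in>cube c l. ennreal \<bar>b x - g x\<bar> \<partial>lebesgue) < ennreal (e / 4)"
    using continuous_L1_approx[OF b, of "e / 4" c l] e by auto
  have gi: "loc_integrable g" by (rule loc_integrable_continuous[OF g])
  define d where "d = e / 2 / l ^ CARD('n)"
  have d: "d > 0" using e l by (simp add: d_def)
  have "uniformly_continuous_on (cube c l) g"
    by (intro compact_uniformly_continuous continuous_on_subset[OF g]) (auto simp: cube_def)
  then obtain h where h: "h > 0" and uc: "\<And>x y. x \<in> cube c l \<Longrightarrow> y \<in> cube c l \<Longrightarrow> dist x y < h \<Longrightarrow> dist (g x) (g y) < d"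
    unfolding uniformly_continuous_on_def using d by metis
  \<comment> \<open>The norm is at most \<open>n\<close> times the largest coordinate, so this
    brings two points of one descendant closer than the modulus \<open>h\<close> of uniform
    continuity.\<close>
  obtain k where "real CARD('n) * l / h < 2 ^ k"
    using real_arch_pow[of 2] by auto
  then have k: "real CARD('n) * (l / 2 ^ k) < h" using h by (simp add: field_simps)
  have "dyadic_osc g k c l \<le> ennreal (d * l ^ CARD('n))"
  proof (rule dyadic_osc_uniform[OF gi l])
    fix x y assume xy: "x \<in> cube c l" "y \<in> cube c l" and "\<And>i. \<bar>x $ i - y $ i\<bar> \<le> l / 2 ^ k"
    then have "norm (x - y) \<le> real CARD('n) * (l / 2 ^ k)" by (intro norm_le_sup_cart) auto
    with k have "dist x y < h" by (simp add: dist_norm)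
    from uc[OF xy this] show "\<bar>g x - g y\<bar> \<le> d" by (simp add: dist_real_def)
  qed (use d in simp)
  also have "d * l ^ CARD('n) = e / 2" using l by (simp add: d_def)
  finally have "dyadic_osc b k c l \<le> ennreal (e / 2) + 2 * ennreal (e / 4)"
    using gb by (intro order_trans[OF dyadic_osc_approx[OF b gi l]] add_mono mult_left_mono) auto
  also have "\<dots> = ennreal e"
    using e by (simp flip: ennreal_plus add: ennreal_mult'[of 2, simplified, symmetric])
  finally show ?thesis by blast
qed

text \<open>The tangent at \<open>min u N\<close> lies below the convex exponential, and truncation
  bounds its slope. The constant \<open>\<kappa> * exp (\<kappa> * N)\<close> may be huge: it will
  multiply only an oscillation that is made arbitrarily small.\<close>

lemma exp_min_lipschitz:
  fixes u v N \<kappa> :: real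
  assumes "\<kappa> > 0" "v \<ge> 0"
  shows "exp (\<kappa> * min u N) \<le> exp (\<kappa> * v) + \<kappa> * exp (\<kappa> * N) * \<bar>u - v\<bar>"
proof (cases "min u N \<le> v")
  case True
  then have "exp (\<kappa> * min u N) \<le> exp (\<kappa> * v)" using assms by simp
  then show ?thesis using assms by (smt (verit) abs_ge_zero exp_ge_zero mult_nonneg_nonneg)
next
  case False
  define s where "s = min u N"
  have "1 + \<kappa> * (v - s) \<le> exp (\<kappa> * (v - s))" by (rule exp_ge_add_one_self)
  then have "exp (\<kappa> * s) * (1 + \<kappa> * (v - s)) \<le> exp (\<kappa> * s) * exp (\<kappa> * (v - s))"
    by (intro mult_left_mono) auto
  also have "\<dots> = exp (\<kappa> * v)" by (simp add: algebra_simps flip: exp_add)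
  finally have "exp (\<kappa> * s) \<le> exp (\<kappa> * v) + exp (\<kappa> * s) * (\<kappa> * (s - v))" by (simp add: algebra_simps)
  also have "exp (\<kappa> * s) * (\<kappa> * (s - v)) \<le> exp (\<kappa> * N) * (\<kappa> * \<bar>u - v\<bar>)"
    using assms False by (intro mult_mono mult_nonneg_nonneg) (auto simp: s_def)
  finally show ?thesis by (simp add: s_def mult_ac)
qed

text \<open>The truncation at \<open>N\<close> makes the integral finite in advance, as the
  absorption of \<open>S\<close> requires. The center \<open>a\<close> is a separate argument
  because the mean of the starting cube is kept while the subcubes shrink.\<close>

definition exp_osc :: "(real^'n \<Rightarrow> real) \<Rightarrow> real \<Rightarrow> real \<Rightarrow> real^'n \<Rightarrow> real \<Rightarrow> real \<Rightarrow> ennreal" where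
  "exp_osc b \<kappa> N c l a = (\<integral>\<^sup>+x\<in>cube c l. ennreal (exp (\<kappa> * min \<bar>b x - a\<bar> N)) \<partial>lebesgue)"

text \<open>A Calderon--Zygmund stopping argument unrolled as an induction over dyadic levels: a child on
  which the average of \<open>\<bar>b - a\<bar>\<close> exceeds \<open>t\<close> is not divided further, and the a priori
  bound \<open>S\<close> is used there.\<close>

lemma exp_osc_stopping:
  fixes b :: "real^'n \<Rightarrow> real"
  assumes b: "loc_integrable b" and pos: "t > 0" "\<kappa> > 0" "S \<ge> 0" "N \<ge> 0"
    and S: "\<And>c l. l > 0 \<Longrightarrow> exp_osc b \<kappa> N c l (mean (cube c l) b) \<le> ennreal (S * l ^ CARD('n))"
    and l: "l > 0" and small: "(\<integral>\<^sup>+x\<in>cube c l. ennreal \<bar>b x - a\<bar> \<partial>lebesgue) \<le> ennreal (t * l ^ CARD('n))"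
  shows "exp_osc b \<kappa> N c l a \<le> ennreal (exp (\<kappa> * t) * l ^ CARD('n))
     + ennreal (exp (\<kappa> * (2 ^ CARD('n) * t)) * S / t) * (\<integral>\<^sup>+x\<in>cube c l. ennreal \<bar>b x - a\<bar> \<partial>lebesgue)
     + ennreal (\<kappa> * exp (\<kappa> * N)) * dyadic_osc b k c l"
  using l small
proof (induction k arbitrary: c l)
  case 0
  let ?Q = "cube c l"
  note [measurable] = loc_integrable_measurable[OF b]
  have "ennreal (\<bar>mean ?Q b - a\<bar> * l ^ CARD('n)) \<le> ennreal (t * l ^ CARD('n))"
    by (rule order_trans[OF mean_diff_le[OF b 0(1)] 0(2)])
  then have m: "\<bar>mean ?Q b - a\<bar> \<le> t" using 0(1) pos by (simp add: ennreal_le_iff)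
  have "exp (\<kappa> * min \<bar>b x - a\<bar> N) \<le> exp (\<kappa> * t) + \<kappa> * exp (\<kappa> * N) * \<bar>b x - mean ?Q b\<bar>" for x
  proof -
    have "exp (\<kappa> * min \<bar>b x - a\<bar> N) \<le> exp (\<kappa> * \<bar>mean ?Q b - a\<bar>) + \<kappa> * exp (\<kappa> * N) * \<bar>\<bar>b x - a\<bar> - \<bar>mean ?Q b - a\<bar>\<bar>"
      by (rule exp_min_lipschitz) (use pos in auto)
    also have "\<dots> \<le> exp (\<kappa> * t) + \<kappa> * exp (\<kappa> * N) * \<bar>b x - mean ?Q b\<bar>"
      using m pos by (intro add_mono mult_left_mono) auto
    finally show ?thesis .
  qed
  then have "exp_osc b \<kappa> N c l a \<le> (\<integral>\<^sup>+x. ennreal (exp (\<kappa> * t)) * indicator ?Q x + ennreal (\<kappa> * exp (\<kappa> * N)) * (ennreal \<bar>b x - mean ?Q b\<bar> * indicator ?Q x) \<partial>lebesgue)"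
    unfolding exp_osc_def using pos
    by (intro nn_integral_mono) (auto split: split_indicator simp flip: ennreal_plus ennreal_mult intro!: ennreal_leI)
  also have "\<dots> = ennreal (exp (\<kappa> * t)) * emeasure lebesgue ?Q + ennreal (\<kappa> * exp (\<kappa> * N)) * dyadic_osc b 0 c l"
    by (simp add: nn_integral_add nn_integral_cmult nn_integral_cmult_indicator del: emeasure_completion)
  also have "ennreal (exp (\<kappa> * t)) * emeasure lebesgue ?Q = ennreal (exp (\<kappa> * t) * l ^ CARD('n))"
    using 0 by (simp add: emeasure_cube ennreal_mult del: emeasure_completion)
  finally show ?case by (simp add: add_increasing2 add.assoc order_trans[OF _ add_left_mono] add_increasing)
next
  case (Suc k)
  note [measurable] = loc_integrable_measurable[OF b]
  let ?I = "\<lambda>c l. \<integral>\<^sup>+x\<in>cube c l. ennreal \<bar>b x - a\<bar> \<partial>lebesgue"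
  let ?K = "exp (\<kappa> * (2 ^ CARD('n) * t)) * S / t"
  let ?L = "\<kappa> * exp (\<kappa> * N)"
  let ?c = "child_center c l"
  have l2: "l / 2 > 0" using Suc.prems by simp
  have child: "exp_osc b \<kappa> N (?c \<sigma>) (l / 2) a \<le> ennreal (exp (\<kappa> * t) * (l / 2) ^ CARD('n))
      + ennreal ?K * ?I (?c \<sigma>) (l / 2) + ennreal ?L * dyadic_osc b k (?c \<sigma>) (l / 2)" for \<sigma>
  proof (cases "?I (?c \<sigma>) (l / 2) \<le> ennreal (t * (l / 2) ^ CARD('n))")
    case True
    then show ?thesis by (rule Suc.IH[OF l2])
  next
    case False
    let ?R = "cube (?c \<sigma>) (l / 2)"
    let ?m = "mean ?R b"
    have "ennreal (\<bar>?m - a\<bar> * (l / 2) ^ CARD('n)) \<le> ?I (?c \<sigma>) (l / 2)"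
      by (rule mean_diff_le[OF b l2])
    also have "\<dots> \<le> ?I c l"
      using child_subset[of l c \<sigma>] Suc.prems by (intro nn_integral_mono) (auto split: split_indicator)
    also have "\<dots> \<le> ennreal (t * l ^ CARD('n))" by (rule Suc.prems)
    finally have "\<bar>?m - a\<bar> * (l / 2) ^ CARD('n) \<le> t * l ^ CARD('n)"
      using Suc.prems pos by (simp add: ennreal_le_iff)
    \<comment> \<open>The child inherits the integral bound of its parent; \<open>2 ^ n\<close> is
      the ratio of the volumes.\<close>
    then have m: "\<bar>?m - a\<bar> \<le> 2 ^ CARD('n) * t"
      using Suc.prems by (simp add: power_divide field_simps)
    have "exp_osc b \<kappa> N (?c \<sigma>) (l / 2) a \<le> (\<integral>\<^sup>+x. ennreal (exp (\<kappa> * (2 ^ CARD('n) * t))) * (ennreal (exp (\<kappa> * min \<bar>b x - ?m\<bar> N)) * indicator ?R x) \<partial>lebesgue)"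
      unfolding exp_osc_def
    proof (intro nn_integral_mono)
      fix x
      have "min \<bar>b x - a\<bar> N \<le> 2 ^ CARD('n) * t + min \<bar>b x - ?m\<bar> N" using m pos by (auto simp: min_def)
      then have "\<kappa> * min \<bar>b x - a\<bar> N \<le> \<kappa> * (2 ^ CARD('n) * t + min \<bar>b x - ?m\<bar> N)"
        using pos by (intro mult_left_mono) auto
      then have "exp (\<kappa> * min \<bar>b x - a\<bar> N) \<le> exp (\<kappa> * (2 ^ CARD('n) * t)) * exp (\<kappa> * min \<bar>b x - ?m\<bar> N)"
        unfolding exp_add[symmetric] by (simp add: distrib_left)
      then show "ennreal (exp (\<kappa> * min \<bar>b x - a\<bar> N)) * indicator ?R x
          \<le> ennreal (exp (\<kappa> * (2 ^ CARD('n) * t))) * (ennreal (exp (\<kappa> * min \<bar>b x - ?m\<bar> N)) * indicator ?R x)"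
        by (auto split: split_indicator simp flip: ennreal_mult intro!: ennreal_leI)
    qed
    also have "\<dots> = ennreal (exp (\<kappa> * (2 ^ CARD('n) * t))) * exp_osc b \<kappa> N (?c \<sigma>) (l / 2) ?m"
      unfolding exp_osc_def by (intro nn_integral_cmult) measurable
    also have "\<dots> \<le> ennreal (exp (\<kappa> * (2 ^ CARD('n) * t))) * ennreal (S * (l / 2) ^ CARD('n))"
      by (intro mult_left_mono S l2) simp
    \<comment> \<open>On a stopped child the integral of \<open>\<bar>b - a\<bar>\<close> exceeds
      \<open>t\<close> times the volume, so the volume is charged to that integral. The charges of
      all children add up to the integral over the parent.\<close>
    also have "\<dots> = ennreal ?K * ennreal (t * (l / 2) ^ CARD('n))"
      using pos l2 by (simp add: field_simps flip: ennreal_mult)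
    also have "\<dots> \<le> ennreal ?K * ?I (?c \<sigma>) (l / 2)"
      using False by (intro mult_left_mono) auto
    finally show ?thesis by (simp add: add_increasing2 add_increasing)
  qed
  have "exp_osc b \<kappa> N c l a = (\<Sum>\<sigma>\<in>UNIV. exp_osc b \<kappa> N (?c \<sigma>) (l / 2) a)"
    unfolding exp_osc_def by (rule nn_integral_children[OF Suc.prems(1)]) measurable
  also have "\<dots> \<le> (\<Sum>\<sigma>\<in>UNIV. ennreal (exp (\<kappa> * t) * (l / 2) ^ CARD('n))
      + ennreal ?K * ?I (?c \<sigma>) (l / 2) + ennreal ?L * dyadic_osc b k (?c \<sigma>) (l / 2))"
    by (intro sum_mono child)
  also have "\<dots> = (\<Sum>\<sigma>\<in>(UNIV::'n set set). ennreal (exp (\<kappa> * t) * (l / 2) ^ CARD('n)))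
      + ennreal ?K * ?I c l + ennreal ?L * dyadic_osc b (Suc k) c l"
    using nn_integral_children[OF Suc.prems(1), of "\<lambda>x. ennreal \<bar>b x - a\<bar>" c]
    by (simp add: sum.distrib sum_distrib_left del: sum_constant)
  also have "(\<Sum>\<sigma>\<in>(UNIV::'n set set). ennreal (exp (\<kappa> * t) * (l / 2) ^ CARD('n))) = ennreal (\<Sum>\<sigma>\<in>(UNIV::'n set set). exp (\<kappa> * t) * (l / 2) ^ CARD('n))"
    using Suc.prems by (intro sum_ennreal) auto
  also have "\<dots> = ennreal (exp (\<kappa> * t) * l ^ CARD('n))"
    using sum_children_volume[of l, where 'n='n] by (simp only: sum_distrib_left[symmetric])
  finally show ?case .
qed

lemma ennreal_le_mult_of_divide_le:
  assumes "0 < v" "0 \<le> s" "x / ennreal v \<le> ennreal s"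
  shows "x \<le> ennreal (s * v)"
proof (cases x)
  case (real r)
  then show ?thesis using assms by (simp add: divide_ennreal ennreal_le_iff pos_divide_le_eq)
next
  case top
  then show ?thesis using assms by (simp add: ennreal_top_divide top_unique)
qed

text \<open>Let \<open>S\<close> be the best constant for the truncated exponential over all cubes,
  which is finite for each \<open>N\<close>. The stopping estimate gives
  \<open>S \<le> 2 + S / 2\<close>, so \<open>S \<le> 4\<close> whatever \<open>N\<close> is, and
  \<open>N\<close> can be sent to infinity.\<close>

theorem John_Nirenberg:
  fixes b :: "real^'n \<Rightarrow> real"
  assumes "b \<in> BMO"
  obtains \<kappa> where "\<kappa> > 0"
    "\<And>c l. l > 0 \<Longrightarrow> (\<integral>\<^sup>+x\<in>cube c l. ennreal (exp (\<kappa> * \<bar>b x - mean (cube c l) b\<bar>)) \<partial>lebesgue) \<le> 4 * emeasure lebesgue (cube c l)"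
proof -
  have b: "loc_integrable b" and fin: "bmo_norm b < \<infinity>" using assms by (auto simp: BMO_def)
  note [measurable] = loc_integrable_measurable[OF b]
  obtain B0 where B0: "bmo_norm b = ennreal B0" "B0 \<ge> 0" using fin by (cases "bmo_norm b") auto
  \<comment> \<open>The summand one keeps \<open>B\<close> positive when the BMO norm is
    zero.\<close>
  define B where "B = B0 + 1"
  have B: "B > 0" "bmo_norm b \<le> ennreal B"
    using B0 by (auto simp: B_def intro: ennreal_leI)
  have osc: "(\<integral>\<^sup>+x\<in>cube c l. ennreal \<bar>b x - mean (cube c l) b\<bar> \<partial>lebesgue) \<le> ennreal (B * l ^ CARD('n))" if l: "l > 0" for c l
  proof -
    let ?I = "\<integral>\<^sup>+x\<in>cube c l. ennreal \<bar>b x - mean (cube c l) b\<bar> \<partial>lebesgue"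
    have "avg (cube c l) (\<lambda>x. ennreal \<bar>b x - mean (cube c l) b\<bar>) \<le> bmo_norm b"
      unfolding bmo_norm_def using l by (intro SUP_upper2[of "(c, l)"]) auto
    then have "?I / ennreal (l ^ CARD('n)) \<le> ennreal B"
      using B l unfolding avg_def by (simp add: emeasure_cube del: emeasure_completion)
    then show ?thesis using l B by (intro ennreal_le_mult_of_divide_le) auto
  qed
  \<comment> \<open>The choice of \<open>\<kappa>\<close> makes
    \<open>exp (\<kappa> * (2 ^ n * t))\<close> equal to \<open>2\<close>, and
    \<open>t = 4 * B\<close> then turns the coefficient of the charged term,
    \<open>2 * s / t * B\<close>, into \<open>s / 2\<close>, which can be absorbed.\<close>
  define t where "t = 4 * B"
  define \<kappa> where "\<kappa> = ln 2 / (2 ^ CARD('n) * t)"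
  have t: "t > 0" using B by (simp add: t_def)
  have lam: "\<kappa> > 0" using t by (simp add: \<kappa>_def)
  have e2: "exp (\<kappa> * (2 ^ CARD('n) * t)) = 2" using t by (simp add: \<kappa>_def)
  have "\<kappa> * t \<le> \<kappa> * (2 ^ CARD('n) * t)" using lam t by simp
  then have "exp (\<kappa> * t) \<le> exp (\<kappa> * (2 ^ CARD('n) * t))" by simp
  then have e1: "exp (\<kappa> * t) \<le> 2" by (simp only: e2)
  have trunc: "exp_osc b \<kappa> N c l (mean (cube c l) b) \<le> ennreal (4 * l ^ CARD('n))" if N: "N \<ge> 0" and l: "l > 0" for N c l
  proof -
    define S where "S = (SUP (c, l) \<in> UNIV \<times> {0<..}. exp_osc b \<kappa> N c l (mean (cube c l) b) / ennreal (l ^ CARD('n)))"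
    have "S \<le> ennreal (exp (\<kappa> * N))" unfolding S_def
    proof (safe intro!: SUP_least)
      fix c :: "real^'n" and l :: real assume l: "l > 0"
      have "exp_osc b \<kappa> N c l (mean (cube c l) b) \<le> (\<integral>\<^sup>+x\<in>cube c l. ennreal (exp (\<kappa> * N)) \<partial>lebesgue)"
        unfolding exp_osc_def using lam by (intro nn_integral_mono) (auto split: split_indicator intro!: ennreal_leI)
      also have "\<dots> = ennreal (exp (\<kappa> * N) * l ^ CARD('n))"
        using l by (simp add: nn_integral_cmult_indicator emeasure_cube ennreal_mult del: emeasure_completion)
      finally have "exp_osc b \<kappa> N c l (mean (cube c l) b) / ennreal (l ^ CARD('n)) \<le> ennreal (exp (\<kappa> * N) * l ^ CARD('n)) / ennreal (l ^ CARD('n))"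
        by (rule divide_right_mono_ennreal)
      then show "exp_osc b \<kappa> N c l (mean (cube c l) b) / ennreal (l ^ CARD('n)) \<le> ennreal (exp (\<kappa> * N))"
        using l by (simp add: divide_ennreal)
    qed
    then obtain s where s: "S = ennreal s" "s \<ge> 0" by (cases S) (auto simp: top_unique)
    have S: "exp_osc b \<kappa> N c l (mean (cube c l) b) \<le> ennreal (s * l ^ CARD('n))" if l: "l > 0" for c l
    proof -
      have "exp_osc b \<kappa> N c l (mean (cube c l) b) / ennreal (l ^ CARD('n)) \<le> ennreal s"
        unfolding s(1)[symmetric] S_def using l by (intro SUP_upper2[of "(c, l)"]) auto
      then show ?thesis using l s by (intro ennreal_le_mult_of_divide_le) auto
    qed
    have half: "exp_osc b \<kappa> N c l (mean (cube c l) b) \<le> ennreal ((2 + s / 2) * l ^ CARD('n))" if l: "l > 0" for c l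
    proof (rule ennreal_le_epsilon)
      fix e :: real assume e: "e > 0"
      let ?L = "\<kappa> * exp (\<kappa> * N)"
      have L: "?L > 0" using lam by simp
      \<comment> \<open>The number of generations is chosen after \<open>N\<close> and the cube; it
        need not be uniform, since it does not appear in the resulting bound.\<close>
      obtain k where k: "dyadic_osc b k c l \<le> ennreal (e / ?L)"
        using dyadic_osc_tendsto_0[OF b l, of "e / ?L" c] e L by auto
      have "exp_osc b \<kappa> N c l (mean (cube c l) b) \<le> ennreal (exp (\<kappa> * t) * l ^ CARD('n))
         + ennreal (exp (\<kappa> * (2 ^ CARD('n) * t)) * s / t) * (\<integral>\<^sup>+x\<in>cube c l. ennreal \<bar>b x - mean (cube c l) b\<bar> \<partial>lebesgue)
         + ennreal ?L * dyadic_osc b k c l"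
        using B l by (intro exp_osc_stopping b t lam s N S order_trans[OF osc]) (auto simp: t_def intro!: ennreal_leI)
      also have "\<dots> \<le> ennreal (2 * l ^ CARD('n)) + ennreal (2 * s / t) * ennreal (B * l ^ CARD('n)) + ennreal ?L * ennreal (e / ?L)"
        using e1 e2 l by (intro add_mono mult_mono osc k) (auto intro!: ennreal_leI)
      also have "\<dots> = ennreal (2 * l ^ CARD('n) + 2 * s / t * (B * l ^ CARD('n)) + e)"
        using s t l B L e lam by (simp flip: ennreal_mult ennreal_plus)
      also have "2 * s / t * (B * l ^ CARD('n)) = s / 2 * l ^ CARD('n)"
        using B by (simp add: t_def)
      also have "ennreal (2 * l ^ CARD('n) + s / 2 * l ^ CARD('n) + e) = ennreal ((2 + s / 2) * l ^ CARD('n)) + ennreal e"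
        using s l e by (simp add: algebra_simps flip: ennreal_plus)
      finally show "exp_osc b \<kappa> N c l (mean (cube c l) b) \<le> ennreal ((2 + s / 2) * l ^ CARD('n)) + ennreal e" .
    qed
    have "S \<le> ennreal (2 + s / 2)" unfolding S_def
    proof (safe intro!: SUP_least)
      fix c :: "real^'n" and l :: real assume l: "l > 0"
      have "exp_osc b \<kappa> N c l (mean (cube c l) b) / ennreal (l ^ CARD('n)) \<le> ennreal ((2 + s / 2) * l ^ CARD('n)) / ennreal (l ^ CARD('n))"
        by (rule divide_right_mono_ennreal[OF half[OF l]])
      then show "exp_osc b \<kappa> N c l (mean (cube c l) b) / ennreal (l ^ CARD('n)) \<le> ennreal (2 + s / 2)"
        using l s by (simp add: divide_ennreal)
    qed
    then have "s \<le> 2 + s / 2" using s(2) unfolding s(1) by (subst (asm) ennreal_le_iff) auto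
    then have "s \<le> 4" by simp
    then have "s * l ^ CARD('n) \<le> 4 * l ^ CARD('n)" using l by (intro mult_right_mono) auto
    with S[OF l, of c] show ?thesis by (meson ennreal_leI order_trans)
  qed
  show thesis
  proof
    show "\<kappa> > 0" by (rule lam)
    fix c :: "real^'n" and l :: real assume l: "l > 0"
    let ?u = "\<lambda>x. \<bar>b x - mean (cube c l) b\<bar>"
    \<comment> \<open>The constant \<open>4\<close> is free of \<open>N\<close>, so Fatou's lemma
      removes the truncation.\<close>
    let ?f = "\<lambda>N x. ennreal (exp (\<kappa> * min (?u x) (real N))) * indicator (cube c l) x"
    have "(\<integral>\<^sup>+x\<in>cube c l. ennreal (exp (\<kappa> * ?u x)) \<partial>lebesgue) = (\<integral>\<^sup>+x. liminf (\<lambda>N. ?f N x) \<partial>lebesgue)"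
    proof (intro nn_integral_cong)
      fix x
      obtain K where "?u x \<le> real K" using real_arch_simple by blast
      then have "\<forall>\<^sub>F N in sequentially. ?f N x = ennreal (exp (\<kappa> * ?u x)) * indicator (cube c l) x"
        by (intro eventually_sequentiallyI[of K]) (auto simp: min_def)
      then have "(\<lambda>N. ?f N x) \<longlonglongrightarrow> ennreal (exp (\<kappa> * ?u x)) * indicator (cube c l) x"
        by (rule tendsto_eventually)
      then show "ennreal (exp (\<kappa> * ?u x)) * indicator (cube c l) x = liminf (\<lambda>N. ?f N x)"
        by (simp add: lim_imp_Liminf)
    qed
    also have "\<dots> \<le> liminf (\<lambda>N. \<integral>\<^sup>+x. ?f N x \<partial>lebesgue)"
      by (rule nn_integral_liminf) measurable
    also have "\<dots> \<le> liminf (\<lambda>N::nat. ennreal (4 * l ^ CARD('n)))"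
      using trunc[OF _ l, of _ c] by (intro Liminf_mono always_eventually) (auto simp: exp_osc_def)
    also have "\<dots> = 4 * emeasure lebesgue (cube c l)"
      using l by (simp add: emeasure_cube ennreal_mult' Liminf_const del: emeasure_completion)
    finally show "(\<integral>\<^sup>+x\<in>cube c l. ennreal (exp (\<kappa> * ?u x)) \<partial>lebesgue) \<le> 4 * emeasure lebesgue (cube c l)" .
  qed
qed

section \<open>Pairing exponential integrability with the logarithmic bump\<close>

lemma powr_le_exp:
  fixes u k \<kappa> :: real
  assumes "u \<ge> 0" "k > 0" "\<kappa> > 0"
  shows "u powr k \<le> (k / \<kappa>) powr k * exp (\<kappa> * u)"
proof -
  have "\<kappa> * u / k \<le> exp (\<kappa> * u / k)" using exp_ge_add_one_self[of "\<kappa> * u / k"] by linarith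
  then have "(\<kappa> * u / k) powr k \<le> exp (\<kappa> * u / k) powr k"
    using assms by (intro powr_mono2) auto
  also have "\<dots> = exp (\<kappa> * u)" using assms by (simp add: powr_def)
  finally have "(k / \<kappa>) powr k * (\<kappa> * u / k) powr k \<le> (k / \<kappa>) powr k * exp (\<kappa> * u)"
    by (intro mult_left_mono) auto
  then show ?thesis using assms by (simp flip: powr_mult)
qed

text \<open>This is why the bump carries one logarithm to the power \<open>r\<close>. If
  \<open>u\<close> is at most \<open>K\<close> times \<open>1 + log_plus v\<close>, the bump alone
  dominates. Otherwise \<open>v < exp (u / K)\<close> up to equality, and
  \<open>K = 2 * r / \<kappa>\<close> is chosen so that \<open>v powr r\<close> costs half of the
  exponential; the other half pays for \<open>u powr r\<close>.\<close>

lemma exp_log_Young: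
  fixes \<kappa> r :: real
  assumes \<kappa>: "\<kappa> > 0" and r: "r > 0"
  obtains C where "C > 0" "\<And>u v. u \<ge> 0 \<Longrightarrow> v \<ge> 0 \<Longrightarrow>
    (u * v) powr r \<le> C * (exp (\<kappa> * u) + v powr r * (1 + log_plus v) powr r)"
proof -
  define K where "K = 2 * r / \<kappa>"
  define M where "M = (r / (\<kappa> / 2)) powr r"
  have K: "K > 0" using \<kappa> r by (simp add: K_def)
  have M: "M > 0" using \<kappa> r by (simp add: M_def)
  have "(u * v) powr r \<le> (K powr r + M) * (exp (\<kappa> * u) + v powr r * (1 + log_plus v) powr r)"
    if u: "u \<ge> 0" and v: "v \<ge> 0" for u v
  proof (cases "u \<le> K * (1 + log_plus v)")
    case True
    have lp: "log_plus v \<ge> 0" by (simp add: log_plus_def)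
    have "(u * v) powr r \<le> (K * (v * (1 + log_plus v))) powr r"
      using True u v r mult_right_mono[OF True v] by (intro powr_mono2) (auto simp: mult_ac)
    also have "\<dots> = K powr r * (v powr r * (1 + log_plus v) powr r)"
      using K v lp by (simp add: powr_mult)
    also have "\<dots> \<le> (K powr r + M) * (exp (\<kappa> * u) + v powr r * (1 + log_plus v) powr r)"
      using M by (intro mult_mono) auto
    finally show ?thesis .
  next
    case False
    then have "log_plus v \<le> u / K" using K by (simp add: field_simps)
    then have "v \<le> exp (u / K)"
    proof (cases "v = 0")
      case False
      then have "ln v \<le> u / K" using v \<open>log_plus v \<le> u / K\<close> by (simp add: log_plus_def split: if_splits)
      then show ?thesis using False v by (metis exp_le_cancel_iff exp_ln less_le)
    qed auto
    then have "v powr r \<le> exp (u / K) powr r" using v r by (intro powr_mono2) auto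
    also have "\<dots> = exp (\<kappa> / 2 * u)" using r \<kappa> by (simp add: powr_def K_def)
    finally have "(u * v) powr r \<le> (M * exp (\<kappa> / 2 * u)) * exp (\<kappa> / 2 * u)"
      using powr_le_exp[OF u r, of "\<kappa> / 2"] \<kappa> u v M by (simp add: powr_mult M_def mult_mono)
    also have "\<dots> = M * exp (\<kappa> * u)" by (simp add: mult.assoc flip: exp_add)
    also have "\<dots> \<le> (K powr r + M) * (exp (\<kappa> * u) + v powr r * (1 + log_plus v) powr r)"
      using M by (intro mult_mono) auto
    finally show ?thesis .
  qed
  moreover have "K powr r + M > 0" using M by (simp add: add_nonneg_pos)
  ultimately show thesis using that by blast
qed

section \<open>Muckenhoupt weights\<close>

lemma wmeas_mono: "A \<subseteq> B \<Longrightarrow> wmeas w A \<le> wmeas w B"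
  unfolding wmeas_def by (intro nn_integral_mono) (auto split: split_indicator)

lemma weight_measurable: "weight w \<Longrightarrow> w \<in> borel_measurable lebesgue"
  by (simp add: weight_def loc_integrable_measurable)

lemma wmeas_cube_finite: "weight w \<Longrightarrow> wmeas w (cube c l) < top"
  using loc_integrable_nn_finite[of w c l] by (simp add: weight_def wmeas_def)

lemma wmeas_Un_disjoint:
  assumes "w \<in> borel_measurable lebesgue" "A \<in> sets lebesgue" "B \<in> sets lebesgue" "A \<inter> B = {}"
  shows "wmeas w (A \<union> B) = wmeas w A + wmeas w B"
proof -
  note [measurable] = assms(1-3)
  have "wmeas w (A \<union> B) = (\<integral>\<^sup>+x. ennreal (w x) * indicator A x + ennreal (w x) * indicator B x \<partial>lebesgue)"
    unfolding wmeas_def using assms(4) by (intro nn_integral_cong) (auto split: split_indicator)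
  also have "\<dots> = wmeas w A + wmeas w B"
    unfolding wmeas_def by (intro nn_integral_add) measurable
  finally show ?thesis .
qed

lemma wmeas_pos:
  assumes w: "weight w" "AE x in lebesgue. w x > 0" and A: "A \<in> sets lebesgue" "emeasure lebesgue A > 0"
  shows "wmeas w A > 0"
proof (rule ccontr)
  note [measurable] = weight_measurable[OF w(1)] A(1)
  assume "\<not> ?thesis"
  then have "(\<integral>\<^sup>+x. ennreal (w x) * indicator A x \<partial>lebesgue) = 0" by (simp add: wmeas_def)
  then have "AE x in lebesgue. ennreal (w x) * indicator A x = 0"
    by (subst (asm) nn_integral_0_iff_AE) auto
  with w(2) have "AE x in lebesgue. x \<notin> A"
    by eventually_elim (auto split: split_indicator_asm)
  then have "A \<in> null_sets lebesgue" using A(1) by (simp add: AE_iff_null_sets)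
  then have "emeasure lebesgue A = 0" by (rule null_setsD1)
  with A(2) show False by simp
qed

lemma UN_cubes: "(\<Union>N::nat. cube (0::real^'n) (real N)) = UNIV"
proof (intro set_eqI iffI UNIV_I)
  fix x :: "real^'n"
  obtain N where N: "norm x \<le> real N" using real_arch_simple by blast
  have "x \<in> cube 0 (real (2 * N))" unfolding mem_cube
  proof
    fix i show "\<bar>x $ i - 0 $ i\<bar> \<le> real (2 * N) / 2" using component_le_norm_cart[of x i] N by simp
  qed
  then show "x \<in> (\<Union>N::nat. cube (0::real^'n) (real N))" by blast
qed

text \<open>On a cube of positive mass the first factor of the condition is nonzero, so the average
  of the negative power is finite, and this power is \<open>\<infinity>\<close> at zeros of
  \<open>w\<close>. One cube of positive mass exists, and all larger cubes about the origin inherit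
  the property and exhaust the space.\<close>

lemma A_class_AE_pos:
  fixes w :: "real^'n \<Rightarrow> real"
  assumes p: "p > 1" and A: "A_class p w" and nz: "\<not> (AE x in lebesgue. w x = 0)"
  shows "AE x in lebesgue. w x > 0"
proof -
  have w: "weight w" using A by (simp add: A_class_def)
  note [measurable] = weight_measurable[OF w]
  have w0: "w x \<ge> 0" for x using w by (simp add: weight_def)
  obtain C where C: "\<And>y l. l > 0 \<Longrightarrow> epowr (avg (cube y l) (\<lambda>x. ennreal (w x))) (1 / p) *
        epowr (avg (cube y l) (\<lambda>x. epowr (ennreal (w x)) (- (conj_exp p / p)))) (1 / conj_exp p) \<le> ennreal C"
    using A unfolding A_class_def by metis
  have cp: "conj_exp p > 0" using p by (simp add: conj_exp_def)
  have pos: "AE x in lebesgue. x \<in> cube c l \<longrightarrow> w x > 0" if l: "l > 0" and nzc: "wmeas w (cube c l) \<noteq> 0" for c l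
  proof -
    let ?Q = "cube c l" and ?g = "\<lambda>x. epowr (ennreal (w x)) (- (conj_exp p / p))"
    have e: "emeasure lebesgue ?Q = ennreal (l ^ CARD('n))" "l ^ CARD('n) > 0" using l by (auto simp: emeasure_cube simp del: emeasure_completion)
    have "avg ?Q (\<lambda>x. ennreal (w x)) \<noteq> 0"
      using nzc unfolding avg_def wmeas_def e by (simp add: ennreal_divide_eq_0_iff)
    then have "epowr (avg ?Q (\<lambda>x. ennreal (w x))) (1 / p) \<noteq> 0" using p by (simp add: epowr_eq_0_iff)
    then have "epowr (avg ?Q ?g) (1 / conj_exp p) \<noteq> top"
      using C[OF l, of c] by (auto simp: ennreal_mult_top top_unique)
    then have "avg ?Q ?g \<noteq> top" using cp by auto
    then have "(\<integral>\<^sup>+x\<in>?Q. ?g x \<partial>lebesgue) \<noteq> \<infinity>"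
      unfolding avg_def e by (auto simp: ennreal_top_divide)
    then have "AE x in lebesgue. ?g x * indicator ?Q x \<noteq> \<infinity>"
      by (intro nn_integral_noteq_infinite) auto
    then show ?thesis
    proof eventually_elim
      case (elim x)
      have "w x \<noteq> 0" if "x \<in> ?Q" using elim that cp p by (auto simp: epowr_def divide_less_0_iff split: if_splits)
      with w0[of x] show ?case by auto
    qed
  qed
  have "\<exists>N. wmeas w (cube 0 (real N)) \<noteq> 0"
  proof (rule ccontr)
    assume "\<not> ?thesis"
    then have "(\<integral>\<^sup>+x. ennreal (w x) * indicator (cube 0 (real N)) x \<partial>lebesgue) = 0" for N
      by (simp add: wmeas_def)
    then have AE0: "AE x in lebesgue. ennreal (w x) * indicator (cube 0 (real N)) x = 0" for N
      by (subst (asm) nn_integral_0_iff_AE) auto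
    have "AE x in lebesgue. \<forall>N. ennreal (w x) * indicator (cube 0 (real N)) x = 0"
      by (subst AE_all_countable) (intro allI AE0)
    then have "AE x in lebesgue. w x = 0"
    proof eventually_elim
      case (elim x)
      obtain N where "x \<in> cube 0 (real N)" using UN_cubes[where 'n='n] by blast
      with elim[rule_format, of N] w0[of x] show ?case by simp
    qed
    with nz show False by blast
  qed
  then obtain N0 where N0: "wmeas w (cube 0 (real N0)) \<noteq> 0" by blast
  have AE1: "AE x in lebesgue. x \<in> cube 0 (real (N + N0 + 1)) \<longrightarrow> w x > 0" for N
    using wmeas_mono[OF cube_mono, of "real N0" "real (N + N0 + 1)" w 0] N0 by (intro pos) auto
  have "AE x in lebesgue. \<forall>N. x \<in> cube 0 (real (N + N0 + 1)) \<longrightarrow> w x > 0"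
    by (subst AE_all_countable) (intro allI AE1)
  then show ?thesis
  proof eventually_elim
    case (elim x)
    obtain N where "x \<in> cube 0 (real N)" using UN_cubes[where 'n='n] by blast
    then have "x \<in> cube 0 (real (N + N0 + 1))" using cube_mono[of "real N" "real (N + N0 + 1)" 0] by auto
    then show ?case using elim by blast
  qed
qed

text \<open>Hoelder for \<open>1 = w^(1/p) * w^(-1/p)\<close> on \<open>E\<close>, with the second
  integral enlarged to \<open>Q\<close> and bounded by the Muckenhoupt condition, gives
  \<open>(e / C)^p w(Q) \<le> w(E)\<close>. Both doubling and reverse doubling are
  instances.\<close>

lemma A_class_large_subset:
  fixes w :: "real^'n \<Rightarrow> real"
  assumes p: "p > 1" and A: "A_class p w" and pos: "AE x in lebesgue. w x > 0" and e: "e > 0"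
  obtains \<delta> where "\<delta> > 0" "\<And>c l E. l > 0 \<Longrightarrow> E \<in> sets lebesgue \<Longrightarrow> E \<subseteq> cube c l \<Longrightarrow>
     ennreal (e * l ^ CARD('n)) \<le> emeasure lebesgue E \<Longrightarrow> ennreal \<delta> * wmeas w (cube c l) \<le> wmeas w E"
proof -
  have w: "weight w" using A by (simp add: A_class_def)
  note [measurable] = weight_measurable[OF w]
  obtain C where C0: "C > 0" and C: "\<And>y l. l > 0 \<Longrightarrow> epowr (avg (cube y l) (\<lambda>x. ennreal (w x))) (1 / p) *
        epowr (avg (cube y l) (\<lambda>x. epowr (ennreal (w x)) (- (conj_exp p / p)))) (1 / conj_exp p) \<le> ennreal C"
    using A unfolding A_class_def by metis
  define q where "q = conj_exp p"
  have q: "q > 1" "1 / p + 1 / q = 1" using p by (auto simp: q_def conj_exp_def field_simps)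
  define \<delta> where "\<delta> = (e / C) powr p"
  have main: "ennreal \<delta> * wmeas w (cube c l) \<le> wmeas w E"
    if l: "l > 0" and E[measurable]: "E \<in> sets lebesgue" and sub: "E \<subseteq> cube c l" and big: "ennreal (e * l ^ CARD('n)) \<le> emeasure lebesgue E" for c l E
  proof -
    let ?Q = "cube c l" and ?g = "\<lambda>x. epowr (ennreal (w x)) (- (q / p))"
    define v where "v = l ^ CARD('n)"
    have v: "v > 0" using l by (simp add: v_def)
    have vol: "emeasure lebesgue ?Q = ennreal v" using l by (simp add: emeasure_cube v_def del: emeasure_completion)
    obtain a where a: "wmeas w ?Q = ennreal a" "a > 0"
      using wmeas_cube_finite[OF w, of c l] wmeas_pos[OF w pos, of ?Q] v vol by (cases "wmeas w ?Q") auto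
    obtain d where d: "wmeas w E = ennreal d" "d \<ge> 0"
      using wmeas_mono[OF sub, of w] a by (cases "wmeas w E") (auto simp: top_unique)
    have "avg ?Q (\<lambda>x. ennreal (w x)) = ennreal (a / v)"
      using a v vol by (simp add: avg_def wmeas_def[symmetric] divide_ennreal)
    then have C': "ennreal ((a / v) powr (1 / p)) * epowr (avg ?Q ?g) (1 / q) \<le> ennreal C"
      using C[OF l, of c] a v by (simp add: epowr_ennreal q_def)
    then have "avg ?Q ?g \<noteq> top" using a v q by (auto simp: ennreal_mult_top top_unique)
    then have "(\<integral>\<^sup>+x\<in>?Q. ?g x \<partial>lebesgue) \<noteq> top"
      unfolding avg_def vol by (auto simp: ennreal_top_divide)
    then obtain G where G: "(\<integral>\<^sup>+x\<in>?Q. ?g x \<partial>lebesgue) = ennreal G" "G \<ge> 0"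
      by (cases "\<integral>\<^sup>+x\<in>?Q. ?g x \<partial>lebesgue") auto
    have "avg ?Q ?g = ennreal (G / v)" using G v vol by (simp add: avg_def divide_ennreal)
    then have C2: "(a / v) powr (1 / p) * (G / v) powr (1 / q) \<le> C"
      using C' G v q C0 by (simp add: epowr_ennreal_pos flip: ennreal_mult)
    have "ennreal (e * v) \<le> (\<integral>\<^sup>+x\<in>E. 1 \<partial>lebesgue)"
      using big by (simp add: v_def)
    also have "\<dots> = (\<integral>\<^sup>+x\<in>E. epowr (ennreal (w x)) (1 / p) * epowr (ennreal (w x)) (- (1 / p)) \<partial>lebesgue)"
    proof (rule nn_integral_cong_AE)
      show "AE x in lebesgue. 1 * indicator E x = epowr (ennreal (w x)) (1 / p) * epowr (ennreal (w x)) (- (1 / p)) * indicator E x"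
        using pos
      proof eventually_elim
        case (elim x)
        then have "epowr (ennreal (w x)) (1 / p) * epowr (ennreal (w x)) (- (1 / p)) = 1"
          by (simp add: epowr_ennreal powr_minus flip: ennreal_mult)
        then show ?case by simp
      qed
    qed
    also have "\<dots> \<le> epowr (\<integral>\<^sup>+x\<in>E. epowr (epowr (ennreal (w x)) (1 / p)) p \<partial>lebesgue) (1 / p)
        * epowr (\<integral>\<^sup>+x\<in>E. epowr (epowr (ennreal (w x)) (- (1 / p))) q \<partial>lebesgue) (1 / q)"
      by (intro ennreal_set_Holder p q) measurable
    also have "\<dots> \<le> epowr (ennreal d) (1 / p) * epowr (ennreal G) (1 / q)"
    proof (intro mult_mono epowr_mono)
      show "(\<integral>\<^sup>+x\<in>E. epowr (epowr (ennreal (w x)) (1 / p)) p \<partial>lebesgue) \<le> ennreal d"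
        using p by (simp add: epowr_epowr_pos d(1)[symmetric] wmeas_def)
      have "(\<integral>\<^sup>+x\<in>E. epowr (epowr (ennreal (w x)) (- (1 / p))) q \<partial>lebesgue) \<le> (\<integral>\<^sup>+x\<in>?Q. ?g x \<partial>lebesgue)"
      proof (rule nn_integral_mono_AE)
        show "AE x in lebesgue. epowr (epowr (ennreal (w x)) (- (1 / p))) q * indicator E x \<le> ?g x * indicator ?Q x"
          using pos
        proof eventually_elim
          case (elim x)
          then have "epowr (epowr (ennreal (w x)) (- (1 / p))) q = ?g x"
            by (simp add: epowr_ennreal powr_powr)
          then show ?case using sub by (auto split: split_indicator)
        qed
      qed
      then show "(\<integral>\<^sup>+x\<in>E. epowr (epowr (ennreal (w x)) (- (1 / p))) q \<partial>lebesgue) \<le> ennreal G" by (simp add: G)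
    qed (use p q in auto)
    also have "\<dots> = ennreal (d powr (1 / p) * G powr (1 / q))"
      using d G p q by (simp add: epowr_ennreal_pos ennreal_mult)
    finally have H: "e * v \<le> d powr (1 / p) * G powr (1 / q)" by (simp add: ennreal_le_iff)
    have vv: "v powr (1 / p) * v powr (1 / q) = v" using v q by (simp flip: powr_add)
    have "e * v * a powr (1 / p) \<le> d powr (1 / p) * (a powr (1 / p) * G powr (1 / q))"
      using mult_right_mono[OF H, of "a powr (1 / p)"] by (simp add: mult_ac)
    also have "a powr (1 / p) * G powr (1 / q) = ((a / v) powr (1 / p) * (G / v) powr (1 / q)) * (v powr (1 / p) * v powr (1 / q))"
      using a v G by (simp add: powr_divide)
    also have "\<dots> \<le> C * v" unfolding vv using C2 v by (intro mult_right_mono) auto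
    finally have "e * v * a powr (1 / p) \<le> d powr (1 / p) * (C * v)" by (simp add: mult_left_mono)
    then have "e / C * a powr (1 / p) \<le> d powr (1 / p)" using v C0 by (simp add: field_simps)
    then have le: "(e / C * a powr (1 / p)) powr p \<le> (d powr (1 / p)) powr p"
      using e C0 p by (intro powr_mono2) auto
    have "\<delta> * a = (e / C) powr p * (a powr (1 / p)) powr p"
      using p a by (simp add: powr_powr \<delta>_def)
    also have "\<dots> = (e / C * a powr (1 / p)) powr p"
      by (rule powr_mult[symmetric])
    also note le
    also have "(d powr (1 / p)) powr p = d" using p d by (simp add: powr_powr)
    finally have "\<delta> * a \<le> d" .
    then show ?thesis using a d by (simp add: ennreal_leI \<delta>_def ennreal_mult[symmetric] del: ennreal_mult)
  qed
  have "\<delta> > 0" using e C0 by (simp add: \<delta>_def)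
  from that[OF this main] show thesis .
qed

text \<open>Real rather than extended, so that ratios and negative powers obey real arithmetic; for
  a weight nothing is lost, since cubes have finite mass.\<close>

definition wq :: "(real^'n \<Rightarrow> real) \<Rightarrow> real^'n \<Rightarrow> real \<Rightarrow> real" where
  "wq w c l = enn2real (wmeas w (cube c l))"

lemma wq_nonneg [simp]: "wq w c l \<ge> 0"
  by (simp add: wq_def)

lemma wmeas_cube:
  assumes "weight w" shows "wmeas w (cube c l) = ennreal (wq w c l)"
  using wmeas_cube_finite[OF assms, of c l] by (simp add: wq_def)

lemma wq_pos:
  fixes w :: "real^'n \<Rightarrow> real"
  assumes "weight w" "AE x in lebesgue. w x > 0" "l > 0" shows "wq w c l > 0"
  using wmeas_pos[OF assms(1,2), of "cube c l"] assms(3)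
  by (simp add: emeasure_cube wmeas_cube[OF assms(1)] del: emeasure_completion)

lemma wq_mono: "weight w \<Longrightarrow> cube c l \<subseteq> cube d r \<Longrightarrow> wq w c l \<le> wq w d r"
  using wmeas_mono[of "cube c l" "cube d r" w] wmeas_cube_finite[of w d r]
  by (simp add: wq_def enn2real_mono)

text \<open>The small cube fills the fixed share \<open>1 / L ^ n\<close> of the large one. Only
  containment is assumed, not a common center, because masses of cubes around different points are
  compared later.\<close>

lemma A_class_doubling:
  fixes w :: "real^'n \<Rightarrow> real"
  assumes p: "p > 1" and A: "A_class p w" and pos: "AE x in lebesgue. w x > 0" and L: "L > 0"
  obtains D where "D > 0" "\<And>c d l. l > 0 \<Longrightarrow> cube c l \<subseteq> cube d (L * l) \<Longrightarrow> wq w d (L * l) \<le> D * wq w c l"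
proof -
  have w: "weight w" using A by (simp add: A_class_def)
  have eps: "1 / L ^ CARD('n) > 0" using L by simp
  obtain \<delta> where \<delta>: "\<delta> > 0" "\<And>c l E. l > 0 \<Longrightarrow> E \<in> sets lebesgue \<Longrightarrow> E \<subseteq> cube c l \<Longrightarrow>
     ennreal (1 / L ^ CARD('n) * l ^ CARD('n)) \<le> emeasure lebesgue E \<Longrightarrow> ennreal \<delta> * wmeas w (cube c l) \<le> wmeas w E"
    by (rule A_class_large_subset[OF p A pos eps], rule that)
  have main: "wq w d (L * l) \<le> 1 / \<delta> * wq w c l" if l: "l > 0" and sub: "cube c l \<subseteq> cube d (L * l)" for c d l
  proof -
    have "ennreal \<delta> * wmeas w (cube d (L * l)) \<le> wmeas w (cube c l)"
      using L l by (intro \<delta>(2) sub) (auto simp: emeasure_cube power_mult_distrib simp del: emeasure_completion)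
    then have "\<delta> * wq w d (L * l) \<le> wq w c l"
      using \<delta>(1) by (simp add: wmeas_cube[OF w] flip: ennreal_mult)
    then show ?thesis using \<delta>(1) by (simp add: field_simps)
  qed
  show thesis by (rule that[OF _ main]) (use \<delta>(1) in simp_all)
qed

text \<open>The subset estimate is applied to the complement of the half cube, which occupies at
  least half of the volume: a fixed share of the mass lies outside the half cube.\<close>

lemma A_class_reverse_doubling:
  fixes w :: "real^'n \<Rightarrow> real"
  assumes p: "p > 1" and A: "A_class p w" and pos: "AE x in lebesgue. w x > 0"
  obtains \<rho> where "0 < \<rho>" "\<rho> < 1" "\<And>c l. l > 0 \<Longrightarrow> wq w c (l / 2) \<le> \<rho> * wq w c l"
proof -
  have w: "weight w" using A by (simp add: A_class_def)
  have half: "(1 / 2 :: real) > 0" by simp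
  obtain \<delta> where \<delta>: "\<delta> > 0" "\<And>c l E. l > 0 \<Longrightarrow> E \<in> sets lebesgue \<Longrightarrow> E \<subseteq> cube c l \<Longrightarrow>
     ennreal (1 / 2 * l ^ CARD('n)) \<le> emeasure lebesgue E \<Longrightarrow> ennreal \<delta> * wmeas w (cube c l) \<le> wmeas w E"
    by (rule A_class_large_subset[OF p A pos half], rule that)
  have "wq w c (l / 2) \<le> (1 - \<delta>) * wq w c l" if l: "l > 0" for c l
  proof -
    let ?Q = "cube c l" and ?R = "cube c (l / 2)"
    have sub: "?R \<subseteq> ?Q" using l by (intro cube_mono) auto
    have "emeasure lebesgue (?Q - ?R) = emeasure lebesgue ?Q - emeasure lebesgue ?R"
      using l sub by (intro emeasure_Diff) (auto simp: emeasure_cube simp del: emeasure_completion)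
    also have "\<dots> = ennreal (l ^ CARD('n) - (l / 2) ^ CARD('n))"
      using l by (simp add: emeasure_cube ennreal_minus del: emeasure_completion)
    finally have vol: "emeasure lebesgue (?Q - ?R) = ennreal (l ^ CARD('n) - (l / 2) ^ CARD('n))" .
    have "(2::real) ^ 1 \<le> 2 ^ CARD('n)" by (intro power_increasing) (auto simp: Suc_leI)
    then have "(l / 2) ^ CARD('n) \<le> l ^ CARD('n) / 2"
      unfolding power_divide using l by (intro divide_left_mono) auto
    then have "ennreal \<delta> * wmeas w ?Q \<le> wmeas w (?Q - ?R)"
      using l vol by (intro \<delta>(2)) (auto simp del: emeasure_completion intro!: ennreal_leI)
    then have "ennreal \<delta> * wmeas w ?Q + wmeas w ?R \<le> wmeas w (?Q - ?R) + wmeas w ?R"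
      by (rule add_right_mono)
    also have "\<dots> = wmeas w ?Q"
      using sub by (subst wmeas_Un_disjoint[symmetric]) (auto simp: weight_measurable[OF w] Un_absorb2)
    finally have "ennreal (\<delta> * wq w c l + wq w c (l / 2)) \<le> ennreal (wq w c l)"
      using \<delta>(1) by (simp add: wmeas_cube[OF w] ennreal_mult)
    then have "\<delta> * wq w c l + wq w c (l / 2) \<le> wq w c l" by (subst (asm) ennreal_le_iff) auto
    then show ?thesis by (simp add: algebra_simps)
  qed
  note step = this
  show thesis
  \<comment> \<open>The maximum keeps the ratio strictly positive even if
    \<open>1 - \<delta>\<close> is zero.\<close>
  proof (rule that[of "max (1 / 2) (1 - \<delta>)"])
    fix c :: "real^'n" and l :: real assume l: "l > 0"
    have "(1 - \<delta>) * wq w c l \<le> max (1 / 2) (1 - \<delta>) * wq w c l"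
      by (intro mult_right_mono) (auto simp: wq_def)
    with step[OF l, of c] show "wq w c (l / 2) \<le> max (1 / 2) (1 - \<delta>) * wq w c l" by linarith
  qed (use \<delta>(1) in auto)
qed

section \<open>The estimate on one cube\<close>

abbreviation (input) bump_fun :: "real \<Rightarrow> real \<Rightarrow> ennreal \<Rightarrow> ennreal" where
  "bump_fun p t v \<equiv> (if v = \<infinity> then \<infinity> else ennreal (log_bump p (enn2real v / t)))"

lemma borel_measurable_log_bump [measurable]: "log_bump p \<in> borel_measurable borel"
  unfolding log_bump_def log_plus_def by measurable

lemma conj_exp: "p > 1 \<Longrightarrow> conj_exp p > 1 \<and> 1 / p + 1 / conj_exp p = 1"
  by (auto simp: conj_exp_def field_simps)

lemma log_bump_nonneg: "log_bump p v \<ge> 0"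
  by (simp add: log_bump_def)

lemma powr_le_log_bump: "v \<ge> 0 \<Longrightarrow> p > 1 \<Longrightarrow> v powr conj_exp p \<le> log_bump p v"
proof -
  assume "v \<ge> 0" "p > 1"
  then have "1 powr conj_exp p \<le> (1 + log_plus v) powr conj_exp p"
    using conj_exp[of p] by (intro powr_mono2) (auto simp: log_plus_def)
  then have "v powr conj_exp p * 1 \<le> v powr conj_exp p * (1 + log_plus v) powr conj_exp p"
    by (intro mult_left_mono) auto
  then show ?thesis by (simp add: log_bump_def)
qed

text \<open>The inequality \<open>le\<close> is applied pointwise with \<open>u = V / t\<close>,
  which converts the modular of the Luxemburg norm into an integral bound. It serves twice: with
  \<open>g = 1\<close> and \<open>e = 0\<close> for the plain power of \<open>V\<close>, and with
  \<open>g\<close> the oscillation of \<open>b\<close> and \<open>e\<close> its exponential.\<close>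

lemma bump_integral_le:
  fixes V :: "real^'n \<Rightarrow> ennreal" and g e :: "real^'n \<Rightarrow> real"
  assumes p: "p > 1" and t: "t > 0" and C: "C > 0" and e0: "\<And>x. e x \<ge> 0" and g0: "\<And>x. g x \<ge> 0"
    and [measurable]: "V \<in> borel_measurable lebesgue" "e \<in> borel_measurable lebesgue"
    and H: "(\<integral>\<^sup>+x\<in>cube c l. bump_fun p t (V x) \<partial>lebesgue) \<le> ennreal v"
    and le: "\<And>x u. u \<ge> 0 \<Longrightarrow> (g x * u) powr conj_exp p \<le> C * (e x + log_bump p u)"
  shows "(\<integral>\<^sup>+x\<in>cube c l. ennreal (g x powr conj_exp p) * epowr (V x) (conj_exp p) \<partial>lebesgue)
     \<le> ennreal (C * t powr conj_exp p) * ((\<integral>\<^sup>+x\<in>cube c l. ennreal (e x) \<partial>lebesgue) + ennreal v)"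
proof -
  let ?P = "cube c l"
  define r where "r = conj_exp p"
  have r: "r > 1" using conj_exp[OF p] by (simp add: r_def)
  have k: "C * t powr r > 0" using C t by simp
  have pw: "ennreal (g x powr r) * epowr (V x) r \<le> ennreal (C * t powr r) * (ennreal (e x) + bump_fun p t (V x))" for x
  proof (cases "V x")
    case (real v)
    have "g x powr r * v powr r = t powr r * (g x * (v / t)) powr r"
      using t real g0[of x] by (simp flip: powr_mult)
    also have "\<dots> \<le> t powr r * (C * (e x + log_bump p (v / t)))"
      using le[of "v / t" x] real t by (intro mult_left_mono) (auto simp: r_def)
    finally have "g x powr r * v powr r \<le> C * t powr r * (e x + log_bump p (v / t))" by (simp add: mult_ac)
    then show ?thesis using real r e0[of x] log_bump_nonneg[of p "v / t"] k
      by (simp add: epowr_ennreal_pos ennreal_leI flip: ennreal_mult ennreal_plus)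
  next
    case top
    then show ?thesis using C t by (simp add: ennreal_mult_top)
  qed
  have "(\<integral>\<^sup>+x\<in>?P. ennreal (g x powr r) * epowr (V x) r \<partial>lebesgue) \<le>
      (\<integral>\<^sup>+x. ennreal (C * t powr r) * (ennreal (e x) * indicator ?P x + bump_fun p t (V x) * indicator ?P x) \<partial>lebesgue)"
  proof (intro nn_integral_mono)
    fix x
    show "ennreal (g x powr r) * epowr (V x) r * indicator ?P x \<le>
        ennreal (C * t powr r) * (ennreal (e x) * indicator ?P x + bump_fun p t (V x) * indicator ?P x)"
    proof (cases "x \<in> ?P")
      case True
      show ?thesis by (simp only: indicator_simps(1)[OF True] mult_1_right pw)
    qed simp
  qed
  also have "\<dots> = ennreal (C * t powr r) * ((\<integral>\<^sup>+x\<in>?P. ennreal (e x) \<partial>lebesgue) + (\<integral>\<^sup>+x\<in>?P. bump_fun p t (V x) \<partial>lebesgue))"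
    by (subst nn_integral_cmult, measurable) (subst nn_integral_add, auto)
  also have "\<dots> \<le> ennreal (C * t powr r) * ((\<integral>\<^sup>+x\<in>?P. ennreal (e x) \<partial>lebesgue) + ennreal v)"
    using H by (intro mult_left_mono add_left_mono) auto
  finally show ?thesis by (simp add: r_def)
qed

lemma bump_Lp:
  fixes V :: "real^'n \<Rightarrow> ennreal"
  assumes p: "p > 1" and t: "t > 0" and V: "V \<in> borel_measurable lebesgue"
    and H: "(\<integral>\<^sup>+x\<in>cube c l. bump_fun p t (V x) \<partial>lebesgue) \<le> ennreal v"
  shows "(\<integral>\<^sup>+x\<in>cube c l. epowr (V x) (conj_exp p) \<partial>lebesgue) \<le> ennreal (t powr conj_exp p) * ennreal v"
  using bump_integral_le[OF p t, of 1 "\<lambda>x. 0" "\<lambda>x. 1", OF _ _ _ V _ H] powr_le_log_bump[OF _ p] by simp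

text \<open>For \<open>V\<close> a negative power of \<open>\<nu>\<close> this says that
  \<open>\<nu>\<close> is positive almost everywhere on the cube.\<close>

lemma bump_AE_finite:
  fixes V :: "real^'n \<Rightarrow> ennreal"
  assumes [measurable]: "V \<in> borel_measurable lebesgue"
    and H: "(\<integral>\<^sup>+x\<in>cube c l. bump_fun p t (V x) \<partial>lebesgue) \<le> ennreal v"
  shows "AE x in lebesgue. x \<in> cube c l \<longrightarrow> V x \<noteq> \<infinity>"
proof -
  have "(\<integral>\<^sup>+x\<in>cube c l. bump_fun p t (V x) \<partial>lebesgue) \<noteq> \<infinity>"
    using H by (auto simp: top_unique)
  then have "AE x in lebesgue. bump_fun p t (V x) * indicator (cube c l) x \<noteq> \<infinity>"
    by (intro nn_integral_noteq_infinite) auto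
  then show ?thesis by eventually_elim (auto split: split_indicator_asm)
qed

text \<open>Replaces the infimum in the Luxemburg norm by one admissible \<open>t\<close>, and the
  average of \<open>w^r\<close> by the number \<open>W^r\<close>. The positivity of \<open>w\<close>
  and \<open>V\<close> is needed to exclude that a zero factor hides an infinite one.\<close>

lemma bump_cube:
  fixes w :: "real^'n \<Rightarrow> real" and V :: "real^'n \<Rightarrow> ennreal"
  assumes p: "p > 1" and r: "r > 1" and q: "q > 0" and l: "l > 0" and C: "C > 0"
    and w: "weight w" "AE x in lebesgue. w x > 0"
    and V: "V \<in> borel_measurable lebesgue" "\<And>x. V x > 0"
    and bump: "epowr (emeasure lebesgue (cube c l)) a * epowr (avg (cube c l) (\<lambda>x. epowr (ennreal (w x)) r)) (1 / (r * q)) *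
       luxemburg (log_bump p) (cube c l) V \<le> ennreal C"
  obtains t W where "t > 0" "W > 0"
    "(\<integral>\<^sup>+x\<in>cube c l. epowr (ennreal (w x)) r \<partial>lebesgue) = ennreal (l ^ CARD('n) * W powr r)"
    "(\<integral>\<^sup>+x\<in>cube c l. bump_fun p t (V x) \<partial>lebesgue) \<le> ennreal (l ^ CARD('n))"
    "(l ^ CARD('n)) powr a * W powr (1 / q) * t \<le> 2 * C"
proof -
  let ?P = "cube c l"
  note [measurable] = weight_measurable[OF w(1)] V(1)
  define v where "v = l ^ CARD('n)"
  have v: "v > 0" using l by (simp add: v_def)
  have vol: "emeasure lebesgue ?P = ennreal v" using l by (simp add: emeasure_cube v_def del: emeasure_completion)
  define s where "s = conj_exp p"
  have s: "s > 1" using conj_exp[OF p] by (simp add: s_def)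
  define A where "A = {t. 0 < t \<and> avg ?P (\<lambda>x. bump_fun p t (V x)) \<le> 1}"
  have lux: "luxemburg (log_bump p) ?P V = Inf (ennreal ` A)"
    by (simp add: luxemburg_def A_def)
  have A: "(\<integral>\<^sup>+x\<in>?P. bump_fun p t (V x) \<partial>lebesgue) \<le> ennreal v" if t: "t \<in> A" for t
    using ennreal_le_mult_of_divide_le[of v 1 "\<integral>\<^sup>+x\<in>?P. bump_fun p t (V x) \<partial>lebesgue"] v t
    unfolding A_def avg_def vol by simp
  let ?G = "\<integral>\<^sup>+x\<in>?P. epowr (V x) s \<partial>lebesgue"
  have G0: "?G \<noteq> 0"
  proof
    assume "?G = 0"
    then have "AE x in lebesgue. epowr (V x) s * indicator ?P x = 0"
      by (subst (asm) nn_integral_0_iff_AE) auto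
    then have "AE x in lebesgue. x \<notin> ?P"
      by eventually_elim (use V(2) s in \<open>auto simp: epowr_eq_0_iff split: split_indicator_asm\<close>, metis less_irrefl)
    then have "?P \<in> null_sets lebesgue" by (simp add: AE_iff_null_sets)
    then have "emeasure lebesgue ?P = 0" by (rule null_setsD1)
    then show False using v vol by simp
  qed
  \<comment> \<open>The integral may be infinite; a positive finite minorant suffices to keep all
    admissible \<open>t\<close> above \<open>t0\<close>.\<close>
  obtain y :: real where y: "y > 0" "ennreal y < ?G"
  proof (cases ?G)
    case (real g)
    then have "g / 2 > 0" "ennreal (g / 2) < ?G" using G0 by (auto simp: ennreal_less_iff less_le)
    then show thesis by (rule that)
  next
    case top
    then show thesis using that[of 1] by simp
  qed
  define t0 where "t0 = (y / v) powr (1 / s)"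
  have t0: "t0 > 0" using y v by (simp add: t0_def)
  have lower: "t0 \<le> t" if t: "t \<in> A" for t
  proof -
    have tp: "t > 0" using t by (simp add: A_def)
    have "ennreal y < ennreal (t powr s) * ennreal v"
      using y(2) bump_Lp[OF p tp V(1) A[OF t]] by (simp add: s_def)
    then have "y < t powr s * v" using y v by (simp add: ennreal_less_iff flip: ennreal_mult)
    then have "y / v \<le> t powr s" using v by (simp add: field_simps)
    then have "t0 \<le> (t powr s) powr (1 / s)" unfolding t0_def using y v s by (intro powr_mono2) auto
    also have "\<dots> = t" using tp s by (simp add: powr_powr)
    finally show ?thesis .
  qed
  have lux0: "luxemburg (log_bump p) ?P V \<ge> ennreal t0"
    unfolding lux using lower by (intro Inf_greatest) (auto intro: ennreal_leI)
  have a0: "epowr (ennreal v) a = ennreal (v powr a)" using v by (simp add: epowr_ennreal)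
  let ?X = "\<integral>\<^sup>+x\<in>?P. epowr (ennreal (w x)) r \<partial>lebesgue"
  have X0: "?X \<noteq> 0"
  proof
    assume "?X = 0"
    then have "AE x in lebesgue. epowr (ennreal (w x)) r * indicator ?P x = 0"
      by (subst (asm) nn_integral_0_iff_AE) auto
    with w(2) have "AE x in lebesgue. x \<notin> ?P"
      by eventually_elim (use r in \<open>auto simp: epowr_eq_0_iff split: split_indicator_asm\<close>)
    then have "?P \<in> null_sets lebesgue" by (simp add: AE_iff_null_sets)
    then have "emeasure lebesgue ?P = 0" by (rule null_setsD1)
    then show False using v vol by simp
  qed
  \<comment> \<open>An infinite integral of \<open>w^r\<close> would meet a Luxemburg norm of at
    least \<open>t0 > 0\<close>, so the product would be infinite and not the default
    \<open>\<infinity> * 0 = 0\<close>.\<close>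
  have "?X \<noteq> top"
  proof
    assume "?X = top"
    then have "avg ?P (\<lambda>x. epowr (ennreal (w x)) r) = top" by (simp add: avg_def vol ennreal_top_divide)
    then have "epowr (emeasure lebesgue ?P) a * epowr (avg ?P (\<lambda>x. epowr (ennreal (w x)) r)) (1 / (r * q)) = top"
      using v r q unfolding vol a0 by (simp add: ennreal_mult_top)
    then have "top * luxemburg (log_bump p) ?P V \<le> ennreal C" using bump by simp
    moreover have "luxemburg (log_bump p) ?P V \<noteq> 0" using lux0 t0 by auto
    ultimately show False by (simp add: ennreal_top_mult top_unique)
  qed
  then obtain X where X: "?X = ennreal X" "X > 0"
    using X0 by (cases ?X) (auto simp: less_le)
  define W where "W = (X / v) powr (1 / r)"
  have W: "W > 0" "W powr r = X / v" using X v r by (auto simp: W_def powr_powr)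
  define k where "k = v powr a * W powr (1 / q)"
  have k: "k > 0" using v W by (simp add: k_def)
  have "avg ?P (\<lambda>x. epowr (ennreal (w x)) r) = ennreal (X / v)"
    using X v by (simp add: avg_def vol divide_ennreal)
  then have "epowr (avg ?P (\<lambda>x. epowr (ennreal (w x)) r)) (1 / (r * q)) = ennreal (W powr (1 / q))"
    using X v r q by (simp add: epowr_ennreal W_def powr_powr)
  then have kl: "ennreal k * luxemburg (log_bump p) ?P V \<le> ennreal C"
    using bump v W unfolding vol a0 by (simp add: k_def ennreal_mult)
  \<comment> \<open>The factor two gives strict inequality, so that some admissible \<open>t\<close>
    itself, and not only the infimum, obeys the bound.\<close>
  have "luxemburg (log_bump p) ?P V < ennreal (2 * C / k)"
  proof (rule ccontr)
    assume "\<not> ?thesis"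
    then have "ennreal k * ennreal (2 * C / k) \<le> ennreal k * luxemburg (log_bump p) ?P V"
      by (intro mult_left_mono) auto
    with kl have "ennreal k * ennreal (2 * C / k) \<le> ennreal C" by (rule order_trans[rotated])
    then show False using k C by (simp add: ennreal_le_iff flip: ennreal_mult)
  qed
  then obtain t where t: "t \<in> A" "ennreal t < ennreal (2 * C / k)"
    unfolding lux Inf_less_iff by auto
  have tp: "t > 0" using t by (simp add: A_def)
  have "t < 2 * C / k" using t(2) tp by (simp add: ennreal_less_iff)
  then have "k * t \<le> 2 * C" using k by (simp add: field_simps)
  show thesis
  proof (rule that[OF tp W(1)])
    show "(\<integral>\<^sup>+x\<in>?P. epowr (ennreal (w x)) r \<partial>lebesgue) = ennreal (l ^ CARD('n) * W powr r)"
      using X W v l by (simp add: v_def)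
    show "(\<integral>\<^sup>+x\<in>?P. bump_fun p t (V x) \<partial>lebesgue) \<le> ennreal (l ^ CARD('n))"
      using A[OF t(1)] by (simp add: v_def)
    show "(l ^ CARD('n)) powr a * W powr (1 / q) * t \<le> 2 * C"
      using \<open>k * t \<le> 2 * C\<close> by (simp add: k_def v_def)
  qed
qed

text \<open>With \<open>u\<close> the oscillation of \<open>b\<close> about its mean on the cube,
  \<open>\<bar>b x - b z\<bar> \<le> u x + u z\<close> decouples the variables into four single
  integrals. Those of \<open>f\<close> use Hoelder with exponents \<open>p\<close>,
  \<open>p'\<close> and the bump of \<open>\<nu>\<close>; those of \<open>w\<close> on
  \<open>E\<close> use Hoelder with exponent \<open>m\<close> and the bump of \<open>w\<close>.
  John--Nirenberg handles \<open>u\<close> in both.\<close>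

lemma cube_estimate:
  fixes w \<nu> b :: "real^'n \<Rightarrow> real" and \<gamma> p q m r C :: real
  assumes p: "1 < p" and q: "1 < q" "q < m" and r: "r > 1" and b: "b \<in> BMO"
    and w: "weight w" "AE x in lebesgue. w x > 0" and nu: "weight \<nu>"
    and bump: "\<And>y l. l > 0 \<Longrightarrow>
      epowr (emeasure lebesgue (cube y l)) (\<gamma> / real CARD('n) + 1 / q - 1 / p) *
      epowr (avg (cube y l) (\<lambda>x. epowr (ennreal (w x)) r)) (1 / (r * q)) *
      luxemburg (log_bump p) (cube y l) (\<lambda>x. epowr (ennreal (\<nu> x)) (- (1 / p))) \<le> ennreal C"
  obtains K where "K > 0"
    "\<And>c l E f. l > 0 \<Longrightarrow> E \<in> sets lebesgue \<Longrightarrow> E \<subseteq> cube c l \<Longrightarrow> f \<in> borel_measurable lebesgue \<Longrightarrow>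
      (\<integral>\<^sup>+x\<in>E. (\<integral>\<^sup>+z\<in>cube c l. ennreal (\<bar>b x - b z\<bar> * \<bar>f z\<bar> * w x) \<partial>lebesgue) \<partial>lebesgue) \<le>
      ennreal (K * l powr (real CARD('n) - \<gamma>) * wq w c l powr (1 / m - 1 / q)) * epowr (wmeas w E) (1 - 1 / m) *
      epowr (\<integral>\<^sup>+z\<in>cube c l. ennreal (\<bar>f z\<bar> powr p * \<nu> z) \<partial>lebesgue) (1 / p)"
proof -
  let ?n = "real CARD('n)"
  have bi: "loc_integrable b" using b by (simp add: BMO_def)
  note [measurable] = loc_integrable_measurable[OF bi] weight_measurable[OF w(1)] weight_measurable[OF nu]
  have w0: "w x \<ge> 0" and nu0: "\<nu> x \<ge> 0" for x using w nu by (auto simp: weight_def)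
  define V where "V = (\<lambda>x. epowr (ennreal (\<nu> x)) (- (1 / p)))"
  have V[measurable]: "V \<in> borel_measurable lebesgue" unfolding V_def by measurable
  have V0: "V x > 0" for x using p nu0[of x] by (auto simp: V_def epowr_def)
  define s where "s = conj_exp p"
  have s: "s > 1" "1 / p + 1 / s = 1" using conj_exp[OF p] by (auto simp: s_def)
  define r' where "r' = conj_exp r"
  have r': "r' > 1" "1 / r + 1 / r' = 1" "1 / r' + 1 / r = 1" using conj_exp[OF r] by (auto simp: r'_def)
  define m' where "m' = conj_exp m"
  have m: "m > 1" using q by simp
  have m': "m' > 1" "1 / m + 1 / m' = 1" "1 / m' + 1 / m = 1" using conj_exp[OF m] by (auto simp: m'_def)
  define C1 where "C1 = max C 1"
  have C1: "C1 > 0" "ennreal C \<le> ennreal C1" by (auto simp: C1_def intro: ennreal_leI)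
  obtain \<kappa> where \<kappa>: "\<kappa> > 0" and JN: "\<And>c l. l > 0 \<Longrightarrow> (\<integral>\<^sup>+x\<in>cube c l. ennreal (exp (\<kappa> * \<bar>b x - mean (cube c l) b\<bar>)) \<partial>lebesgue) \<le> 4 * emeasure lebesgue (cube c l)"
    by (rule John_Nirenberg[OF b], rule that)
  have s0: "s > 0" using s by simp
  obtain C2 where C2: "C2 > 0" and young: "\<And>u v. u \<ge> 0 \<Longrightarrow> v \<ge> 0 \<Longrightarrow>
      (u * v) powr s \<le> C2 * (exp (\<kappa> * u) + v powr s * (1 + log_plus v) powr s)"
    by (rule exp_log_Young[OF \<kappa> s0], rule that)
  \<comment> \<open>\<open>M\<close> is the constant by which \<open>u powr (m * r')\<close> is
    dominated by \<open>exp (\<kappa> * u)\<close>. The \<open>4\<close> in \<open>K2\<close> is the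
    John--Nirenberg constant, and the \<open>5\<close> in \<open>K3\<close> adds to it the modular
    of the Luxemburg norm.\<close>
  define M where "M = (m * r' / \<kappa>) powr (m * r')"
  have M: "M > 0" using m r' \<kappa> by (simp add: M_def)
  define K2 where "K2 = ((4 * M) powr (1 / r')) powr (1 / m)"
  define K3 where "K3 = (5 * C2) powr (1 / s)"
  define K where "K = (K2 + K3) * (2 * C1)"
  have K: "K2 > 0" "K3 > 0" "K > 0" using M C2 C1 by (auto simp: K2_def K3_def K_def add_pos_pos)
  show thesis
  proof (rule that[OF K(3)])
    fix c :: "real^'n" and l :: real and E and f :: "real^'n \<Rightarrow> real"
    assume l: "l > 0" and E[measurable]: "E \<in> sets lebesgue" and sub: "E \<subseteq> cube c l" and f[measurable]: "f \<in> borel_measurable lebesgue"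
    let ?P = "cube c l"
    define v where "v = l ^ CARD('n)"
    have v: "v > 0" using l by (simp add: v_def)
    have vol: "emeasure lebesgue ?P = ennreal v" using l by (simp add: emeasure_cube v_def del: emeasure_completion)
    have bc: "epowr (emeasure lebesgue ?P) (\<gamma> / ?n + 1 / q - 1 / p) *
       epowr (avg ?P (\<lambda>x. epowr (ennreal (w x)) r)) (1 / (r * q)) * luxemburg (log_bump p) ?P V \<le> ennreal C1"
      using bump[OF l, of c] C1(2) unfolding V_def by (rule order_trans)
    have q0: "q > 0" using q by simp
    obtain t W where t: "t > 0" and W: "W > 0"
      and Wr: "(\<integral>\<^sup>+x\<in>?P. epowr (ennreal (w x)) r \<partial>lebesgue) = ennreal (v * W powr r)"
      and H: "(\<integral>\<^sup>+x\<in>?P. bump_fun p t (V x) \<partial>lebesgue) \<le> ennreal v"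
      and tW: "v powr (\<gamma> / ?n + 1 / q - 1 / p) * W powr (1 / q) * t \<le> 2 * C1"
      unfolding v_def by (rule bump_cube[OF p r q0 l C1(1) w V V0 bc], erule (1) that[unfolded v_def])
    define u where "u = (\<lambda>x. \<bar>b x - mean ?P b\<bar>)"
    have u0: "u x \<ge> 0" for x by (simp add: u_def)
    have [measurable]: "u \<in> borel_measurable lebesgue" unfolding u_def by measurable
    have eu: "(\<integral>\<^sup>+x\<in>?P. ennreal (exp (\<kappa> * u x)) \<partial>lebesgue) \<le> ennreal (4 * v)"
      using JN[OF l, of c] v unfolding vol u_def by (simp add: ennreal_mult')
    let ?F = "\<integral>\<^sup>+z\<in>?P. ennreal (\<bar>f z\<bar> powr p * \<nu> z) \<partial>lebesgue"
    let ?F1 = "epowr ?F (1 / p)"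
    have Vs: "(\<integral>\<^sup>+x\<in>?P. epowr (V x) s \<partial>lebesgue) \<le> ennreal (t powr s * v)"
      using bump_Lp[OF p t V H] v by (simp add: s_def ennreal_mult)
    have uVs: "(\<integral>\<^sup>+x\<in>?P. epowr (ennreal (u x) * V x) s \<partial>lebesgue) \<le> ennreal (5 * C2 * t powr s * v)"
    proof -
      have "(\<integral>\<^sup>+x\<in>?P. epowr (ennreal (u x) * V x) s \<partial>lebesgue) = (\<integral>\<^sup>+x\<in>?P. ennreal (u x powr s) * epowr (V x) s \<partial>lebesgue)"
        using s u0 by (simp add: epowr_mult epowr_ennreal_pos)
      also have "\<dots> \<le> ennreal (C2 * t powr s) * ((\<integral>\<^sup>+x\<in>?P. ennreal (exp (\<kappa> * u x)) \<partial>lebesgue) + ennreal v)"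
        unfolding s_def by (rule bump_integral_le[OF p t C2 _ u0 V _ H])
          (auto simp: log_bump_def s_def[symmetric] intro!: young u0)
      also have "\<dots> \<le> ennreal (C2 * t powr s) * (ennreal (4 * v) + ennreal v)"
        by (intro mult_left_mono add_right_mono eu) auto
      also have "\<dots> = ennreal (5 * C2 * t powr s * v)"
        using v C2 by (simp add: algebra_simps flip: ennreal_mult ennreal_plus)
      finally show ?thesis .
    qed
    \<comment> \<open>Where \<open>\<nu>\<close> vanishes \<open>V\<close> is infinite, and this
      happens only on a null set of the cube; elsewhere the two powers of \<open>\<nu>\<close>
      cancel.\<close>
    have fV: "AE z in lebesgue. z \<in> ?P \<longrightarrow> ennreal \<bar>f z\<bar> = epowr (ennreal (\<bar>f z\<bar> powr p * \<nu> z)) (1 / p) * V z"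
      using bump_AE_finite[OF V H]
    proof eventually_elim
      case (elim z)
      show ?case
      proof
        assume "z \<in> ?P"
        then have "V z \<noteq> \<infinity>" using elim by blast
        then have nz: "\<nu> z > 0" using nu0[of z] p by (auto simp: V_def epowr_def less_le)
        have "epowr (ennreal (\<bar>f z\<bar> powr p * \<nu> z)) (1 / p) * V z = ennreal ((\<bar>f z\<bar> powr p * \<nu> z) powr (1 / p) * \<nu> z powr (- (1 / p)))"
          using nz p by (simp add: V_def epowr_ennreal epowr_ennreal_pos flip: ennreal_mult)
        also have "(\<bar>f z\<bar> powr p * \<nu> z) powr (1 / p) * \<nu> z powr (- (1 / p)) = \<bar>f z\<bar>"
          using nz p by (simp add: powr_mult powr_powr powr_minus)
        finally show "ennreal \<bar>f z\<bar> = epowr (ennreal (\<bar>f z\<bar> powr p * \<nu> z)) (1 / p) * V z" by simp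
      qed
    qed
    have Hold: "(\<integral>\<^sup>+z\<in>?P. g z * ennreal \<bar>f z\<bar> \<partial>lebesgue) \<le> ?F1 * epowr (\<integral>\<^sup>+z\<in>?P. epowr (g z * V z) s \<partial>lebesgue) (1 / s)"
      if [measurable]: "g \<in> borel_measurable lebesgue" for g
    proof -
      have "(\<integral>\<^sup>+z\<in>?P. g z * ennreal \<bar>f z\<bar> \<partial>lebesgue) = (\<integral>\<^sup>+z\<in>?P. epowr (ennreal (\<bar>f z\<bar> powr p * \<nu> z)) (1 / p) * (g z * V z) \<partial>lebesgue)"
        using fV by (intro nn_integral_cong_AE) (auto split: split_indicator simp: mult_ac elim!: eventually_mono)
      also have "\<dots> \<le> epowr (\<integral>\<^sup>+z\<in>?P. epowr (epowr (ennreal (\<bar>f z\<bar> powr p * \<nu> z)) (1 / p)) p \<partial>lebesgue) (1 / p) *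
          epowr (\<integral>\<^sup>+z\<in>?P. epowr (g z * V z) s \<partial>lebesgue) (1 / s)"
        by (intro ennreal_set_Holder p s) measurable
      finally show ?thesis using p by (simp add: epowr_epowr_pos)
    qed
    have tv: "(a * t powr s * v) powr (1 / s) = a powr (1 / s) * t * v powr (1 / s)" for a
      using t s by (simp add: powr_mult powr_powr)
    have I1: "(\<integral>\<^sup>+z\<in>?P. ennreal \<bar>f z\<bar> \<partial>lebesgue) \<le> ?F1 * ennreal (t * v powr (1 / s))"
    proof -
      have "(\<integral>\<^sup>+z\<in>?P. ennreal \<bar>f z\<bar> \<partial>lebesgue) \<le> ?F1 * epowr (ennreal (t powr s * v)) (1 / s)"
        using Hold[of "\<lambda>_. 1"] s Vs by (auto intro: order_trans intro!: mult_left_mono epowr_mono)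
      also have "epowr (ennreal (t powr s * v)) (1 / s) = ennreal (t * v powr (1 / s))"
        using tv[of 1] s v by (simp add: epowr_ennreal_pos)
      finally show ?thesis .
    qed
    have I2: "(\<integral>\<^sup>+z\<in>?P. ennreal (u z) * ennreal \<bar>f z\<bar> \<partial>lebesgue) \<le> ?F1 * ennreal (K3 * t * v powr (1 / s))"
    proof -
      have "(\<integral>\<^sup>+z\<in>?P. ennreal (u z) * ennreal \<bar>f z\<bar> \<partial>lebesgue) \<le> ?F1 * epowr (\<integral>\<^sup>+z\<in>?P. epowr (ennreal (u z) * V z) s \<partial>lebesgue) (1 / s)"
        by (rule Hold) measurable
      also have "\<dots> \<le> ?F1 * epowr (ennreal (5 * C2 * t powr s * v)) (1 / s)"
        using s by (intro mult_left_mono epowr_mono uVs) auto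
      also have "epowr (ennreal (5 * C2 * t powr s * v)) (1 / s) = ennreal (K3 * t * v powr (1 / s))"
        using tv[of "5 * C2"] s v C2 by (simp add: epowr_ennreal_pos K3_def)
      finally show ?thesis .
    qed
    have Wp: "epowr (\<integral>\<^sup>+x\<in>?P. epowr (ennreal (w x)) r \<partial>lebesgue) (1 / r) = ennreal (v powr (1 / r) * W)"
      unfolding Wr using v W r by (simp add: epowr_ennreal powr_mult powr_powr)
    have vv: "v powr (1 / r') * v powr (1 / r) = v" using v r' by (simp flip: powr_add)
    have wP: "wmeas w ?P \<le> ennreal (v * W)"
    proof -
      have "wmeas w ?P = (\<integral>\<^sup>+x\<in>?P. 1 * ennreal (w x) \<partial>lebesgue)" by (simp add: wmeas_def)
      also have "\<dots> \<le> epowr (\<integral>\<^sup>+x\<in>?P. epowr 1 r' \<partial>lebesgue) (1 / r') * epowr (\<integral>\<^sup>+x\<in>?P. epowr (ennreal (w x)) r \<partial>lebesgue) (1 / r)"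
        by (intro ennreal_set_Holder r r') measurable
      also have "\<dots> = ennreal (v powr (1 / r')) * ennreal (v powr (1 / r) * W)"
        unfolding Wp using v vol by (simp add: epowr_ennreal)
      also have "\<dots> = ennreal (v * W)" using W vv by (simp add: mult.assoc[symmetric] flip: ennreal_mult)
      finally show ?thesis .
    qed
    have umw: "(\<integral>\<^sup>+x\<in>?P. ennreal (u x powr m) * ennreal (w x) \<partial>lebesgue) \<le> ennreal ((4 * M) powr (1 / r') * (v * W))"
    proof -
      have "(\<integral>\<^sup>+x\<in>?P. epowr (ennreal (u x powr m)) r' \<partial>lebesgue) \<le> (\<integral>\<^sup>+x. ennreal M * (ennreal (exp (\<kappa> * u x)) * indicator ?P x) \<partial>lebesgue)"
      proof (intro nn_integral_mono)
        fix x
        have "(u x powr m) powr r' \<le> M * exp (\<kappa> * u x)"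
          using powr_le_exp[OF u0, of "m * r'" \<kappa> x] m r' \<kappa> by (simp add: powr_powr M_def)
        then show "epowr (ennreal (u x powr m)) r' * indicator ?P x \<le> ennreal M * (ennreal (exp (\<kappa> * u x)) * indicator ?P x)"
          using r' M by (auto split: split_indicator simp: epowr_ennreal_pos ennreal_leI simp flip: ennreal_mult)
      qed
      also have "\<dots> = ennreal M * (\<integral>\<^sup>+x\<in>?P. ennreal (exp (\<kappa> * u x)) \<partial>lebesgue)"
        by (intro nn_integral_cmult) measurable
      also have "\<dots> \<le> ennreal M * ennreal (4 * v)" by (intro mult_left_mono eu) simp
      also have "\<dots> = ennreal (4 * M * v)" using M v by (simp add: mult_ac flip: ennreal_mult)
      finally have um: "(\<integral>\<^sup>+x\<in>?P. epowr (ennreal (u x powr m)) r' \<partial>lebesgue) \<le> ennreal (4 * M * v)" .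
      have "(\<integral>\<^sup>+x\<in>?P. ennreal (u x powr m) * ennreal (w x) \<partial>lebesgue) \<le>
          epowr (\<integral>\<^sup>+x\<in>?P. epowr (ennreal (u x powr m)) r' \<partial>lebesgue) (1 / r') * epowr (\<integral>\<^sup>+x\<in>?P. epowr (ennreal (w x)) r \<partial>lebesgue) (1 / r)"
        by (intro ennreal_set_Holder r r') measurable
      also have "\<dots> \<le> epowr (ennreal (4 * M * v)) (1 / r') * ennreal (v powr (1 / r) * W)"
        unfolding Wp using r' by (intro mult_right_mono epowr_mono um) auto
      also have "\<dots> = ennreal ((4 * M) powr (1 / r') * (v powr (1 / r') * v powr (1 / r)) * W)"
        using M v W by (simp add: epowr_ennreal powr_mult mult_ac flip: ennreal_mult)
      finally show ?thesis unfolding vv by (simp add: mult_ac)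
    qed
    have "(\<integral>\<^sup>+x\<in>E. ennreal (u x powr m) * ennreal (w x) \<partial>lebesgue) \<le> (\<integral>\<^sup>+x\<in>?P. ennreal (u x powr m) * ennreal (w x) \<partial>lebesgue)"
      using sub by (intro nn_integral_mono) (auto split: split_indicator)
    note umE = order_trans[OF this umw]
    have mm: "1 / m' = 1 - 1 / m" using m' by simp
    let ?E1 = "epowr (wmeas w E) (1 - 1 / m)"
    \<comment> \<open>The weight is split as \<open>w^(1/m') * w^(1/m)\<close> and \<open>u\<close>
      is attached to the second factor. Hoelder keeps \<open>E\<close> in the first factor only; the
      second is enlarged to the whole cube.\<close>
    have J: "(\<integral>\<^sup>+x\<in>E. ennreal (u x) * ennreal (w x) \<partial>lebesgue) \<le> ?E1 * ennreal (K2 * (v * W) powr (1 / m))"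
    proof -
      have "(\<integral>\<^sup>+x\<in>E. ennreal (u x) * ennreal (w x) \<partial>lebesgue) =
          (\<integral>\<^sup>+x\<in>E. epowr (ennreal (w x)) (1 / m') * epowr (ennreal (u x powr m) * ennreal (w x)) (1 / m) \<partial>lebesgue)"
      proof (intro nn_integral_cong)
        fix x
        have "w x powr (1 / m') * (u x powr m * w x) powr (1 / m) = u x * (w x powr (1 / m') * w x powr (1 / m))"
          using m u0[of x] by (simp add: powr_mult powr_powr)
        also have "w x powr (1 / m') * w x powr (1 / m) = w x" using m' w0[of x] by (simp flip: powr_add)
        finally have "epowr (ennreal (w x)) (1 / m') * epowr (ennreal (u x powr m) * ennreal (w x)) (1 / m) = ennreal (u x * w x)"
          using m m' w0[of x] by (simp add: epowr_ennreal_pos flip: ennreal_mult)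
        then show "ennreal (u x) * ennreal (w x) * indicator E x =
            epowr (ennreal (w x)) (1 / m') * epowr (ennreal (u x powr m) * ennreal (w x)) (1 / m) * indicator E x"
          using u0[of x] w0[of x] by (simp add: ennreal_mult)
      qed
      also have "\<dots> \<le> epowr (\<integral>\<^sup>+x\<in>E. epowr (epowr (ennreal (w x)) (1 / m')) m' \<partial>lebesgue) (1 / m') *
          epowr (\<integral>\<^sup>+x\<in>E. epowr (epowr (ennreal (u x powr m) * ennreal (w x)) (1 / m)) m \<partial>lebesgue) (1 / m)"
        by (intro ennreal_set_Holder m m') measurable
      also have "\<dots> = ?E1 * epowr (\<integral>\<^sup>+x\<in>E. ennreal (u x powr m) * ennreal (w x) \<partial>lebesgue) (1 / m)"
        using m m' unfolding mm[symmetric] by (simp add: epowr_epowr_pos wmeas_def)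
      also have "\<dots> \<le> ?E1 * epowr (ennreal ((4 * M) powr (1 / r') * (v * W))) (1 / m)"
        using m umE by (intro mult_left_mono epowr_mono) auto
      also have "epowr (ennreal ((4 * M) powr (1 / r') * (v * W))) (1 / m) = ennreal (K2 * (v * W) powr (1 / m))"
        using M v W m by (simp add: epowr_ennreal_pos powr_mult K2_def)
      finally show ?thesis .
    qed
    have wE: "wmeas w E \<le> ?E1 * ennreal ((v * W) powr (1 / m))"
    proof -
      have fin: "wmeas w E \<noteq> top" using wmeas_mono[OF sub, of w] wP by (auto simp: top_unique)
      have "wmeas w E = ?E1 * epowr (wmeas w E) (1 / m)"
      proof (cases "wmeas w E")
        case (real a)
        then show ?thesis using m by (simp add: epowr_ennreal_pos flip: ennreal_mult powr_add)
      qed (use fin in auto)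
      also have "\<dots> \<le> ?E1 * epowr (ennreal (v * W)) (1 / m)"
        using m wmeas_mono[OF sub, of w] wP by (intro mult_left_mono epowr_mono) (auto intro: order_trans)
      also have "\<dots> = ?E1 * ennreal ((v * W) powr (1 / m))" using v W by (simp add: epowr_ennreal)
      finally show ?thesis .
    qed
    let ?I1 = "\<integral>\<^sup>+z\<in>?P. ennreal \<bar>f z\<bar> \<partial>lebesgue" and ?I2 = "\<integral>\<^sup>+z\<in>?P. ennreal (u z) * ennreal \<bar>f z\<bar> \<partial>lebesgue"
    have inner: "(\<integral>\<^sup>+z\<in>?P. ennreal (\<bar>b x - b z\<bar> * \<bar>f z\<bar> * w x) \<partial>lebesgue) \<le> (ennreal (u x) * ennreal (w x)) * ?I1 + ennreal (w x) * ?I2" for x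
    proof -
      have "(\<integral>\<^sup>+z\<in>?P. ennreal (\<bar>b x - b z\<bar> * \<bar>f z\<bar> * w x) \<partial>lebesgue) \<le>
         (\<integral>\<^sup>+z. (ennreal (u x) * ennreal (w x)) * (ennreal \<bar>f z\<bar> * indicator ?P z) + ennreal (w x) * (ennreal (u z) * ennreal \<bar>f z\<bar> * indicator ?P z) \<partial>lebesgue)"
      proof (intro nn_integral_mono)
        fix z
        have "\<bar>b x - b z\<bar> * \<bar>f z\<bar> * w x \<le> (u x + u z) * \<bar>f z\<bar> * w x"
          using w0[of x] by (intro mult_right_mono) (auto simp: u_def)
        also have "\<dots> = u x * w x * \<bar>f z\<bar> + w x * (u z * \<bar>f z\<bar>)" by (simp add: algebra_simps)
        finally have "ennreal (\<bar>b x - b z\<bar> * \<bar>f z\<bar> * w x) \<le> ennreal (u x * w x * \<bar>f z\<bar> + w x * (u z * \<bar>f z\<bar>))"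
          by (rule ennreal_leI)
        also have "\<dots> = ennreal (u x) * ennreal (w x) * ennreal \<bar>f z\<bar> + ennreal (w x) * (ennreal (u z) * ennreal \<bar>f z\<bar>)"
          using u0 w0 by (simp add: ennreal_mult)
        finally show "ennreal (\<bar>b x - b z\<bar> * \<bar>f z\<bar> * w x) * indicator ?P z \<le>
            (ennreal (u x) * ennreal (w x)) * (ennreal \<bar>f z\<bar> * indicator ?P z) + ennreal (w x) * (ennreal (u z) * ennreal \<bar>f z\<bar> * indicator ?P z)"
          by (cases "z \<in> ?P") auto
      qed
      also have "\<dots> = (ennreal (u x) * ennreal (w x)) * ?I1 + ennreal (w x) * ?I2"
        by (subst nn_integral_add, measurable) (simp add: nn_integral_cmult)
      finally show ?thesis .
    qed
    have "(\<integral>\<^sup>+x\<in>E. (\<integral>\<^sup>+z\<in>?P. ennreal (\<bar>b x - b z\<bar> * \<bar>f z\<bar> * w x) \<partial>lebesgue) \<partial>lebesgue)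
        \<le> (\<integral>\<^sup>+x. (ennreal (u x) * ennreal (w x) * indicator E x) * ?I1 + (ennreal (w x) * indicator E x) * ?I2 \<partial>lebesgue)"
    proof (intro nn_integral_mono)
      fix x
      show "(\<integral>\<^sup>+z\<in>?P. ennreal (\<bar>b x - b z\<bar> * \<bar>f z\<bar> * w x) \<partial>lebesgue) * indicator E x \<le>
         (ennreal (u x) * ennreal (w x) * indicator E x) * ?I1 + (ennreal (w x) * indicator E x) * ?I2"
        using inner[of x] by (cases "x \<in> E") auto
    qed
    also have "\<dots> = (\<integral>\<^sup>+x\<in>E. ennreal (u x) * ennreal (w x) \<partial>lebesgue) * ?I1 + wmeas w E * ?I2"
      unfolding wmeas_def by (subst nn_integral_add, measurable) (simp add: nn_integral_multc)
    also have "\<dots> \<le> (?E1 * ennreal (K2 * (v * W) powr (1 / m))) * (?F1 * ennreal (t * v powr (1 / s))) +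
        (?E1 * ennreal ((v * W) powr (1 / m))) * (?F1 * ennreal (K3 * t * v powr (1 / s)))"
      by (intro add_mono mult_mono J I1 I2 wE) auto
    also have "\<dots> = ?E1 * ?F1 * (ennreal (K2 * (v * W) powr (1 / m)) * ennreal (t * v powr (1 / s)) +
        ennreal ((v * W) powr (1 / m)) * ennreal (K3 * t * v powr (1 / s)))"
      by (simp only: distrib_left mult_ac)
    also have "ennreal (K2 * (v * W) powr (1 / m)) * ennreal (t * v powr (1 / s)) +
        ennreal ((v * W) powr (1 / m)) * ennreal (K3 * t * v powr (1 / s)) =
        ennreal ((K2 + K3) * ((v * W) powr (1 / m) * v powr (1 / s) * t))"
      using K t by (simp add: algebra_simps flip: ennreal_mult ennreal_plus)
    also have "?E1 * ?F1 * \<dots> \<le> ?E1 * ?F1 * ennreal (K * l powr (?n - \<gamma>) * wq w c l powr (1 / m - 1 / q))"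
    proof (intro mult_left_mono ennreal_leI)
      define a where "a = \<gamma> / ?n + 1 / q - 1 / p"
      define th where "th = 1 / m - 1 / q"
      have th: "th < 0" using q by (simp add: th_def field_simps)
      have "v powr a * W powr (1 / q) * t \<le> 2 * C1" using tW by (simp only: a_def)
      then have "t \<le> 2 * C1 * (v powr (- a) * W powr (- (1 / q)))"
        using v W by (simp add: powr_minus field_simps)
      then have "(v * W) powr (1 / m) * v powr (1 / s) * t \<le> (v * W) powr (1 / m) * v powr (1 / s) * (2 * C1 * (v powr (- a) * W powr (- (1 / q))))"
        by (intro mult_left_mono) auto
      also have "\<dots> = 2 * C1 * (v powr (1 / m + 1 / s - a) * W powr th)"
        by (simp add: powr_mult th_def powr_diff powr_add powr_minus field_simps)
      \<comment> \<open>After \<open>1 - \<gamma> / n\<close> is split off, \<open>v\<close> and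
        \<open>W\<close> carry the same exponent \<open>th\<close> and merge into
        \<open>v * W\<close>, the majorant of the mass of the cube.\<close>
      also have "1 / m + 1 / s - a = th + (1 - \<gamma> / ?n)"
        using s(2) by (simp add: a_def th_def)
      also have "v powr (th + (1 - \<gamma> / ?n)) * W powr th = (v * W) powr th * v powr (1 - \<gamma> / ?n)"
        by (simp add: powr_add powr_mult)
      also have "v powr (1 - \<gamma> / ?n) = l powr (?n - \<gamma>)"
      proof -
        have "v = l powr ?n" using l by (simp add: v_def powr_realpow)
        then show ?thesis by (simp add: powr_powr right_diff_distrib)
      qed
      \<comment> \<open>Since \<open>th\<close> is negative, the inequality
        \<open>w(P) \<le> v * W\<close> is reversed by the power; this is how the average of
        \<open>w^r\<close> gives way to the mass itself.\<close>
      also have "(v * W) powr th \<le> wq w c l powr th"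
      proof (rule powr_mono2')
        show "wq w c l \<le> v * W" using wP v W by (simp add: wmeas_cube[OF w(1)] ennreal_le_iff)
        show "0 < wq w c l" by (rule wq_pos[OF w l])
      qed (use th in simp)
      finally have "(v * W) powr (1 / m) * v powr (1 / s) * t \<le> 2 * C1 * (wq w c l powr th * l powr (?n - \<gamma>))"
        using C1 by (simp add: mult_left_mono mult_right_mono)
      then have "(K2 + K3) * ((v * W) powr (1 / m) * v powr (1 / s) * t) \<le> (K2 + K3) * (2 * C1 * (wq w c l powr th * l powr (?n - \<gamma>)))"
        using K by (intro mult_left_mono) auto
      then show "(K2 + K3) * ((v * W) powr (1 / m) * v powr (1 / s) * t) \<le> K * l powr (?n - \<gamma>) * wq w c l powr (1 / m - 1 / q)"
        by (simp only: K_def th_def mult_ac)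
    qed simp
    finally show "(\<integral>\<^sup>+x\<in>E. (\<integral>\<^sup>+z\<in>?P. ennreal (\<bar>b x - b z\<bar> * \<bar>f z\<bar> * w x) \<partial>lebesgue) \<partial>lebesgue) \<le>
      ennreal (K * l powr (?n - \<gamma>) * wq w c l powr (1 / m - 1 / q)) * ?E1 * ?F1"
      by (simp only: mult_ac)
  qed
qed

section \<open>Summation over cubes\<close>

lemma powr_nat_mult: "x > 0 \<Longrightarrow> (x powr a) ^ k = (x ^ k) powr (a::real)"
  by (simp add: powr_realpow[symmetric] powr_powr mult.commute)

text \<open>The two branches of the minimum meet at \<open>v = u\<close> with value
  \<open>u powr a\<close>. Moving away from that index, the first branch decays with ratio
  \<open>\<rho> powr a\<close> and the second with ratio \<open>\<rho> powr \<theta>\<close>, so two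
  geometric series remain, whatever the position of the peak.\<close>

lemma suminf_two_sided_geometric:
  fixes v :: "nat \<Rightarrow> real"
  assumes v: "\<And>j. v j > 0" and \<rho>: "0 < \<rho>" "\<rho> < 1" and dec: "\<And>j. v (Suc j) \<le> \<rho> * v j"
    and u: "u > 0" and a: "a > 0" and \<theta>: "\<theta> > 0"
  shows "(\<Sum>j. ennreal (min (v j powr a) (u powr (a + \<theta>) * v j powr (- \<theta>)))) \<le>
     ennreal ((1 / (1 - \<rho> powr \<theta>) + 1 / (1 - \<rho> powr a)) * u powr a)"
proof -
  define A where "A = \<rho> powr a"
  define B where "B = \<rho> powr \<theta>"
  have AB: "0 < A" "A < 1" "0 < B" "B < 1"
    using \<rho> a \<theta> powr_less_mono2[of a \<rho> 1] powr_less_mono2[of \<theta> \<rho> 1] by (auto simp: A_def B_def)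
  have dec': "v (i + k) \<le> \<rho> ^ k * v i" for i k
  proof (induction k)
    case (Suc k)
    have "v (i + Suc k) \<le> \<rho> * v (i + k)" using dec by simp
    also have "\<dots> \<le> \<rho> * (\<rho> ^ k * v i)" using Suc \<rho> by (intro mult_left_mono) auto
    finally show ?case by (simp add: mult_ac)
  qed simp
  have "(\<lambda>j. \<rho> ^ j * v 0) \<longlonglongrightarrow> 0 * v 0"
    using \<rho> by (intro tendsto_mult LIMSEQ_power_zero tendsto_const) auto
  then have "\<forall>\<^sub>F j in sequentially. \<rho> ^ j * v 0 < u" using u by (intro order_tendstoD(2)) auto
  then obtain j0 where "\<rho> ^ j0 * v 0 < u" by (auto dest: eventually_happens)
  then have "v j0 \<le> u" using dec'[of 0 j0] by simp
  \<comment> \<open>\<open>J\<close> is the first index past the peak: \<open>J + k\<close> is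
    compared with \<open>v J \<le> u\<close>, and \<open>J - Suc k\<close> with
    \<open>v (J - 1) > u\<close>, hence the offset by one.\<close>
  define J where "J = (LEAST j. v j \<le> u)"
  have J: "v J \<le> u" unfolding J_def by (rule LeastI) (rule \<open>v j0 \<le> u\<close>)
  have less: "v j > u" if "j < J" for j
    using not_less_Least[of j "\<lambda>j. v j \<le> u"] that unfolding J_def by simp
  let ?t = "\<lambda>j. min (v j powr a) (u powr (a + \<theta>) * v j powr (- \<theta>))"
  have t0: "?t j \<ge> 0" for j by simp
  have low: "?t (J + k) \<le> A ^ k * u powr a" for k
  proof -
    have "v (J + k) \<le> \<rho> ^ k * u" using dec'[of J k] J \<rho> by (meson less_imp_le mult_left_mono order_trans zero_le_power)
    then have "v (J + k) powr a \<le> (\<rho> ^ k * u) powr a" using v[of "J + k"] a by (intro powr_mono2) auto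
    also have "\<dots> = A ^ k * u powr a" using \<rho> u by (simp add: A_def powr_mult powr_nat_mult)
    finally show ?thesis by simp
  qed
  have high: "?t (J - Suc k) \<le> B ^ k * u powr a" if k: "k < J" for k
  proof -
    have "u < v (J - 1)" using k by (intro less) auto
    also have "v (J - 1) \<le> \<rho> ^ k * v (J - Suc k)" using dec'[of "J - Suc k" k] k by simp
    finally have "u \<le> \<rho> ^ k * v (J - Suc k)" by simp
    then have "(\<rho> ^ k * v (J - Suc k)) powr (- \<theta>) \<le> u powr (- \<theta>)"
      using u \<theta> by (intro powr_mono2') auto
    then have "B ^ k * (\<rho> ^ k * v (J - Suc k)) powr (- \<theta>) \<le> B ^ k * u powr (- \<theta>)"
      using AB by (intro mult_left_mono) auto
    moreover have "B ^ k * (\<rho> ^ k * v (J - Suc k)) powr (- \<theta>) = v (J - Suc k) powr (- \<theta>)"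
      using \<rho> by (simp add: B_def powr_nat_mult powr_mult powr_minus)
    ultimately have "v (J - Suc k) powr (- \<theta>) \<le> B ^ k * u powr (- \<theta>)" by simp
    then have "u powr (a + \<theta>) * v (J - Suc k) powr (- \<theta>) \<le> u powr (a + \<theta>) * (B ^ k * u powr (- \<theta>))"
      by (intro mult_left_mono) auto
    also have "\<dots> = B ^ k * u powr a" using u by (simp add: powr_add powr_minus)
    finally show ?thesis by simp
  qed
  have geo: "(\<Sum>k<N. c ^ k) \<le> 1 / (1 - c)" if "0 < c" "c < 1" for c :: real and N
  proof -
    have "(\<Sum>k<N. c ^ k) = (1 - c ^ N) / (1 - c)" using that by (simp add: sum_gp_strict)
    also have "\<dots> \<le> 1 / (1 - c)" using that by (intro divide_right_mono) auto
    finally show ?thesis .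
  qed
  show ?thesis
  proof (rule suminf_le_const)
    fix N
    have "(\<Sum>j<N. ?t j) \<le> (\<Sum>j<J + N. ?t j)" by (intro sum_mono2) auto
    also have "\<dots> = (\<Sum>j<J. ?t j) + (\<Sum>k<N. ?t (J + k))"
      by (induction N) (simp_all add: add.assoc)
    also have "(\<Sum>j<J. ?t j) = (\<Sum>k<J. ?t (J - Suc k))" by (rule sum.nat_diff_reindex[symmetric])
    also have "\<dots> \<le> (\<Sum>k<J. B ^ k * u powr a)" by (intro sum_mono high) auto
    also have "\<dots> = (\<Sum>k<J. B ^ k) * u powr a" by (simp add: sum_distrib_right)
    also have "\<dots> \<le> 1 / (1 - B) * u powr a" using AB by (intro mult_right_mono geo) auto
    also have "(\<Sum>k<N. ?t (J + k)) \<le> (\<Sum>k<N. A ^ k * u powr a)" by (intro sum_mono low)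
    also have "\<dots> = (\<Sum>k<N. A ^ k) * u powr a" by (simp add: sum_distrib_right)
    also have "\<dots> \<le> 1 / (1 - A) * u powr a" using AB by (intro mult_right_mono geo) auto
    finally have "(\<Sum>j<N. ?t j) \<le> (1 / (1 - B) + 1 / (1 - A)) * u powr a" by (simp add: algebra_simps)
    then show "(\<Sum>j<N. ennreal (?t j)) \<le> ennreal ((1 / (1 - \<rho> powr \<theta>) + 1 / (1 - \<rho> powr a)) * u powr a)"
      using t0 by (subst sum_ennreal) (auto intro!: ennreal_leI simp: A_def B_def)
  qed (rule summableI)
qed

lemma mem_cube_commute: "x \<in> cube c l \<longleftrightarrow> c \<in> cube x l"
  unfolding mem_cube by (simp add: abs_minus_commute)

lemma wmeas_cube_measurable [measurable]:
  assumes [measurable]: "w \<in> borel_measurable lebesgue"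
  shows "(\<lambda>y. wmeas w (cube y l)) \<in> borel_measurable lebesgue"
proof -
  have "(\<lambda>y. \<integral>\<^sup>+x. (if x \<in> cube y l then ennreal (w x) else 0) \<partial>lebesgue) \<in> borel_measurable lebesgue"
    by measurable
  then show ?thesis
    by (rule back_subst[where P="\<lambda>f. f \<in> borel_measurable lebesgue"])
       (auto simp: wmeas_def intro!: ext nn_integral_cong split: split_indicator)
qed

text \<open>Collects what the summation uses of the Muckenhoupt condition: positivity, decay of the
  mass under halving, and comparability of a cube with a larger one that contains it.\<close>

locale Ainf_weight =
  fixes w :: "real^'n \<Rightarrow> real" and \<rho> :: real
  assumes weight: "weight w" and AE_pos: "AE x in lebesgue. w x > 0"
    and rho: "0 < \<rho>" "\<rho> < 1"
    and reverse_doubling: "\<And>c l. l > 0 \<Longrightarrow> wq w c (l / 2) \<le> \<rho> * wq w c l"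
    and doubling: "\<And>L. L > 0 \<Longrightarrow> \<exists>D>0. \<forall>c d l. l > 0 \<longrightarrow> cube c l \<subseteq> cube d (L * l) \<longrightarrow> wq w d (L * l) \<le> D * wq w c l"
begin

lemma w_measurable [measurable]: "w \<in> borel_measurable lebesgue"
  by (rule weight_measurable[OF weight])

lemma w_nonneg: "w x \<ge> 0"
  using weight by (simp add: weight_def)

lemma w_cube_pos: "l > 0 \<Longrightarrow> wq w c l > 0"
  by (rule wq_pos[OF weight AE_pos])

lemma wq_measurable [measurable]: "(\<lambda>c. wq w c l) \<in> borel_measurable lebesgue"
  unfolding wq_def by measurable

text \<open>Here \<open>t\<close> stands for \<open>w(P)\<close> and \<open>u\<close> for
  \<open>w(E)\<close>: inserting \<open>w(E \<inter> P) \<le> t\<close> or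
  \<open>w(E \<inter> P) \<le> u\<close> into
  \<open>w(P)^(-\<theta>) w(E \<inter> P)^(a + \<theta>)\<close> gives the two branches.\<close>

definition \<phi> :: "real \<Rightarrow> real \<Rightarrow> real \<Rightarrow> real \<Rightarrow> real" where
  "\<phi> a \<theta> u t = min (t powr a) (u powr (a + \<theta>) * t powr (- \<theta>))"

lemma \<phi>_nonneg [simp]: "\<phi> a \<theta> u t \<ge> 0"
  by (simp add: \<phi>_def)

lemma \<phi>_measurable [measurable]: "\<phi> a \<theta> u \<in> borel_measurable borel"
  unfolding \<phi>_def by measurable

text \<open>Allows the mass of a cube to be exchanged for that of a comparable one. One branch costs
  \<open>D powr a\<close>, the other \<open>D powr \<theta>\<close>, and
  \<open>D powr (a + \<theta>)\<close> covers both.\<close>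

lemma \<phi>_compare:
  assumes "a > 0" "\<theta> > 0" "0 < s" "0 < t" "D \<ge> 1" "s \<le> D * t" "t \<le> D * s"
  shows "\<phi> a \<theta> u s \<le> D powr (a + \<theta>) * \<phi> a \<theta> u t"
proof -
  have "s powr a \<le> (D * t) powr a" using assms by (intro powr_mono2) auto
  also have "\<dots> = D powr a * t powr a" by (simp add: powr_mult)
  also have "\<dots> \<le> D powr (a + \<theta>) * t powr a" using assms by (intro mult_right_mono powr_mono) auto
  finally have 1: "s powr a \<le> D powr (a + \<theta>) * t powr a" .
  have "(D * s) powr (- \<theta>) \<le> t powr (- \<theta>)" using assms by (intro powr_mono2') auto
  then have "D powr \<theta> * (D * s) powr (- \<theta>) \<le> D powr \<theta> * t powr (- \<theta>)" by (intro mult_left_mono) auto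
  also have "D powr \<theta> * (D * s) powr (- \<theta>) = s powr (- \<theta>)"
    using assms by (simp add: powr_mult powr_minus)
  also have "D powr \<theta> * t powr (- \<theta>) \<le> D powr (a + \<theta>) * t powr (- \<theta>)"
    using assms by (intro mult_right_mono powr_mono) auto
  finally have "u powr (a + \<theta>) * s powr (- \<theta>) \<le> u powr (a + \<theta>) * (D powr (a + \<theta>) * t powr (- \<theta>))"
    by (intro mult_left_mono) auto
  then have 2: "u powr (a + \<theta>) * s powr (- \<theta>) \<le> D powr (a + \<theta>) * (u powr (a + \<theta>) * t powr (- \<theta>))"
    by (simp only: mult_ac)
  show ?thesis unfolding \<phi>_def using 1 2 by (auto simp: min_def)
qed

text \<open>For \<open>x\<close> in \<open>cube c (3 * h)\<close>, this cube lies in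
  \<open>cube x (6 * h)\<close>, and \<open>cube x h\<close> lies in \<open>cube c (4 * h)\<close>.
  The ratios \<open>6\<close> and \<open>4 / 3\<close> are those of \<open>6 h\<close> to
  \<open>h\<close> and of \<open>4 h\<close> to \<open>3 h\<close>.\<close>

lemma wq_cube_compare:
  obtains D where "D \<ge> 1" "\<And>c x h. h > 0 \<Longrightarrow> x \<in> cube c (3 * h) \<Longrightarrow> wq w c (3 * h) \<le> D * wq w x h \<and> wq w x h \<le> D * wq w c (3 * h)"
proof -
  obtain D1 where D1: "D1 > 0" "\<forall>c d l. l > 0 \<longrightarrow> cube c l \<subseteq> cube d (6 * l) \<longrightarrow> wq w d (6 * l) \<le> D1 * wq w c l"
    using doubling[of 6] by auto
  obtain D2 where D2: "D2 > 0" "\<forall>c d l. l > 0 \<longrightarrow> cube c l \<subseteq> cube d (4 / 3 * l) \<longrightarrow> wq w d (4 / 3 * l) \<le> D2 * wq w c l"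
    using doubling[of "4 / 3"] by auto
  define D where "D = max 1 (max D1 D2)"
  have D: "D \<ge> 1" "D1 \<le> D" "D2 \<le> D" by (auto simp: D_def)
  have main: "wq w c (3 * h) \<le> D * wq w x h \<and> wq w x h \<le> D * wq w c (3 * h)" if h: "h > 0" and x: "x \<in> cube c (3 * h)" for c x h
  proof
    have "wq w c (3 * h) \<le> wq w x (6 * h)"
      using x by (intro wq_mono weight cube_subset) (auto simp: mem_cube abs_minus_commute)
    also have "\<dots> \<le> D1 * wq w x h" using D1(2) h cube_mono[of h "6 * h" x] by auto
    also have "\<dots> \<le> D * wq w x h" using D by (intro mult_right_mono) auto
    finally show "wq w c (3 * h) \<le> D * wq w x h" .
    have "wq w x h \<le> wq w c (4 / 3 * (3 * h))"
      using x h by (intro wq_mono weight cube_subset) (auto simp: mem_cube abs_minus_commute intro: order_trans)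
    also have "\<dots> \<le> D2 * wq w c (3 * h)"
      using D2(2)[rule_format, of "3 * h" c c] h cube_mono[of "3 * h" "4 / 3 * (3 * h)" c] by simp
    also have "\<dots> \<le> D * wq w c (3 * h)" using D by (intro mult_right_mono) auto
    finally show "wq w x h \<le> D * wq w c (3 * h)" .
  qed
  from that[OF D(1) main] show thesis .
qed

text \<open>The averages over all translates of cubes of side \<open>3 \<cdot> 2\<^sup>-\<^sup>j l\<close> replace a dyadic grid.
  Since \<open>\<phi>\<close> decays on both sides of \<open>u\<close> and \<open>w\<close> of concentric cubes grows geometrically, the sum
  over the scales is dominated by one term.\<close>

lemma multiscale_sum_le:
  assumes a: "a > 0" and \<theta>: "\<theta> > 0"
  obtains S where "S > 0" "\<And>u l k. u > 0 \<Longrightarrow> l > 0 \<Longrightarrow> k \<in> borel_measurable lebesgue \<Longrightarrow>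
    (\<Sum>j. ennreal (1 / (l / 2 ^ j) ^ CARD('n)) * (\<integral>\<^sup>+c. ennreal (\<phi> a \<theta> u (wq w c (3 * (l / 2 ^ j)))) *
       (\<integral>\<^sup>+x\<in>cube c (3 * (l / 2 ^ j)). k x \<partial>lebesgue) \<partial>lebesgue)) \<le> ennreal (S * u powr a) * (\<integral>\<^sup>+x. k x \<partial>(lebesgue :: (real^'n) measure))"
proof -
  obtain D where D: "D \<ge> 1" and cmp: "\<And>c x h. h > 0 \<Longrightarrow> x \<in> cube c (3 * h) \<Longrightarrow> wq w c (3 * h) \<le> D * wq w x h \<and> wq w x h \<le> D * wq w c (3 * h)"
    by (rule wq_cube_compare, rule that)
  define S0 where "S0 = 1 / (1 - \<rho> powr \<theta>) + 1 / (1 - \<rho> powr a)"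
  have S0: "S0 > 0"
    using rho a \<theta> powr_less_mono2[of a \<rho> 1] powr_less_mono2[of \<theta> \<rho> 1] unfolding S0_def by (intro add_pos_pos) auto
  define S where "S = 3 ^ CARD('n) * D powr (a + \<theta>) * S0"
  have S: "S > 0" using S0 D by (simp add: S_def)
  have main: "(\<Sum>j. ennreal (1 / (l / 2 ^ j) ^ CARD('n)) * (\<integral>\<^sup>+c. ennreal (\<phi> a \<theta> u (wq w c (3 * (l / 2 ^ j)))) *
       (\<integral>\<^sup>+x\<in>cube c (3 * (l / 2 ^ j)). k x \<partial>lebesgue) \<partial>lebesgue)) \<le> ennreal (S * u powr a) * (\<integral>\<^sup>+x. k x \<partial>(lebesgue :: (real^'n) measure))"
    if u: "u > 0" and l: "l > 0" and k[measurable]: "k \<in> borel_measurable lebesgue" for u l and k :: "real^'n \<Rightarrow> ennreal"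
  proof -
    define E where "E = 3 ^ CARD('n) * D powr (a + \<theta>)"
    have E: "E > 0" using D by (simp add: E_def)
    have step: "ennreal (1 / h ^ CARD('n)) * (\<integral>\<^sup>+c. ennreal (\<phi> a \<theta> u (wq w c (3 * h))) * (\<integral>\<^sup>+x\<in>cube c (3 * h). k x \<partial>lebesgue) \<partial>lebesgue)
        \<le> (\<integral>\<^sup>+x. ennreal E * (ennreal (\<phi> a \<theta> u (wq w x h)) * k x) \<partial>lebesgue)" if h: "h > 0" for h
    proof -
      have "(\<integral>\<^sup>+c. ennreal (\<phi> a \<theta> u (wq w c (3 * h))) * (\<integral>\<^sup>+x\<in>cube c (3 * h). k x \<partial>lebesgue) \<partial>lebesgue)
         = (\<integral>\<^sup>+c. (\<integral>\<^sup>+x. (if x \<in> cube c (3 * h) then ennreal (\<phi> a \<theta> u (wq w c (3 * h))) * k x else 0) \<partial>lebesgue) \<partial>lebesgue)"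
        by (intro nn_integral_cong, subst nn_integral_cmult[symmetric]) (auto intro!: nn_integral_cong split: split_indicator)
      \<comment> \<open>For fixed \<open>x\<close> the centers fill \<open>cube x (3 * h)\<close>,
        whose volume cancels \<open>1 / h ^ n\<close> up to \<open>3 ^ n\<close>, while
        comparability moves the mass from a cube about \<open>c\<close> to one about
        \<open>x\<close>. Afterwards all cubes at \<open>x\<close> are concentric and reverse
        doubling applies.\<close>
      also have "\<dots> = (\<integral>\<^sup>+x. (\<integral>\<^sup>+c. (if x \<in> cube c (3 * h) then ennreal (\<phi> a \<theta> u (wq w c (3 * h))) * k x else 0) \<partial>lebesgue) \<partial>lebesgue)"
        by (rule lebesgue_pair.Fubini') measurable
      also have "\<dots> \<le> (\<integral>\<^sup>+x. (\<integral>\<^sup>+c. (ennreal (D powr (a + \<theta>) * \<phi> a \<theta> u (wq w x h)) * k x) * indicator (cube x (3 * h)) c \<partial>lebesgue) \<partial>lebesgue)"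
      proof (intro nn_integral_mono)
        fix x c :: "real^'n"
        show "(if x \<in> cube c (3 * h) then ennreal (\<phi> a \<theta> u (wq w c (3 * h))) * k x else 0) \<le>
           (ennreal (D powr (a + \<theta>) * \<phi> a \<theta> u (wq w x h)) * k x) * indicator (cube x (3 * h)) c"
        proof (cases "x \<in> cube c (3 * h)")
          case True
          then have "c \<in> cube x (3 * h)" by (simp add: mem_cube_commute)
          moreover have "\<phi> a \<theta> u (wq w c (3 * h)) \<le> D powr (a + \<theta>) * \<phi> a \<theta> u (wq w x h)"
            using cmp[OF h True] h by (intro \<phi>_compare a \<theta> D w_cube_pos) auto
          ultimately show ?thesis using True by (auto intro!: mult_right_mono ennreal_leI)
        qed simp
      qed
      also have "\<dots> = (\<integral>\<^sup>+x. ennreal ((3 * h) ^ CARD('n)) * (ennreal (D powr (a + \<theta>) * \<phi> a \<theta> u (wq w x h)) * k x) \<partial>lebesgue)"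
        using h by (intro nn_integral_cong, subst nn_integral_cmult_indicator)
          (simp_all add: emeasure_cube mult.commute del: emeasure_completion)
      also have "ennreal (1 / h ^ CARD('n)) * \<dots> = (\<integral>\<^sup>+x. ennreal (1 / h ^ CARD('n)) * (ennreal ((3 * h) ^ CARD('n)) * (ennreal (D powr (a + \<theta>) * \<phi> a \<theta> u (wq w x h)) * k x)) \<partial>lebesgue)"
        by (intro nn_integral_cmult[symmetric]) measurable
      also have "\<dots> = (\<integral>\<^sup>+x. ennreal E * (ennreal (\<phi> a \<theta> u (wq w x h)) * k x) \<partial>lebesgue)"
        using h E by (intro nn_integral_cong) (simp add: E_def mult.assoc[symmetric] power_mult_distrib flip: ennreal_mult)
      finally show ?thesis by (simp add: mult_left_mono)
    qed
    have "(\<Sum>j. ennreal (1 / (l / 2 ^ j) ^ CARD('n)) * (\<integral>\<^sup>+c. ennreal (\<phi> a \<theta> u (wq w c (3 * (l / 2 ^ j)))) *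
       (\<integral>\<^sup>+x\<in>cube c (3 * (l / 2 ^ j)). k x \<partial>lebesgue) \<partial>lebesgue)) \<le>
       (\<Sum>j. \<integral>\<^sup>+x. ennreal E * (ennreal (\<phi> a \<theta> u (wq w x (l / 2 ^ j))) * k x) \<partial>lebesgue)"
      using l by (intro suminf_le step summableI) auto
    also have "\<dots> = (\<integral>\<^sup>+x. (\<Sum>j. ennreal E * (ennreal (\<phi> a \<theta> u (wq w x (l / 2 ^ j))) * k x)) \<partial>lebesgue)"
      by (rule nn_integral_suminf[symmetric]) measurable
    also have "\<dots> \<le> (\<integral>\<^sup>+x. ennreal (S * u powr a) * k x \<partial>lebesgue)"
    proof (intro nn_integral_mono)
      fix x
      have "(\<Sum>j. ennreal (\<phi> a \<theta> u (wq w x (l / 2 ^ j)))) \<le> ennreal (S0 * u powr a)"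
        unfolding \<phi>_def S0_def using l reverse_doubling[of "l / 2 ^ j" x for j]
        by (intro suminf_two_sided_geometric rho u a \<theta> w_cube_pos) (auto simp: mult.commute)
      then have "ennreal E * ((\<Sum>j. ennreal (\<phi> a \<theta> u (wq w x (l / 2 ^ j)))) * k x) \<le> ennreal E * (ennreal (S0 * u powr a) * k x)"
        by (intro mult_left_mono mult_right_mono) auto
      also have "\<dots> = ennreal (S * u powr a) * k x"
        using E S0 by (simp add: S_def E_def mult.assoc[symmetric] flip: ennreal_mult)
      finally show "(\<Sum>j. ennreal E * (ennreal (\<phi> a \<theta> u (wq w x (l / 2 ^ j))) * k x)) \<le> ennreal (S * u powr a) * k x"
        by (simp add: ennreal_suminf_cmult ennreal_suminf_multc)
    qed
    also have "\<dots> = ennreal (S * u powr a) * (\<integral>\<^sup>+x. k x \<partial>lebesgue)" by (rule nn_integral_cmult) measurable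
    finally show ?thesis .
  qed
  from that[OF S main] show thesis .
qed

end

text \<open>If \<open>F \<le> L powr p * e\<close> the first term alone dominates, otherwise the
  second. The right side is linear in \<open>e\<close> and \<open>F\<close>, which is what makes it
  summable over cubes.\<close>

lemma real_Young_lambda:
  fixes e F L p :: real
  assumes "p > 1" "e \<ge> 0" "F \<ge> 0" "L > 0"
  shows "e powr (1 - 1 / p) * F powr (1 / p) \<le> L * e + L powr (1 - p) * F"
proof (cases "F \<le> L powr p * e")
  case True
  then have "F powr (1 / p) \<le> (L powr p * e) powr (1 / p)" using assms by (intro powr_mono2) auto
  also have "\<dots> = L * e powr (1 / p)" using assms by (simp add: powr_mult powr_powr)
  finally have "e powr (1 - 1 / p) * F powr (1 / p) \<le> e powr (1 - 1 / p) * (L * e powr (1 / p))"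
    by (intro mult_left_mono) auto
  also have "\<dots> = L * (e powr (1 - 1 / p) * e powr (1 / p))" by (simp only: mult_ac)
  also have "e powr (1 - 1 / p) * e powr (1 / p) = e" using assms by (simp flip: powr_add)
  finally show ?thesis using assms by (simp add: add_increasing2)
next
  case False
  then have "e \<le> L powr (- p) * F" using assms by (simp add: powr_minus field_simps)
  then have "e powr (1 - 1 / p) \<le> (L powr (- p) * F) powr (1 - 1 / p)" using assms by (intro powr_mono2) auto
  also have "\<dots> = L powr (1 - p) * F powr (1 - 1 / p)"
    using assms by (simp add: powr_mult powr_powr algebra_simps)
  finally have "e powr (1 - 1 / p) * F powr (1 / p) \<le> L powr (1 - p) * F powr (1 - 1 / p) * F powr (1 / p)"
    by (intro mult_right_mono) auto
  also have "\<dots> = L powr (1 - p) * F" using assms by (simp add: mult.assoc flip: powr_add)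
  finally show ?thesis using assms by (simp add: add_increasing)
qed

text \<open>The two terms balance at \<open>L = (F / u) powr (1 / p)\<close>. For
  \<open>F = 0\<close> this value is not positive, and arbitrarily small \<open>L\<close> are used
  instead.\<close>

lemma optimize_lambda:
  fixes T F :: ennreal and c u p :: real
  assumes p: "p > 1" and c: "c > 0" and u: "u > 0"
    and T: "\<And>L. L > 0 \<Longrightarrow> T \<le> ennreal c * (ennreal (L * u) + ennreal (L powr (1 - p)) * F)"
  shows "T \<le> ennreal (2 * c * u powr (1 - 1 / p)) * epowr F (1 / p)"
proof (cases F)
  case top
  then show ?thesis using p c u by (simp add: ennreal_mult_top)
next
  case (real x)
  show ?thesis
  proof (cases "x = 0")
    case True
    have "T \<le> 0"
    proof (rule ennreal_le_epsilon)
      fix e :: real assume e: "e > 0"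
      have "T \<le> ennreal c * ennreal (e / (c * u) * u)"
        using T[of "e / (c * u)"] e c u real True by simp
      also have "\<dots> = ennreal e" using e c u by (simp flip: ennreal_mult)
      finally show "T \<le> 0 + ennreal e" by simp
    qed
    then show ?thesis by simp
  next
    case False
    then have x: "x > 0" using real by simp
    define L where "L = (x / u) powr (1 / p)"
    have L: "L > 0" using x u by (simp add: L_def)
    have 1: "L * u = x powr (1 / p) * u powr (1 - 1 / p)"
      using x u by (simp add: L_def powr_divide powr_diff)
    have "L powr (1 - p) = (x / u) powr (1 / p - 1)"
      using p by (simp add: L_def powr_powr right_diff_distrib)
    then have 2: "L powr (1 - p) * x = x powr (1 / p) * u powr (1 - 1 / p)"
      using x u by (simp add: powr_divide powr_diff)
    have "T \<le> ennreal c * (ennreal (L * u) + ennreal (L powr (1 - p)) * F)" by (rule T[OF L])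
    also have "\<dots> = ennreal (2 * c * u powr (1 - 1 / p)) * epowr F (1 / p)"
      using real x u c p L 1 2 by (simp add: epowr_ennreal algebra_simps flip: ennreal_mult ennreal_plus)
    finally show ?thesis .
  qed
qed

section \<open>Kernel bounds and summation over small and large scales\<close>

lemma riesz_kernel_le:
  fixes x z :: "real^'n"
  assumes "\<gamma> < real CARD('n)" "d > 0" "d < \<bar>x $ i - z $ i\<bar>"
  shows "riesz_kernel \<gamma> (x - z) \<le> d powr (\<gamma> - real CARD('n))"
proof -
  have "d \<le> norm (x - z)" using component_le_norm_cart[of "x - z" i] assms by simp
  then have "norm (x - z) powr (\<gamma> - real CARD('n)) \<le> d powr (\<gamma> - real CARD('n))"
    using assms by (intro powr_mono2') auto
  moreover have "riesz_kernel \<gamma> (x - z) = norm (x - z) powr (\<gamma> - real CARD('n))"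
    unfolding riesz_kernel_def by (metis inverse_eq_divide minus_diff_eq powr_minus)
  ultimately show ?thesis by simp
qed

lemma powr_half_eq: "x / 2 powr (e::real) = 2 powr (- e) * x"
  by (simp add: powr_minus divide_inverse)

lemma nat_first_change:
  assumes "P (0::nat)" "\<not> P N"
  shows "\<exists>j. P j \<and> \<not> P (Suc j)"
proof (rule ccontr)
  assume "\<not> ?thesis"
  then have "P j" for j by (induction j) (use assms in auto)
  then show False using assms by blast
qed

text \<open>From here on the BMO and bump hypotheses enter only through
  \<open>cube_est\<close>.\<close>

locale cube_bound = Ainf_weight w \<rho> for w :: "real^'n \<Rightarrow> real" and \<rho> +
  fixes b \<nu> :: "real^'n \<Rightarrow> real" and \<gamma> p q m K :: real
  assumes b_measurable [measurable]: "b \<in> borel_measurable lebesgue"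
    and nu_measurable [measurable]: "\<nu> \<in> borel_measurable lebesgue"
    and exps: "1 < p" "p < q" "q < m" and gamma: "\<gamma> < real CARD('n)" and K_pos: "K > 0"
    and cube_est: "\<And>c l E f. l > 0 \<Longrightarrow> E \<in> sets lebesgue \<Longrightarrow> E \<subseteq> cube c l \<Longrightarrow> f \<in> borel_measurable lebesgue \<Longrightarrow>
      (\<integral>\<^sup>+x\<in>E. (\<integral>\<^sup>+z\<in>cube c l. ennreal (\<bar>b x - b z\<bar> * \<bar>f z\<bar> * w x) \<partial>lebesgue) \<partial>lebesgue) \<le>
      ennreal (K * l powr (real CARD('n) - \<gamma>) * wq w c l powr (1 / m - 1 / q)) * epowr (wmeas w E) (1 - 1 / m) *
      epowr (\<integral>\<^sup>+z\<in>cube c l. ennreal (\<bar>f z\<bar> powr p * \<nu> z) \<partial>lebesgue) (1 / p)"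
begin

definition G :: "(real^'n \<Rightarrow> real) \<Rightarrow> real^'n \<Rightarrow> real^'n \<Rightarrow> ennreal" where
  "G f x z = ennreal (\<bar>b x - b z\<bar> * \<bar>f z\<bar> * w x)"

definition Fp :: "(real^'n \<Rightarrow> real) \<Rightarrow> real^'n \<Rightarrow> real \<Rightarrow> ennreal" where
  "Fp f c l = (\<integral>\<^sup>+z\<in>cube c l. ennreal (\<bar>f z\<bar> powr p * \<nu> z) \<partial>lebesgue)"

lemma G_measurable [measurable]:
  assumes [measurable]: "f \<in> borel_measurable lebesgue" "g \<in> M \<rightarrow>\<^sub>M lebesgue" "h \<in> M \<rightarrow>\<^sub>M lebesgue"
  shows "(\<lambda>t. G f (g t) (h t)) \<in> borel_measurable M"
  unfolding G_def by measurable

lemma kernel_measurable [measurable]: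
  assumes g: "g \<in> M \<rightarrow>\<^sub>M (lebesgue :: (real^'n) measure)" and h: "h \<in> M \<rightarrow>\<^sub>M (lebesgue :: (real^'n) measure)"
  shows "(\<lambda>t. riesz_kernel \<gamma> (g t - h t)) \<in> borel_measurable M"
proof -
  have [measurable]: "g \<in> borel_measurable M" "h \<in> borel_measurable M"
    using measurable_lebesgue_imp_borel[OF g] measurable_lebesgue_imp_borel[OF h] by auto
  show ?thesis unfolding riesz_kernel_def by measurable
qed

text \<open>If \<open>z\<close> is in \<open>cube x (2 * h)\<close>, every center \<open>c\<close>
  in \<open>cube x h\<close>, a set of measure \<open>h ^ n\<close>, has both \<open>x\<close> and
  \<open>z\<close> in \<open>cube c (3 * h)\<close>. Averaging over these centers localizes both
  variables to a common cube, as a dyadic grid cannot do for close points on different sides of a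
  face.\<close>

lemma pair_average:
  assumes [measurable]: "f \<in> borel_measurable lebesgue" "E \<in> sets lebesgue" and h: "h > 0"
  shows "(\<integral>\<^sup>+x\<in>E. (\<integral>\<^sup>+z\<in>cube x (2 * h). G f x z \<partial>lebesgue) \<partial>lebesgue) \<le>
     ennreal (1 / h ^ CARD('n)) * (\<integral>\<^sup>+c. (\<integral>\<^sup>+x\<in>E \<inter> cube c (3 * h). (\<integral>\<^sup>+z\<in>cube c (3 * h). G f x z \<partial>lebesgue) \<partial>lebesgue) \<partial>lebesgue)"
proof -
  let ?Q = "\<lambda>x c z. x \<in> E \<and> x \<in> cube c (3 * h) \<and> z \<in> cube c (3 * h)"
  have one: "1 = ennreal (1 / h ^ CARD('n)) * emeasure lebesgue (cube x h)" for x :: "real^'n"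
    using h by (simp add: emeasure_cube del: emeasure_completion flip: ennreal_mult)
  have "(\<integral>\<^sup>+x\<in>E. (\<integral>\<^sup>+z\<in>cube x (2 * h). G f x z \<partial>lebesgue) \<partial>lebesgue) =
      (\<integral>\<^sup>+x. (\<integral>\<^sup>+z. (if x \<in> E \<and> z \<in> cube x (2 * h) then G f x z else 0) \<partial>lebesgue) \<partial>lebesgue)"
    by (intro nn_integral_cong, subst nn_integral_multc[symmetric]) (auto intro!: nn_integral_cong split: split_indicator)
  also have "\<dots> \<le> (\<integral>\<^sup>+x. (\<integral>\<^sup>+z. ennreal (1 / h ^ CARD('n)) * (\<integral>\<^sup>+c. (if ?Q x c z then G f x z else 0) \<partial>lebesgue) \<partial>lebesgue) \<partial>lebesgue)"
  proof (intro nn_integral_mono)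
    fix x z :: "real^'n"
    show "(if x \<in> E \<and> z \<in> cube x (2 * h) then G f x z else 0) \<le> ennreal (1 / h ^ CARD('n)) * (\<integral>\<^sup>+c. (if ?Q x c z then G f x z else 0) \<partial>lebesgue)"
    proof (cases "x \<in> E \<and> z \<in> cube x (2 * h)")
      case True
      have sub: "x \<in> cube c (3 * h) \<and> z \<in> cube c (3 * h)" if "c \<in> cube x h" for c
      proof -
        have "\<bar>x $ i - c $ i\<bar> \<le> 3 * h / 2 \<and> \<bar>z $ i - c $ i\<bar> \<le> 3 * h / 2" for i
        proof -
          have "\<bar>c $ i - x $ i\<bar> \<le> h / 2" "\<bar>z $ i - x $ i\<bar> \<le> h"
            using that True by (auto simp: mem_cube)
          then show ?thesis by arith
        qed
        then show ?thesis by (simp add: mem_cube)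
      qed
      have "ennreal (1 / h ^ CARD('n)) * (G f x z * emeasure lebesgue (cube x h)) =
          (ennreal (1 / h ^ CARD('n)) * emeasure lebesgue (cube x h)) * G f x z"
        by (simp only: mult_ac)
      then have "G f x z = ennreal (1 / h ^ CARD('n)) * (G f x z * emeasure lebesgue (cube x h))"
        by (simp only: one[symmetric] mult_1_left)
      also have "G f x z * emeasure lebesgue (cube x h) = (\<integral>\<^sup>+c. G f x z * indicator (cube x h) c \<partial>lebesgue)"
        by (rule nn_integral_cmult_indicator[symmetric]) simp
      also have "ennreal (1 / h ^ CARD('n)) * \<dots> \<le> ennreal (1 / h ^ CARD('n)) * (\<integral>\<^sup>+c. (if ?Q x c z then G f x z else 0) \<partial>lebesgue)"
        using True sub by (intro mult_left_mono nn_integral_mono) (auto split: split_indicator)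
      finally show ?thesis using True by simp
    qed auto
  qed
  also have "\<dots> = ennreal (1 / h ^ CARD('n)) * (\<integral>\<^sup>+x. (\<integral>\<^sup>+z. (\<integral>\<^sup>+c. (if ?Q x c z then G f x z else 0) \<partial>lebesgue) \<partial>lebesgue) \<partial>lebesgue)"
    by (simp add: nn_integral_cmult)
  also have "(\<integral>\<^sup>+x. (\<integral>\<^sup>+z. (\<integral>\<^sup>+c. (if ?Q x c z then G f x z else 0) \<partial>lebesgue) \<partial>lebesgue) \<partial>lebesgue) =
      (\<integral>\<^sup>+x. (\<integral>\<^sup>+c. (\<integral>\<^sup>+z. (if ?Q x c z then G f x z else 0) \<partial>lebesgue) \<partial>lebesgue) \<partial>lebesgue)"
    by (intro nn_integral_cong lebesgue_pair.Fubini') measurable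
  also have "\<dots> = (\<integral>\<^sup>+c. (\<integral>\<^sup>+x. (\<integral>\<^sup>+z. (if ?Q x c z then G f x z else 0) \<partial>lebesgue) \<partial>lebesgue) \<partial>lebesgue)"
    by (rule lebesgue_pair.Fubini') measurable
  also have "\<dots> = (\<integral>\<^sup>+c. (\<integral>\<^sup>+x\<in>E \<inter> cube c (3 * h). (\<integral>\<^sup>+z\<in>cube c (3 * h). G f x z \<partial>lebesgue) \<partial>lebesgue) \<partial>lebesgue)"
    by (intro nn_integral_cong, subst nn_integral_multc[symmetric]) (auto intro!: nn_integral_cong split: split_indicator)
  finally show ?thesis .
qed

text \<open>In \<open>\<phi>\<close>, \<open>a\<close> governs the decay towards small masses and
  \<open>\<theta>\<close> the decay towards large ones; \<open>p < q\<close> and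
  \<open>q < m\<close> make them positive.\<close>

definition a where "a = 1 / p - 1 / q"
definition \<theta> where "\<theta> = 1 / q - 1 / m"

lemma a_\<theta>_pos: "a > 0" "\<theta> > 0" "a + \<theta> = 1 / p - 1 / m"
  using exps by (auto simp: a_def \<theta>_def field_simps)

text \<open>The power \<open>1 - 1/m\<close> of \<open>e\<close> is split as
  \<open>(1/p - 1/m) + (1 - 1/p)\<close>. The first part equals \<open>a + \<theta>\<close> and is
  absorbed by \<open>\<phi>\<close> through \<open>e \<le> u\<close> and \<open>e \<le> W\<close>;
  the second is what the parametrized Young inequality pairs with \<open>F\<close>.\<close>

lemma cube_term_le:
  assumes u: "u > 0" and W: "W > 0" and L: "L > 0" and e: "e \<le> ennreal u" "e \<le> ennreal W"
  shows "ennreal (W powr (1 / m - 1 / q)) * epowr e (1 - 1 / m) * epowr F (1 / p) \<le>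
     ennreal (\<phi> a \<theta> u W) * (ennreal L * e + ennreal (L powr (1 - p)) * F)"
proof -
  have phi: "\<phi> a \<theta> u W > 0" using u W by (simp add: \<phi>_def)
  show ?thesis
  proof (cases F)
    case top
    then show ?thesis using phi L by (simp add: ennreal_mult_top)
  next
    case (real F')
    obtain e' where e': "e = ennreal e'" "e' \<ge> 0" "e' \<le> u" "e' \<le> W"
      using e u W by (cases e) (auto simp: ennreal_le_iff top_unique)
    have "W powr (- \<theta>) * e' powr (1 / p - 1 / m) \<le> \<phi> a \<theta> u W"
    proof -
      have "e' powr (a + \<theta>) \<le> W powr (a + \<theta>)" "e' powr (a + \<theta>) \<le> u powr (a + \<theta>)"
        using e' a_\<theta>_pos by (auto intro!: powr_mono2)
      then have "W powr (- \<theta>) * e' powr (a + \<theta>) \<le> W powr (- \<theta>) * W powr (a + \<theta>)"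
        and "W powr (- \<theta>) * e' powr (a + \<theta>) \<le> W powr (- \<theta>) * u powr (a + \<theta>)"
        by (auto intro!: mult_left_mono)
      moreover have "W powr (- \<theta>) * W powr (a + \<theta>) = W powr a" using W by (simp flip: powr_add)
      ultimately show ?thesis unfolding \<phi>_def a_\<theta>_pos(3)[symmetric] by (simp add: mult.commute)
    qed
    then have "(W powr (- \<theta>) * e' powr (1 / p - 1 / m)) * (e' powr (1 - 1 / p) * F' powr (1 / p)) \<le>
        \<phi> a \<theta> u W * (L * e' + L powr (1 - p) * F')"
      using e' real L exps by (intro mult_mono real_Young_lambda) auto
    also have "(W powr (- \<theta>) * e' powr (1 / p - 1 / m)) * (e' powr (1 - 1 / p) * F' powr (1 / p)) =
        W powr (1 / m - 1 / q) * (e' powr (1 / p - 1 / m) * e' powr (1 - 1 / p)) * F' powr (1 / p)"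
      by (simp add: \<theta>_def mult_ac)
    also have "e' powr (1 / p - 1 / m) * e' powr (1 - 1 / p) = e' powr (1 - 1 / m)"
      by (simp flip: powr_add)
    finally have "W powr (1 / m - 1 / q) * e' powr (1 - 1 / m) * F' powr (1 / p) \<le> \<phi> a \<theta> u W * (L * e' + L powr (1 - p) * F')" .
    then show ?thesis using e' real L exps
      by (simp add: epowr_ennreal_pos ennreal_leI flip: ennreal_mult ennreal_plus)
  qed
qed

text \<open>At the last scale whose cube about \<open>x\<close> still contains \<open>z\<close>, the
  largest coordinate difference exceeds half of that scale, so one term of the series dominates.
  Taking the full series avoids splitting the domain into annuli. On the diagonal the factor
  \<open>b x - b z\<close> vanishes.\<close>

lemma kernel_le_sum:
  assumes l: "l > 0" and z: "z \<in> cube x (2 * l)"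
  shows "ennreal (riesz_kernel \<gamma> (x - z)) * G f x z \<le>
    (\<Sum>j. ennreal (2 powr (real CARD('n) - \<gamma>) * (l / 2 ^ j) powr (\<gamma> - real CARD('n))) * (G f x z * indicator (cube x (2 * (l / 2 ^ j))) z))"
proof (cases "x = z")
  case True
  then show ?thesis by (simp add: G_def)
next
  case False
  then obtain i where i: "\<bar>x $ i - z $ i\<bar> > 0" by (auto simp: vec_eq_iff)
  obtain M where "l / \<bar>x $ i - z $ i\<bar> < 2 ^ M" using real_arch_pow[of 2] by auto
  then have "l / 2 ^ M < \<bar>x $ i - z $ i\<bar>" using i by (simp add: field_simps)
  then have "z \<notin> cube x (2 * (l / 2 ^ M))" by (auto simp: mem_cube abs_minus_commute not_le)
  then obtain j where j: "z \<in> cube x (2 * (l / 2 ^ j))" "z \<notin> cube x (2 * (l / 2 ^ Suc j))"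
    using nat_first_change[of "\<lambda>j. z \<in> cube x (2 * (l / 2 ^ j))" M] z by auto
  from j(2) obtain k where k: "l / 2 ^ j / 2 < \<bar>x $ k - z $ k\<bar>"
    by (auto simp: mem_cube not_le abs_minus_commute)
  have "riesz_kernel \<gamma> (x - z) \<le> (l / 2 ^ j / 2) powr (\<gamma> - real CARD('n))"
    using l by (intro riesz_kernel_le[OF gamma _ k]) auto
  also have "\<dots> = 2 powr (real CARD('n) - \<gamma>) * (l / 2 ^ j) powr (\<gamma> - real CARD('n))"
    unfolding powr_divide[of "l / 2 ^ j" 2] powr_half_eq by simp
  finally have "ennreal (riesz_kernel \<gamma> (x - z)) * G f x z \<le>
      ennreal (2 powr (real CARD('n) - \<gamma>) * (l / 2 ^ j) powr (\<gamma> - real CARD('n))) * (G f x z * indicator (cube x (2 * (l / 2 ^ j))) z)"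
    using j(1) by (auto intro!: mult_right_mono ennreal_leI)
  also have "\<dots> \<le> (\<Sum>j. ennreal (2 powr (real CARD('n) - \<gamma>) * (l / 2 ^ j) powr (\<gamma> - real CARD('n))) * (G f x z * indicator (cube x (2 * (l / 2 ^ j))) z))"
    using sum_le_suminf[OF summableI, of "{j}"] by simp
  finally show ?thesis .
qed

lemma Fp_mono: "l \<le> r \<Longrightarrow> Fp f c l \<le> Fp f c r"
  unfolding Fp_def using cube_mono[of l r c] by (intro nn_integral_mono) (auto split: split_indicator)

text \<open>In the bound of one cube the power \<open>n - \<gamma>\<close> of the side cancels the
  size of the kernel at that scale, so the scales interact only through the masses, which
  \<open>multiscale_sum_le\<close> controls.\<close>

lemma local_part:
  obtains C where "C > 0" "\<And>y l E f u. l > 0 \<Longrightarrow> E \<in> sets lebesgue \<Longrightarrow> E \<subseteq> cube y l \<Longrightarrow> u > 0 \<Longrightarrow>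
    wmeas w E = ennreal u \<Longrightarrow> f \<in> borel_measurable lebesgue \<Longrightarrow>
    (\<integral>\<^sup>+x\<in>E. (\<integral>\<^sup>+z\<in>cube x (2 * l). ennreal (riesz_kernel \<gamma> (x - z)) * G f x z \<partial>lebesgue) \<partial>lebesgue) \<le>
    ennreal (C * u powr (1 - 1 / q)) * epowr (Fp f y (3 * l)) (1 / p)"
proof -
  obtain S where S: "S > 0" and ms: "\<And>u l k. u > 0 \<Longrightarrow> l > 0 \<Longrightarrow> k \<in> borel_measurable lebesgue \<Longrightarrow>
    (\<Sum>j. ennreal (1 / (l / 2 ^ j) ^ CARD('n)) * (\<integral>\<^sup>+c. ennreal (\<phi> a \<theta> u (wq w c (3 * (l / 2 ^ j)))) *
       (\<integral>\<^sup>+x\<in>cube c (3 * (l / 2 ^ j)). k x \<partial>lebesgue) \<partial>lebesgue)) \<le> ennreal (S * u powr a) * (\<integral>\<^sup>+x. k x \<partial>(lebesgue :: (real^'n) measure))"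
    by (rule multiscale_sum_le[OF a_\<theta>_pos(1,2)], rule that)
  \<comment> \<open>A factor \<open>2\<close> comes from the kernel bound at half the scale and a
    factor \<open>3\<close> from the enlarged cubes of the averaging.\<close>
  define C0 where "C0 = K * 6 powr (real CARD('n) - \<gamma>)"
  have C0: "C0 > 0" using K_pos by (simp add: C0_def)
  have main: "(\<integral>\<^sup>+x\<in>E. (\<integral>\<^sup>+z\<in>cube x (2 * l). ennreal (riesz_kernel \<gamma> (x - z)) * G f x z \<partial>lebesgue) \<partial>lebesgue) \<le>
    ennreal (2 * C0 * S * u powr (1 - 1 / q)) * epowr (Fp f y (3 * l)) (1 / p)"
    if l: "l > 0" and E[measurable]: "E \<in> sets lebesgue" and sub: "E \<subseteq> cube y l" and u: "u > 0"
      and wE: "wmeas w E = ennreal u" and f[measurable]: "f \<in> borel_measurable lebesgue" for y l E f u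
  proof -
    let ?T = "\<integral>\<^sup>+x\<in>E. (\<integral>\<^sup>+z\<in>cube x (2 * l). ennreal (riesz_kernel \<gamma> (x - z)) * G f x z \<partial>lebesgue) \<partial>lebesgue"
    \<comment> \<open>For \<open>x\<close> in \<open>cube y l\<close> only values of
      \<open>f\<close> on \<open>cube y (3 * l)\<close> matter; cutting off makes the total integral
      of \<open>\<bar>f0\<bar>^p \<nu>\<close> equal to \<open>Fp f y (3 * l)\<close>.\<close>
    define f0 where "f0 = (\<lambda>z. f z * indicator (cube y (3 * l)) z)"
    have f0[measurable]: "f0 \<in> borel_measurable lebesgue" unfolding f0_def by measurable
    define h where "h j = l / 2 ^ j" for j :: nat
    have h: "h j > 0" for j using l by (simp add: h_def)
    define cj where "cj j = 2 powr (real CARD('n) - \<gamma>) * h j powr (\<gamma> - real CARD('n))" for j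
    have cj: "cj j \<ge> 0" for j by (simp add: cj_def)
    have G0: "G f x z = G f0 x z" if "x \<in> E" "z \<in> cube x (2 * l)" for x z
    proof -
      have "z \<in> cube y (3 * l)" unfolding mem_cube
      proof
        fix i
        have "\<bar>x $ i - y $ i\<bar> \<le> l / 2" "\<bar>z $ i - x $ i\<bar> \<le> l" using that sub by (auto simp: mem_cube)
        then show "\<bar>z $ i - y $ i\<bar> \<le> 3 * l / 2" by arith
      qed
      then show ?thesis by (simp add: G_def f0_def)
    qed
    let ?I = "\<lambda>c j. \<integral>\<^sup>+x\<in>E \<inter> cube c (3 * h j). (\<integral>\<^sup>+z\<in>cube c (3 * h j). G f0 x z \<partial>lebesgue) \<partial>lebesgue"
    have "?T \<le> (\<integral>\<^sup>+x\<in>E. (\<integral>\<^sup>+z. (\<Sum>j. ennreal (cj j) * (G f0 x z * indicator (cube x (2 * h j)) z)) \<partial>lebesgue) \<partial>lebesgue)"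
    proof (intro nn_integral_mono)
      fix x
      show "(\<integral>\<^sup>+z\<in>cube x (2 * l). ennreal (riesz_kernel \<gamma> (x - z)) * G f x z \<partial>lebesgue) * indicator E x \<le>
        (\<integral>\<^sup>+z. (\<Sum>j. ennreal (cj j) * (G f0 x z * indicator (cube x (2 * h j)) z)) \<partial>lebesgue) * indicator E x"
      proof (cases "x \<in> E")
        case True
        have "(\<integral>\<^sup>+z\<in>cube x (2 * l). ennreal (riesz_kernel \<gamma> (x - z)) * G f x z \<partial>lebesgue) \<le>
          (\<integral>\<^sup>+z. (\<Sum>j. ennreal (cj j) * (G f0 x z * indicator (cube x (2 * h j)) z)) \<partial>lebesgue)"
        proof (intro nn_integral_mono)
          fix z
          show "ennreal (riesz_kernel \<gamma> (x - z)) * G f x z * indicator (cube x (2 * l)) z \<le>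
             (\<Sum>j. ennreal (cj j) * (G f0 x z * indicator (cube x (2 * h j)) z))"
            using kernel_le_sum[OF l, of z x f0] G0[OF True, of z]
            by (cases "z \<in> cube x (2 * l)") (simp_all add: cj_def h_def)
        qed
        then show ?thesis by (intro mult_right_mono) auto
      qed simp
    qed
    also have "\<dots> = (\<integral>\<^sup>+x. (\<Sum>j. ennreal (cj j) * ((\<integral>\<^sup>+z\<in>cube x (2 * h j). G f0 x z \<partial>lebesgue) * indicator E x)) \<partial>lebesgue)"
    proof (intro nn_integral_cong)
      fix x
      have [measurable]: "(\<lambda>z. G f0 x z) \<in> borel_measurable lebesgue" by measurable
      have "(\<integral>\<^sup>+z. (\<Sum>j. ennreal (cj j) * (G f0 x z * indicator (cube x (2 * h j)) z)) \<partial>lebesgue) =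
         (\<Sum>j. ennreal (cj j) * (\<integral>\<^sup>+z\<in>cube x (2 * h j). G f0 x z \<partial>lebesgue))"
        by (subst nn_integral_suminf) (simp_all add: nn_integral_cmult)
      then show "(\<integral>\<^sup>+z. (\<Sum>j. ennreal (cj j) * (G f0 x z * indicator (cube x (2 * h j)) z)) \<partial>lebesgue) * indicator E x =
         (\<Sum>j. ennreal (cj j) * ((\<integral>\<^sup>+z\<in>cube x (2 * h j). G f0 x z \<partial>lebesgue) * indicator E x))"
        by (simp add: ennreal_suminf_multc[symmetric] mult.assoc)
    qed
    also have "\<dots> = (\<Sum>j. ennreal (cj j) * (\<integral>\<^sup>+x\<in>E. (\<integral>\<^sup>+z\<in>cube x (2 * h j). G f0 x z \<partial>lebesgue) \<partial>lebesgue))"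
    proof -
      have [measurable]: "(\<lambda>x. \<integral>\<^sup>+z. G f0 x z * indicator (cube x (2 * h j)) z \<partial>lebesgue) \<in> borel_measurable lebesgue" for j
      proof -
        have "(\<lambda>x. \<integral>\<^sup>+z. (if z \<in> cube x (2 * h j) then G f0 x z else 0) \<partial>lebesgue) \<in> borel_measurable lebesgue"
          by measurable
        then show ?thesis by (rule back_subst[where P="\<lambda>f. f \<in> borel_measurable lebesgue"])
          (auto intro!: ext nn_integral_cong)
      qed
      show ?thesis by (subst nn_integral_suminf) (simp_all add: nn_integral_cmult)
    qed
    also have "\<dots> \<le> (\<Sum>j. ennreal (cj j) * (ennreal (1 / h j ^ CARD('n)) * (\<integral>\<^sup>+c. ?I c j \<partial>lebesgue)))"
      by (intro suminf_le mult_left_mono pair_average h summableI) auto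
    also have "\<dots> = (\<Sum>j. ennreal (1 / h j ^ CARD('n)) * (ennreal (cj j) * (\<integral>\<^sup>+c. ?I c j \<partial>lebesgue)))"
      by (simp only: mult.left_commute)
    finally have T1: "?T \<le> (\<Sum>j. ennreal (1 / h j ^ CARD('n)) * (ennreal (cj j) * (\<integral>\<^sup>+c. ?I c j \<partial>lebesgue)))" .
    have "?T \<le> ennreal (C0 * S * u powr a) * (ennreal (L * u) + ennreal (L powr (1 - p)) * Fp f y (3 * l))" if L: "L > 0" for L
    proof -
      \<comment> \<open>The linearized bounds are integrals of this single density over the cubes.
        The same \<open>L\<close> is used everywhere, so only the total integral of \<open>k\<close>
        survives the summation.\<close>
      define k where "k = (\<lambda>x. ennreal L * (ennreal (w x) * indicator E x) + ennreal (L powr (1 - p)) * ennreal (\<bar>f0 x\<bar> powr p * \<nu> x))"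
      have k[measurable]: "k \<in> borel_measurable lebesgue" unfolding k_def by measurable
      have kint: "(\<integral>\<^sup>+x\<in>A. k x \<partial>lebesgue) = ennreal L * wmeas w (E \<inter> A) + ennreal (L powr (1 - p)) * (\<integral>\<^sup>+x\<in>A. ennreal (\<bar>f0 x\<bar> powr p * \<nu> x) \<partial>lebesgue)"
        if [measurable]: "A \<in> sets lebesgue" for A
      proof -
        have "(\<integral>\<^sup>+x\<in>A. k x \<partial>lebesgue) = (\<integral>\<^sup>+x. ennreal L * (ennreal (w x) * indicator (E \<inter> A) x) + ennreal (L powr (1 - p)) * (ennreal (\<bar>f0 x\<bar> powr p * \<nu> x) * indicator A x) \<partial>lebesgue)"
          unfolding k_def by (intro nn_integral_cong) (auto split: split_indicator)
        also have "\<dots> = ennreal L * wmeas w (E \<inter> A) + ennreal (L powr (1 - p)) * (\<integral>\<^sup>+x\<in>A. ennreal (\<bar>f0 x\<bar> powr p * \<nu> x) \<partial>lebesgue)"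
          unfolding wmeas_def by (subst nn_integral_add, measurable) (simp add: nn_integral_cmult)
        finally show ?thesis .
      qed
      have ktot: "(\<integral>\<^sup>+x. k x \<partial>lebesgue) = ennreal (L * u) + ennreal (L powr (1 - p)) * Fp f y (3 * l)"
      proof -
        have "Fp f y (3 * l) = (\<integral>\<^sup>+x. ennreal (\<bar>f0 x\<bar> powr p * \<nu> x) \<partial>lebesgue)"
          unfolding Fp_def f0_def using exps by (intro nn_integral_cong) (auto split: split_indicator)
        then show ?thesis using kint[of UNIV] wE L u by (simp add: ennreal_mult)
      qed
      have term_le: "ennreal (cj j) * ?I c j \<le> ennreal C0 * (ennreal (\<phi> a \<theta> u (wq w c (3 * h j))) * (\<integral>\<^sup>+x\<in>cube c (3 * h j). k x \<partial>lebesgue))" for c j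
      proof -
        let ?P = "cube c (3 * h j)" and ?W = "wq w c (3 * h j)"
        let ?F = "\<integral>\<^sup>+z\<in>?P. ennreal (\<bar>f0 z\<bar> powr p * \<nu> z) \<partial>lebesgue"
        have h3: "3 * h j > 0" using h by simp
        have "?I c j \<le> ennreal (K * (3 * h j) powr (real CARD('n) - \<gamma>) * ?W powr (1 / m - 1 / q)) * epowr (wmeas w (E \<inter> ?P)) (1 - 1 / m) * epowr ?F (1 / p)"
          unfolding G_def by (rule cube_est[OF h3]) auto
        then have "ennreal (cj j) * ?I c j \<le> ennreal (cj j) * (ennreal (K * (3 * h j) powr (real CARD('n) - \<gamma>) * ?W powr (1 / m - 1 / q)) * epowr (wmeas w (E \<inter> ?P)) (1 - 1 / m) * epowr ?F (1 / p))"
          by (rule mult_left_mono) simp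
        also have "\<dots> = ennreal (cj j * (K * (3 * h j) powr (real CARD('n) - \<gamma>))) * (ennreal (?W powr (1 / m - 1 / q)) * epowr (wmeas w (E \<inter> ?P)) (1 - 1 / m) * epowr ?F (1 / p))"
          using cj K_pos by (simp add: ennreal_mult mult.assoc)
        also have "cj j * (K * (3 * h j) powr (real CARD('n) - \<gamma>)) = C0"
        proof -
          have "(6::real) powr (real CARD('n) - \<gamma>) = 2 powr (real CARD('n) - \<gamma>) * 3 powr (real CARD('n) - \<gamma>)"
            by (simp flip: powr_mult)
          moreover have "h j powr (\<gamma> - real CARD('n)) * h j powr (real CARD('n) - \<gamma>) = 1"
            using h[of j] by (simp flip: powr_add)
          ultimately show ?thesis by (simp add: cj_def C0_def powr_mult mult_ac)
        qed
        also have "ennreal C0 * (ennreal (?W powr (1 / m - 1 / q)) * epowr (wmeas w (E \<inter> ?P)) (1 - 1 / m) * epowr ?F (1 / p)) \<le>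
            ennreal C0 * (ennreal (\<phi> a \<theta> u ?W) * (ennreal L * wmeas w (E \<inter> ?P) + ennreal (L powr (1 - p)) * ?F))"
          using wmeas_mono[of "E \<inter> ?P" E w] wmeas_mono[of "E \<inter> ?P" ?P w] wE wmeas_cube[OF weight, of c "3 * h j"]
          by (intro mult_left_mono cube_term_le u L w_cube_pos[OF h3]) auto
        finally show ?thesis by (subst kint) auto
      qed
      have [measurable]: "(\<lambda>c. \<integral>\<^sup>+x. k x * indicator (cube c r) x \<partial>lebesgue) \<in> borel_measurable lebesgue" for r
      proof -
        have "(\<lambda>c. \<integral>\<^sup>+x. (if x \<in> cube c r then k x else 0) \<partial>lebesgue) \<in> borel_measurable lebesgue"
          by measurable
        then show ?thesis by (rule back_subst[where P="\<lambda>f. f \<in> borel_measurable lebesgue"])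
          (auto intro!: ext nn_integral_cong)
      qed
      have "ennreal (cj j) * (\<integral>\<^sup>+c. ?I c j \<partial>lebesgue) \<le> ennreal C0 * (\<integral>\<^sup>+c. ennreal (\<phi> a \<theta> u (wq w c (3 * h j))) * (\<integral>\<^sup>+x\<in>cube c (3 * h j). k x \<partial>lebesgue) \<partial>lebesgue)" for j
      proof -
        have Im: "(\<lambda>c. ?I c j) \<in> borel_measurable lebesgue"
        proof -
          have "(\<lambda>c. \<integral>\<^sup>+x. (\<integral>\<^sup>+z. (if x \<in> E \<and> x \<in> cube c (3 * h j) \<and> z \<in> cube c (3 * h j) then G f0 x z else 0) \<partial>lebesgue) \<partial>lebesgue) \<in> borel_measurable lebesgue"
            by measurable
          then show ?thesis
            by (rule back_subst[where P="\<lambda>f. f \<in> borel_measurable lebesgue"])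
               (intro ext nn_integral_cong, subst nn_integral_multc[symmetric], auto intro!: nn_integral_cong split: split_indicator)
        qed
        have "ennreal (cj j) * (\<integral>\<^sup>+c. ?I c j \<partial>lebesgue) = (\<integral>\<^sup>+c. ennreal (cj j) * ?I c j \<partial>lebesgue)"
          by (rule nn_integral_cmult[symmetric, OF Im])
        also have "\<dots> \<le> (\<integral>\<^sup>+c. ennreal C0 * (ennreal (\<phi> a \<theta> u (wq w c (3 * h j))) * (\<integral>\<^sup>+x\<in>cube c (3 * h j). k x \<partial>lebesgue)) \<partial>lebesgue)"
          by (intro nn_integral_mono term_le)
        also have "\<dots> = ennreal C0 * (\<integral>\<^sup>+c. ennreal (\<phi> a \<theta> u (wq w c (3 * h j))) * (\<integral>\<^sup>+x\<in>cube c (3 * h j). k x \<partial>lebesgue) \<partial>lebesgue)"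
          by (rule nn_integral_cmult) measurable
        finally show ?thesis .
      qed
      then have "?T \<le> (\<Sum>j. ennreal (1 / h j ^ CARD('n)) * (ennreal C0 * (\<integral>\<^sup>+c. ennreal (\<phi> a \<theta> u (wq w c (3 * h j))) * (\<integral>\<^sup>+x\<in>cube c (3 * h j). k x \<partial>lebesgue) \<partial>lebesgue)))"
        by (intro order_trans[OF T1] suminf_le mult_left_mono summableI) auto
      also have "\<dots> = ennreal C0 * (\<Sum>j. ennreal (1 / h j ^ CARD('n)) * (\<integral>\<^sup>+c. ennreal (\<phi> a \<theta> u (wq w c (3 * h j))) * (\<integral>\<^sup>+x\<in>cube c (3 * h j). k x \<partial>lebesgue) \<partial>lebesgue))"
        by (simp add: mult.left_commute[of _ "ennreal C0"])
      also have "\<dots> \<le> ennreal C0 * (ennreal (S * u powr a) * (\<integral>\<^sup>+x. k x \<partial>lebesgue))"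
        unfolding h_def by (intro mult_left_mono ms u l k) auto
      also have "\<dots> = ennreal (C0 * S * u powr a) * (ennreal (L * u) + ennreal (L powr (1 - p)) * Fp f y (3 * l))"
        unfolding ktot using C0 S by (simp add: mult.assoc ennreal_mult)
      finally show ?thesis .
    qed
    then have "?T \<le> ennreal (2 * (C0 * S * u powr a) * u powr (1 - 1 / p)) * epowr (Fp f y (3 * l)) (1 / p)"
      using exps C0 S u by (intro optimize_lambda) auto
    also have "2 * (C0 * S * u powr a) * u powr (1 - 1 / p) = 2 * C0 * S * (u powr a * u powr (1 - 1 / p))"
      by (simp only: mult_ac)
    \<comment> \<open>The gain \<open>u powr a\<close> from the scales raises the exponent from the
      one dual to \<open>p\<close> to the one dual to \<open>q\<close>.\<close>
    also have "u powr a * u powr (1 - 1 / p) = u powr (1 - 1 / q)" using u by (simp add: a_def flip: powr_add)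
    finally show ?thesis .
  qed
  have "2 * C0 * S > 0" using C0 S by simp
  from that[OF this main] show thesis .
qed

text \<open>If the largest coordinate difference of \<open>x\<close> and \<open>z\<close> lies
  between \<open>2 ^ j * l\<close> and twice that, then \<open>z\<close> is within
  \<open>2 * 2 ^ j * l + l / 2\<close> of \<open>y\<close> in each coordinate. This is at most
  \<open>4 * 2 ^ j * l\<close>, half the side of the cube about \<open>y\<close>, so cubes
  concentric with \<open>cube y l\<close> suffice.\<close>

lemma kernel_le_far_sum:
  assumes l: "l > 0" and x: "x \<in> cube y l" and z: "z \<notin> cube x (2 * l)"
  shows "ennreal (riesz_kernel \<gamma> (x - z)) * G f x z \<le>
    (\<Sum>j. ennreal ((2 ^ j * l) powr (\<gamma> - real CARD('n))) * (G f x z * indicator (cube y (8 * (2 ^ j * l))) z))"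
proof -
  obtain M where "norm (z - x) / l < 2 ^ M" using real_arch_pow[of 2] by auto
  then have M: "norm (z - x) < 2 ^ M * l" using l by (simp add: field_simps)
  have "z \<in> cube x (2 * (2 ^ M * l))" unfolding mem_cube
  proof
    fix i show "\<bar>z $ i - x $ i\<bar> \<le> 2 * (2 ^ M * l) / 2"
      using component_le_norm_cart[of "z - x" i] M by simp
  qed
  then obtain j where j: "z \<notin> cube x (2 * (2 ^ j * l))" "z \<in> cube x (2 * (2 ^ Suc j * l))"
    using nat_first_change[of "\<lambda>j. z \<notin> cube x (2 * (2 ^ j * l))" M] z by auto
  from j(1) obtain k where k: "2 ^ j * l < \<bar>x $ k - z $ k\<bar>"
    by (auto simp: mem_cube not_le abs_minus_commute)
  have "z \<in> cube y (8 * (2 ^ j * l))" unfolding mem_cube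
  proof
    fix i
    have "\<bar>z $ i - x $ i\<bar> \<le> 2 * (2 ^ j * l)" "\<bar>x $ i - y $ i\<bar> \<le> l / 2" using x j(2) by (auto simp: mem_cube mult_ac)
    moreover have "1 * l \<le> 2 ^ j * l" using l by (intro mult_right_mono) auto
    ultimately show "\<bar>z $ i - y $ i\<bar> \<le> 8 * (2 ^ j * l) / 2" using l by arith
  qed
  moreover have "riesz_kernel \<gamma> (x - z) \<le> (2 ^ j * l) powr (\<gamma> - real CARD('n))"
    using l by (intro riesz_kernel_le[OF gamma _ k]) auto
  ultimately have "ennreal (riesz_kernel \<gamma> (x - z)) * G f x z \<le>
      ennreal ((2 ^ j * l) powr (\<gamma> - real CARD('n))) * (G f x z * indicator (cube y (8 * (2 ^ j * l))) z)"
    by (auto intro!: mult_right_mono ennreal_leI)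
  also have "\<dots> \<le> (\<Sum>j. ennreal ((2 ^ j * l) powr (\<gamma> - real CARD('n))) * (G f x z * indicator (cube y (8 * (2 ^ j * l))) z))"
    using sum_le_suminf[OF summableI, of "{j}"] by simp
  finally show ?thesis .
qed

text \<open>The series to which small and large scales are both reduced; the mass ratio is the decay
  that is left after \<open>w(E)\<close> has been given the exponent \<open>1 - 1/q\<close>.\<close>

definition tail_sum :: "(real^'n \<Rightarrow> real) \<Rightarrow> real^'n \<Rightarrow> real \<Rightarrow> ennreal" where
  "tail_sum f y l = (\<Sum>j. ennreal ((wq w y l / wq w y (8 * (2 ^ j * l))) powr \<theta>) * epowr (Fp f y (8 * (2 ^ j * l))) (1 / p))"

text \<open>All of \<open>E\<close> lies in each of the large cubes, so the one-cube bound applies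
  with \<open>w(E) = u\<close>. The surplus \<open>u powr \<theta>\<close> in
  \<open>u powr (1 - 1/m)\<close> is at most \<open>w(Q)^\<theta>\<close> and forms the ratio in
  \<open>tail_sum\<close> with the negative power of the large mass.\<close>

lemma far_part:
  assumes l: "l > 0" and E[measurable]: "E \<in> sets lebesgue" and sub: "E \<subseteq> cube y l" and u: "u > 0"
    and wE: "wmeas w E = ennreal u" and f[measurable]: "f \<in> borel_measurable lebesgue"
  shows "(\<integral>\<^sup>+x\<in>E. (\<integral>\<^sup>+z\<in>- cube x (2 * l). ennreal (riesz_kernel \<gamma> (x - z)) * G f x z \<partial>lebesgue) \<partial>lebesgue) \<le>
    ennreal (K * 8 powr (real CARD('n) - \<gamma>) * u powr (1 - 1 / q)) * tail_sum f y l"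
proof -
  let ?T = "\<integral>\<^sup>+x\<in>E. (\<integral>\<^sup>+z\<in>- cube x (2 * l). ennreal (riesz_kernel \<gamma> (x - z)) * G f x z \<partial>lebesgue) \<partial>lebesgue"
  define r where "r j = 8 * (2 ^ j * l)" for j :: nat
  define cj where "cj j = (2 ^ j * l) powr (\<gamma> - real CARD('n))" for j :: nat
  have r: "r j > 0" for j using l by (simp add: r_def)
  have rl: "l \<le> r j" for j
  proof -
    have "(1::real) \<le> 8 * 2 ^ j" using one_le_power[of "2::real" j] by linarith
    then have "1 * l \<le> 8 * 2 ^ j * l" using l by (intro mult_right_mono) auto
    then show ?thesis by (simp add: r_def mult.assoc)
  qed
  have cj: "cj j \<ge> 0" for j by (simp add: cj_def)
  define C where "C = K * 8 powr (real CARD('n) - \<gamma>)"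
  have C: "C > 0" using K_pos by (simp add: C_def)
  have "?T \<le> (\<integral>\<^sup>+x\<in>E. (\<integral>\<^sup>+z. (\<Sum>j. ennreal (cj j) * (G f x z * indicator (cube y (r j)) z)) \<partial>lebesgue) \<partial>lebesgue)"
  proof (intro nn_integral_mono)
    fix x
    show "(\<integral>\<^sup>+z\<in>- cube x (2 * l). ennreal (riesz_kernel \<gamma> (x - z)) * G f x z \<partial>lebesgue) * indicator E x \<le>
        (\<integral>\<^sup>+z. (\<Sum>j. ennreal (cj j) * (G f x z * indicator (cube y (r j)) z)) \<partial>lebesgue) * indicator E x"
    proof (cases "x \<in> E")
      case True
      have "(\<integral>\<^sup>+z\<in>- cube x (2 * l). ennreal (riesz_kernel \<gamma> (x - z)) * G f x z \<partial>lebesgue) \<le>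
        (\<integral>\<^sup>+z. (\<Sum>j. ennreal (cj j) * (G f x z * indicator (cube y (r j)) z)) \<partial>lebesgue)"
      proof (intro nn_integral_mono)
        fix z
        show "ennreal (riesz_kernel \<gamma> (x - z)) * G f x z * indicator (- cube x (2 * l)) z \<le>
             (\<Sum>j. ennreal (cj j) * (G f x z * indicator (cube y (r j)) z))"
          using kernel_le_far_sum[OF l, of x y z f] True sub
          by (cases "z \<in> cube x (2 * l)") (auto simp: cj_def r_def)
      qed
      then show ?thesis by (intro mult_right_mono) auto
    qed simp
  qed
  also have "\<dots> = (\<integral>\<^sup>+x. (\<Sum>j. ennreal (cj j) * ((\<integral>\<^sup>+z\<in>cube y (r j). G f x z \<partial>lebesgue) * indicator E x)) \<partial>lebesgue)"
  proof (intro nn_integral_cong)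
    fix x
    have [measurable]: "(\<lambda>z. G f x z) \<in> borel_measurable lebesgue" by measurable
    have "(\<integral>\<^sup>+z. (\<Sum>j. ennreal (cj j) * (G f x z * indicator (cube y (r j)) z)) \<partial>lebesgue) =
         (\<Sum>j. ennreal (cj j) * (\<integral>\<^sup>+z\<in>cube y (r j). G f x z \<partial>lebesgue))"
      by (subst nn_integral_suminf) (simp_all add: nn_integral_cmult)
    then show "(\<integral>\<^sup>+z. (\<Sum>j. ennreal (cj j) * (G f x z * indicator (cube y (r j)) z)) \<partial>lebesgue) * indicator E x =
         (\<Sum>j. ennreal (cj j) * ((\<integral>\<^sup>+z\<in>cube y (r j). G f x z \<partial>lebesgue) * indicator E x))"
      by (simp add: ennreal_suminf_multc[symmetric] mult.assoc)
  qed
  also have "\<dots> = (\<Sum>j. ennreal (cj j) * (\<integral>\<^sup>+x\<in>E. (\<integral>\<^sup>+z\<in>cube y (r j). G f x z \<partial>lebesgue) \<partial>lebesgue))"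
    by (subst nn_integral_suminf) (simp_all add: nn_integral_cmult)
  also have "\<dots> \<le> (\<Sum>j. ennreal (C * u powr (1 - 1 / q)) * (ennreal ((wq w y l / wq w y (r j)) powr \<theta>) * epowr (Fp f y (r j)) (1 / p)))"
  proof (intro suminf_le summableI)
    fix j
    let ?W = "wq w y (r j)"
    have W: "?W > 0" using w_cube_pos r by simp
    have "(\<integral>\<^sup>+x\<in>E. (\<integral>\<^sup>+z\<in>cube y (r j). G f x z \<partial>lebesgue) \<partial>lebesgue) \<le>
       ennreal (K * r j powr (real CARD('n) - \<gamma>) * ?W powr (1 / m - 1 / q)) * epowr (wmeas w E) (1 - 1 / m) * epowr (Fp f y (r j)) (1 / p)"
      unfolding G_def Fp_def using sub cube_mono[OF rl[of j], of y] by (intro cube_est r) auto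
    then have "ennreal (cj j) * (\<integral>\<^sup>+x\<in>E. (\<integral>\<^sup>+z\<in>cube y (r j). G f x z \<partial>lebesgue) \<partial>lebesgue) \<le>
       ennreal (cj j) * (ennreal (K * r j powr (real CARD('n) - \<gamma>) * ?W powr (1 / m - 1 / q)) * epowr (wmeas w E) (1 - 1 / m) * epowr (Fp f y (r j)) (1 / p))"
      by (rule mult_left_mono) simp
    also have "\<dots> = ennreal (cj j * (K * r j powr (real CARD('n) - \<gamma>)) * (?W powr (1 / m - 1 / q) * u powr (1 - 1 / m))) * epowr (Fp f y (r j)) (1 / p)"
      using cj K_pos u wE by (simp add: epowr_ennreal ennreal_mult mult_ac)
    also have "cj j * (K * r j powr (real CARD('n) - \<gamma>)) = C"
    proof -
      have "(2 ^ j * l) powr (\<gamma> - real CARD('n)) * (2 ^ j * l) powr (real CARD('n) - \<gamma>) = 1"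
        using l by (simp flip: powr_add)
      moreover have "r j powr (real CARD('n) - \<gamma>) = 8 powr (real CARD('n) - \<gamma>) * (2 ^ j * l) powr (real CARD('n) - \<gamma>)"
        unfolding r_def by (rule powr_mult)
      ultimately show ?thesis unfolding cj_def C_def by algebra
    qed
    also have "ennreal (C * (?W powr (1 / m - 1 / q) * u powr (1 - 1 / m))) * epowr (Fp f y (r j)) (1 / p) \<le>
        ennreal (C * (u powr (1 - 1 / q) * (wq w y l / ?W) powr \<theta>)) * epowr (Fp f y (r j)) (1 / p)"
    proof (intro mult_right_mono ennreal_leI mult_left_mono)
      have "u \<le> wq w y l" using wmeas_mono[OF sub, of w] wE u wmeas_cube[OF weight, of y l] by (simp add: ennreal_le_iff)
      then have "u powr \<theta> \<le> wq w y l powr \<theta>" using u a_\<theta>_pos by (intro powr_mono2) auto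
      then have "?W powr (- \<theta>) * (u powr (1 - 1 / q) * u powr \<theta>) \<le> ?W powr (- \<theta>) * (u powr (1 - 1 / q) * wq w y l powr \<theta>)"
        by (intro mult_left_mono) auto
      moreover have U: "u powr (1 - 1 / q) * u powr \<theta> = u powr (1 - 1 / m)" by (simp add: \<theta>_def flip: powr_add)
      ultimately have "?W powr (- \<theta>) * u powr (1 - 1 / m) \<le> ?W powr (- \<theta>) * (u powr (1 - 1 / q) * wq w y l powr \<theta>)"
        by (simp only: U)
      moreover have "?W powr (1 / m - 1 / q) = ?W powr (- \<theta>)" by (simp add: \<theta>_def)
      moreover have "(wq w y l / ?W) powr \<theta> = ?W powr (- \<theta>) * wq w y l powr \<theta>"
        unfolding powr_divide powr_minus by (simp add: divide_inverse)
      ultimately show "?W powr (1 / m - 1 / q) * u powr (1 - 1 / m) \<le> u powr (1 - 1 / q) * (wq w y l / ?W) powr \<theta>"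
        by (simp only: mult_ac)
    qed (use C in auto)
    also have "\<dots> = ennreal (C * u powr (1 - 1 / q)) * (ennreal ((wq w y l / ?W) powr \<theta>) * epowr (Fp f y (r j)) (1 / p))"
      using C by (simp add: ennreal_mult mult.assoc)
    finally show "ennreal (cj j) * (\<integral>\<^sup>+x\<in>E. (\<integral>\<^sup>+z\<in>cube y (r j). G f x z \<partial>lebesgue) \<partial>lebesgue) \<le>
       ennreal (C * u powr (1 - 1 / q)) * (ennreal ((wq w y l / ?W) powr \<theta>) * epowr (Fp f y (r j)) (1 / p))" .
  qed
  also have "\<dots> = ennreal (C * u powr (1 - 1 / q)) * tail_sum f y l"
    by (simp add: tail_sum_def r_def)
  finally show ?thesis by (simp only: C_def)
qed

text \<open>The local part needs no term of its own: \<open>cube y (3 * l)\<close> lies in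
  \<open>cube y (8 * l)\<close>, and doubling with ratio \<open>8\<close> bounds the coefficient at
  \<open>j = 0\<close> from below.\<close>

lemma pair_estimate:
  obtains C where "C > 0" "\<And>y l E f u. l > 0 \<Longrightarrow> E \<in> sets lebesgue \<Longrightarrow> E \<subseteq> cube y l \<Longrightarrow> u > 0 \<Longrightarrow>
    wmeas w E = ennreal u \<Longrightarrow> f \<in> borel_measurable lebesgue \<Longrightarrow>
    (\<integral>\<^sup>+x\<in>E. (\<integral>\<^sup>+z. ennreal (riesz_kernel \<gamma> (x - z)) * G f x z \<partial>lebesgue) \<partial>lebesgue) \<le>
    ennreal (C * u powr (1 - 1 / q)) * tail_sum f y l"
proof -
  obtain C1 where C1: "C1 > 0" and loc: "\<And>y l E f u. l > 0 \<Longrightarrow> E \<in> sets lebesgue \<Longrightarrow> E \<subseteq> cube y l \<Longrightarrow> u > 0 \<Longrightarrow>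
    wmeas w E = ennreal u \<Longrightarrow> f \<in> borel_measurable lebesgue \<Longrightarrow>
    (\<integral>\<^sup>+x\<in>E. (\<integral>\<^sup>+z\<in>cube x (2 * l). ennreal (riesz_kernel \<gamma> (x - z)) * G f x z \<partial>lebesgue) \<partial>lebesgue) \<le>
    ennreal (C1 * u powr (1 - 1 / q)) * epowr (Fp f y (3 * l)) (1 / p)"
    by (rule local_part, rule that)
  obtain D where D: "D > 0" "\<forall>c d l. l > 0 \<longrightarrow> cube c l \<subseteq> cube d (8 * l) \<longrightarrow> wq w d (8 * l) \<le> D * wq w c l"
    using doubling[of 8] by auto
  define C2 where "C2 = K * 8 powr (real CARD('n) - \<gamma>)"
  have C2: "C2 > 0" using K_pos by (simp add: C2_def)
  have main: "(\<integral>\<^sup>+x\<in>E. (\<integral>\<^sup>+z. ennreal (riesz_kernel \<gamma> (x - z)) * G f x z \<partial>lebesgue) \<partial>lebesgue) \<le>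
    ennreal ((C1 * D powr \<theta> + C2) * u powr (1 - 1 / q)) * tail_sum f y l"
    if l: "l > 0" and E[measurable]: "E \<in> sets lebesgue" and sub: "E \<subseteq> cube y l" and u: "u > 0"
      and wE: "wmeas w E = ennreal u" and f[measurable]: "f \<in> borel_measurable lebesgue" for y l E f u
  proof -
    let ?k = "\<lambda>x z. ennreal (riesz_kernel \<gamma> (x - z)) * G f x z"
    let ?U = "u powr (1 - 1 / q)"
    have "(\<integral>\<^sup>+x\<in>E. (\<integral>\<^sup>+z. ?k x z \<partial>lebesgue) \<partial>lebesgue) =
      (\<integral>\<^sup>+x. (\<integral>\<^sup>+z\<in>cube x (2 * l). ?k x z \<partial>lebesgue) * indicator E x + (\<integral>\<^sup>+z\<in>- cube x (2 * l). ?k x z \<partial>lebesgue) * indicator E x \<partial>lebesgue)"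
    proof (intro nn_integral_cong)
      fix x
      have [measurable]: "(\<lambda>z. ?k x z) \<in> borel_measurable lebesgue" by measurable
      have "(\<integral>\<^sup>+z. ?k x z \<partial>lebesgue) = (\<integral>\<^sup>+z. ?k x z * indicator (cube x (2 * l)) z + ?k x z * indicator (- cube x (2 * l)) z \<partial>lebesgue)"
        by (intro nn_integral_cong) (auto split: split_indicator)
      also have "\<dots> = (\<integral>\<^sup>+z\<in>cube x (2 * l). ?k x z \<partial>lebesgue) + (\<integral>\<^sup>+z\<in>- cube x (2 * l). ?k x z \<partial>lebesgue)"
        by (rule nn_integral_add) measurable
      finally show "(\<integral>\<^sup>+z. ?k x z \<partial>lebesgue) * indicator E x =
          (\<integral>\<^sup>+z\<in>cube x (2 * l). ?k x z \<partial>lebesgue) * indicator E x + (\<integral>\<^sup>+z\<in>- cube x (2 * l). ?k x z \<partial>lebesgue) * indicator E x"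
        by (simp add: distrib_right)
    qed
    also have "\<dots> = (\<integral>\<^sup>+x\<in>E. (\<integral>\<^sup>+z\<in>cube x (2 * l). ?k x z \<partial>lebesgue) \<partial>lebesgue) + (\<integral>\<^sup>+x\<in>E. (\<integral>\<^sup>+z\<in>- cube x (2 * l). ?k x z \<partial>lebesgue) \<partial>lebesgue)"
    proof -
      have [measurable]: "(\<lambda>x. \<integral>\<^sup>+z. ?k x z * indicator (cube x (2 * l)) z \<partial>lebesgue) \<in> borel_measurable lebesgue"
      proof -
        have "(\<lambda>x. \<integral>\<^sup>+z. (if z \<in> cube x (2 * l) then ?k x z else 0) \<partial>lebesgue) \<in> borel_measurable lebesgue"
          by measurable
        then show ?thesis by (rule back_subst[where P="\<lambda>f. f \<in> borel_measurable lebesgue"])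
          (auto intro!: ext nn_integral_cong)
      qed
      have [measurable]: "(\<lambda>x. \<integral>\<^sup>+z. ?k x z * indicator (- cube x (2 * l)) z \<partial>lebesgue) \<in> borel_measurable lebesgue"
      proof -
        have "(\<lambda>x. \<integral>\<^sup>+z. (if z \<in> cube x (2 * l) then 0 else ?k x z) \<partial>lebesgue) \<in> borel_measurable lebesgue"
          by measurable
        then show ?thesis by (rule back_subst[where P="\<lambda>f. f \<in> borel_measurable lebesgue"])
          (auto intro!: ext nn_integral_cong)
      qed
      show ?thesis by (rule nn_integral_add) measurable
    qed
    also have "\<dots> \<le> ennreal (C1 * ?U) * epowr (Fp f y (3 * l)) (1 / p) + ennreal (C2 * ?U) * tail_sum f y l"
      unfolding C2_def by (intro add_mono loc far_part l E sub u wE f)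
    also have "epowr (Fp f y (3 * l)) (1 / p) \<le> ennreal (D powr \<theta>) * tail_sum f y l"
    proof -
      let ?W = "wq w y (8 * l)"
      have W: "?W > 0" "wq w y l > 0" using l by (auto intro!: w_cube_pos)
      have "?W \<le> D * wq w y l" using D(2) l cube_mono[of l "8 * l" y] by auto
      then have "1 \<le> D * (wq w y l / ?W)" using W by (simp add: field_simps)
      then have "1 powr \<theta> \<le> (D * (wq w y l / ?W)) powr \<theta>" using a_\<theta>_pos by (intro powr_mono2) auto
      then have one: "1 \<le> D powr \<theta> * (wq w y l / ?W) powr \<theta>"
        unfolding powr_mult powr_one_eq_one .
      have "epowr (Fp f y (3 * l)) (1 / p) \<le> epowr (Fp f y (8 * l)) (1 / p)"
        using exps l by (intro epowr_mono Fp_mono) auto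
      also have "\<dots> = ennreal 1 * epowr (Fp f y (8 * l)) (1 / p)" by simp
      also have "\<dots> \<le> ennreal (D powr \<theta> * (wq w y l / ?W) powr \<theta>) * epowr (Fp f y (8 * l)) (1 / p)"
        using one by (intro mult_right_mono ennreal_leI) auto
      also have "\<dots> = ennreal (D powr \<theta>) * (ennreal ((wq w y l / ?W) powr \<theta>) * epowr (Fp f y (8 * l)) (1 / p))"
        by (simp add: ennreal_mult mult.assoc)
      also have "ennreal ((wq w y l / ?W) powr \<theta>) * epowr (Fp f y (8 * l)) (1 / p) \<le> tail_sum f y l"
        unfolding tail_sum_def
        using sum_le_suminf[OF summableI, of "{0}" "\<lambda>j. ennreal ((wq w y l / wq w y (8 * (2 ^ j * l))) powr \<theta>) * epowr (Fp f y (8 * (2 ^ j * l))) (1 / p)"]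
        by simp
      finally show ?thesis by (simp add: mult_left_mono)
    qed
    finally have "(\<integral>\<^sup>+x\<in>E. (\<integral>\<^sup>+z. ?k x z \<partial>lebesgue) \<partial>lebesgue) \<le>
        ennreal (C1 * ?U) * (ennreal (D powr \<theta>) * tail_sum f y l) + ennreal (C2 * ?U) * tail_sum f y l"
      by (simp add: add_right_mono mult_left_mono)
    also have "\<dots> = ennreal ((C1 * D powr \<theta> + C2) * ?U) * tail_sum f y l"
    proof -
      have "(C1 * D powr \<theta> + C2) * ?U = C1 * ?U * D powr \<theta> + C2 * ?U" by (simp add: algebra_simps)
      then show ?thesis using C1 C2 by (simp add: ennreal_mult algebra_simps)
    qed
    finally show ?thesis .
  qed
  have "C1 * D powr \<theta> + C2 > 0" using C1 C2 D(1) by (intro add_pos_pos) auto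
  from that[OF this main] show thesis .
qed

end

section \<open>Weak-type and amalgam estimates\<close>

lemma riesz_const_pos:
  assumes "0 < \<gamma>" "\<gamma> < real CARD('n::finite)"
  shows "riesz_const TYPE('n) \<gamma> > 0"
  unfolding riesz_const_def using assms by (intro divide_pos_pos mult_pos_pos Gamma_real_pos) auto

lemma Lp_norm_real:
  assumes "p > 0"
  shows "Lp_norm (ennreal p) v g = epowr (\<integral>\<^sup>+x. epowr (g x) p * ennreal (v x) \<partial>lebesgue) (1 / p)"
  using assms by (simp add: Lp_norm_def)

lemma Lp_norm_indicator:
  assumes "p > 0" "\<And>x. \<nu> x \<ge> 0"
  shows "Lp_norm (ennreal p) \<nu> (\<lambda>x. ennreal \<bar>f x * indicator A x\<bar>) =
    epowr (\<integral>\<^sup>+x\<in>A. ennreal (\<bar>f x\<bar> powr p * \<nu> x) \<partial>lebesgue) (1 / p)"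
  unfolding Lp_norm_real[OF assms(1)] using assms
  by (intro arg_cong2[where f=epowr] nn_integral_cong) (auto simp: epowr_ennreal_pos ennreal_mult split: split_indicator)

text \<open>For \<open>s < \<infinity>\<close>, half of the geometric decay is spent on replacing the sum by the
  \<open>\<ell>\<^sup>s\<close> norm of the sequence, which can be integrated term by term.\<close>

lemma Lp_norm_geometric_sum:
  fixes \<mu> :: "real^'n \<Rightarrow> real"
  assumes s: "s > 0" and \<eta>: "0 < \<eta>" "\<eta> < 1" and C: "C > 0" and mu: "\<mu> \<in> borel_measurable lebesgue"
  obtains C' where "C' > 0" "\<And>g h A. g \<in> borel_measurable lebesgue \<Longrightarrow> (\<And>j. h j \<in> borel_measurable lebesgue) \<Longrightarrow>
    (\<And>j::nat. Lp_norm s \<mu> (h j) \<le> A) \<Longrightarrow> (\<And>y. g y \<le> ennreal C * (\<Sum>j. ennreal (\<eta> ^ j) * h j y)) \<Longrightarrow>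
    Lp_norm s \<mu> g \<le> ennreal C' * A"
proof -
  have geo: "(\<Sum>j. ennreal (c ^ j)) = ennreal (1 / (1 - c))" if "0 < c" "c < 1" for c :: real
    using that by (subst suminf_ennreal2) (auto simp: summable_geometric suminf_geometric)
  show thesis
  proof (cases "s = \<infinity>")
    case True
    let ?M = "density lebesgue (\<lambda>x. ennreal (\<mu> x))"
    have main: "Lp_norm s \<mu> g \<le> ennreal (C * (1 / (1 - \<eta>))) * A"
      if g: "g \<in> borel_measurable lebesgue" and "\<And>j. h j \<in> borel_measurable lebesgue"
        and A: "\<And>j::nat. Lp_norm s \<mu> (h j) \<le> A" and le: "\<And>y. g y \<le> ennreal C * (\<Sum>j. ennreal (\<eta> ^ j) * h j y)" for g h A
    proof -
      have hA: "AE y in ?M. h j y \<le> A" for j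
        using esssup_AE[where M="?M" and f="h j"] A[of j] True
        by (auto simp: Lp_norm_def elim!: eventually_mono intro: order_trans)
      have "AE y in ?M. \<forall>j. h j y \<le> A" by (subst AE_all_countable) (intro allI hA)
      then have "AE y in ?M. g y \<le> ennreal (C * (1 / (1 - \<eta>))) * A"
      proof eventually_elim
        case (elim y)
        have "g y \<le> ennreal C * (\<Sum>j. ennreal (\<eta> ^ j) * A)"
          using elim by (intro order_trans[OF le] mult_left_mono suminf_le summableI) auto
        also have "(\<Sum>j. ennreal (\<eta> ^ j) * A) = ennreal (1 / (1 - \<eta>)) * A"
          unfolding ennreal_suminf_multc geo[OF \<eta>] ..
        finally have "g y \<le> ennreal C * (ennreal (1 / (1 - \<eta>)) * A)" .
        moreover have "ennreal (C * (1 / (1 - \<eta>))) = ennreal C * ennreal (1 / (1 - \<eta>))"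
          using C \<eta> by (intro ennreal_mult) auto
        ultimately show ?case by (simp only: mult.assoc)
      qed
      then have "esssup ?M g \<le> ennreal (C * (1 / (1 - \<eta>))) * A"
        using g by (intro esssup_I) auto
      then show ?thesis using True by (simp add: Lp_norm_def)
    qed
    have "C * (1 / (1 - \<eta>)) > 0" using C \<eta> by simp
    from that[OF this main] show thesis .
  next
    case False
    then obtain \<sigma> where \<sigma>: "s = ennreal \<sigma>" "\<sigma> > 0" using s by (cases s) auto
    define k where "k = sqrt \<eta>"
    have k: "0 < k" "k < 1" "k * k = \<eta>" using \<eta> by (auto simp: k_def)
    define B where "B = 1 / (1 - k)"
    have B: "B > 0" using k by (simp add: B_def)
    have ks: "0 < k powr \<sigma>" "k powr \<sigma> < 1" using k \<sigma> powr_less_mono2[of \<sigma> k 1] by auto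
    define B2 where "B2 = 1 / (1 - k powr \<sigma>)"
    have B2: "B2 > 0" using ks by (simp add: B2_def)
    have main: "Lp_norm s \<mu> g \<le> ennreal (C * B * B2 powr (1 / \<sigma>)) * A"
      if "g \<in> borel_measurable lebesgue" and [measurable]: "\<And>j. h j \<in> borel_measurable lebesgue"
        and A: "\<And>j::nat. Lp_norm s \<mu> (h j) \<le> A" and le: "\<And>y. g y \<le> ennreal C * (\<Sum>j. ennreal (\<eta> ^ j) * h j y)" for g h A
    proof -
      \<comment> \<open>Each \<open>k ^ j * h j y\<close> is at most \<open>R y\<close> to the power
        \<open>1 / \<sigma>\<close>, being the root of a single term of \<open>R\<close>. No
        triangle inequality is involved, so every \<open>\<sigma> > 0\<close> is treated
        alike.\<close>
      define R where "R y = (\<Sum>j. ennreal ((k powr \<sigma>) ^ j) * epowr (h j y) \<sigma>)" for y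
      note [measurable] = mu
      have kh: "ennreal (k ^ j) * h j y \<le> epowr (R y) (1 / \<sigma>)" for j y
      proof -
        have "ennreal ((k powr \<sigma>) ^ j) * epowr (h j y) \<sigma> \<le> R y"
          unfolding R_def using sum_le_suminf[OF summableI, of "{j}" "\<lambda>j. ennreal ((k powr \<sigma>) ^ j) * epowr (h j y) \<sigma>"] by simp
        moreover have "ennreal ((k powr \<sigma>) ^ j) = epowr (ennreal (k ^ j)) \<sigma>"
          using k \<sigma> by (simp add: epowr_ennreal powr_nat_mult)
        ultimately have "epowr (ennreal (k ^ j) * h j y) \<sigma> \<le> R y" using \<sigma> by (simp add: epowr_mult)
        then have "epowr (epowr (ennreal (k ^ j) * h j y) \<sigma>) (1 / \<sigma>) \<le> epowr (R y) (1 / \<sigma>)"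
          using \<sigma> by (intro epowr_mono) auto
        then show ?thesis using \<sigma> by (simp add: epowr_epowr_pos)
      qed
      have gR: "epowr (g y) \<sigma> \<le> ennreal ((C * B) powr \<sigma>) * R y" for y
      proof -
        have "(\<Sum>j. ennreal (\<eta> ^ j) * h j y) = (\<Sum>j. ennreal (k ^ j) * (ennreal (k ^ j) * h j y))"
          using k by (simp add: k(3)[symmetric] power_mult_distrib ennreal_mult mult.assoc)
        also have "\<dots> \<le> (\<Sum>j. ennreal (k ^ j) * epowr (R y) (1 / \<sigma>))"
          by (intro suminf_le mult_left_mono kh summableI) auto
        also have "\<dots> = ennreal B * epowr (R y) (1 / \<sigma>)"
          unfolding ennreal_suminf_multc geo[OF k(1,2)] B_def ..
        finally have "g y \<le> ennreal C * (ennreal B * epowr (R y) (1 / \<sigma>))"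
          by (intro order_trans[OF le] mult_left_mono) auto
        then have "epowr (g y) \<sigma> \<le> epowr (ennreal (C * B) * epowr (R y) (1 / \<sigma>)) \<sigma>"
          using C B \<sigma> by (intro epowr_mono) (auto simp: ennreal_mult mult.assoc)
        then show ?thesis using C B \<sigma> by (simp add: epowr_mult epowr_epowr_pos epowr_ennreal)
      qed
      have hA: "(\<integral>\<^sup>+y. epowr (h j y) \<sigma> * ennreal (\<mu> y) \<partial>lebesgue) \<le> epowr A \<sigma>" for j
      proof -
        have "epowr (Lp_norm s \<mu> (h j)) \<sigma> \<le> epowr A \<sigma>" using A \<sigma> by (intro epowr_mono) auto
        then show ?thesis using \<sigma> by (simp add: Lp_norm_real epowr_epowr_pos)
      qed
      have "(\<integral>\<^sup>+y. epowr (g y) \<sigma> * ennreal (\<mu> y) \<partial>lebesgue) \<le> (\<integral>\<^sup>+y. ennreal ((C * B) powr \<sigma>) * (\<Sum>j. ennreal ((k powr \<sigma>) ^ j) * (epowr (h j y) \<sigma> * ennreal (\<mu> y))) \<partial>lebesgue)"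
        using mult_right_mono[OF gR] by (intro nn_integral_mono) (simp add: R_def mult.assoc[symmetric] ennreal_suminf_multc)
      also have "\<dots> = ennreal ((C * B) powr \<sigma>) * (\<Sum>j. ennreal ((k powr \<sigma>) ^ j) * (\<integral>\<^sup>+y. epowr (h j y) \<sigma> * ennreal (\<mu> y) \<partial>lebesgue))"
        by (subst nn_integral_cmult, measurable) (subst nn_integral_suminf, simp_all add: nn_integral_cmult)
      also have "\<dots> \<le> ennreal ((C * B) powr \<sigma>) * (\<Sum>j. ennreal ((k powr \<sigma>) ^ j) * epowr A \<sigma>)"
        by (intro mult_left_mono suminf_le hA summableI) auto
      also have "(\<Sum>j. ennreal ((k powr \<sigma>) ^ j) * epowr A \<sigma>) = ennreal B2 * epowr A \<sigma>"
        unfolding ennreal_suminf_multc geo[OF ks] B2_def ..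
      finally have "epowr (\<integral>\<^sup>+y. epowr (g y) \<sigma> * ennreal (\<mu> y) \<partial>lebesgue) (1 / \<sigma>) \<le>
          epowr (ennreal ((C * B) powr \<sigma>) * (ennreal B2 * epowr A \<sigma>)) (1 / \<sigma>)"
        using \<sigma> by (intro epowr_mono) auto
      also have "\<dots> = ennreal (C * B * B2 powr (1 / \<sigma>)) * A"
        using C B B2 \<sigma> by (simp add: epowr_mult epowr_ennreal_pos epowr_epowr_pos powr_powr ennreal_mult mult.assoc)
      finally show ?thesis using \<sigma> by (simp add: Lp_norm_real)
    qed
    have "C * B * B2 powr (1 / \<sigma>) > 0" using C B B2 by simp
    from that[OF this main] show thesis .
  qed
qed

text \<open>The level sets grow as \<open>t\<close> decreases, and \<open>t\<close> is the supremum
  of the rationals below it, so rational thresholds suffice. A countable supremum keeps the weak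
  norm measurable in the center of the cube.\<close>

lemma weak_Lp_norm_Rats:
  "weak_Lp_norm q w g = (SUP t\<in>{t \<in> \<rat>. 0 < t}. ennreal t * epowr (wmeas w {x. \<bar>g x\<bar> > ereal t}) (1 / q))"
  if "q > 0"
proof (rule antisym)
  let ?H = "\<lambda>t. epowr (wmeas w {x. \<bar>g x\<bar> > ereal t}) (1 / q)"
  show "weak_Lp_norm q w g \<le> (SUP t\<in>{t \<in> \<rat>. 0 < t}. ennreal t * ?H t)"
    unfolding weak_Lp_norm_def
  proof (rule SUP_least)
    fix t :: real assume "t \<in> {0<..}"
    then have t: "t > 0" by simp
    let ?R = "{r \<in> \<rat>. 0 < r \<and> r < t}"
    have "ennreal t \<le> (SUP r\<in>?R. ennreal r)"
      unfolding le_SUP_iff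
    proof (intro allI impI)
      fix y assume y: "y < ennreal t"
      then obtain y' where y': "y = ennreal y'" "y' \<ge> 0" by (cases y) auto
      then have "y' < t" using y by (simp add: ennreal_less_iff)
      then obtain r where "r \<in> \<rat>" "y' < r" "r < t" using Rats_dense_in_real by blast
      then show "\<exists>r\<in>?R. y < ennreal r" using y' by (intro bexI[of _ r]) (auto simp: ennreal_less_iff)
    qed
    then have "ennreal t * ?H t \<le> (SUP r\<in>?R. ennreal r) * ?H t" by (rule mult_right_mono) simp
    also have "\<dots> = (SUP r\<in>?R. ennreal r * ?H t)" by (rule SUP_mult_right_ennreal)
    also have "\<dots> \<le> (SUP t\<in>{t \<in> \<rat>. 0 < t}. ennreal t * ?H t)"
    proof (rule SUP_least)
      fix r assume r: "r \<in> ?R"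
      have "ennreal r * ?H t \<le> ennreal r * ?H r"
        using r that by (intro mult_left_mono epowr_mono wmeas_mono) (auto intro: less_trans[of _ "ereal t"] simp: less_le_trans order_le_less_trans)
      also have "\<dots> \<le> (SUP t\<in>{t \<in> \<rat>. 0 < t}. ennreal t * ?H t)" using r by (intro SUP_upper) auto
      finally show "ennreal r * ?H t \<le> (SUP t\<in>{t \<in> \<rat>. 0 < t}. ennreal t * ?H t)" .
    qed
    finally show "ennreal t * ?H t \<le> (SUP t\<in>{t \<in> \<rat>. 0 < t}. ennreal t * ?H t)" .
  qed
  show "(SUP t\<in>{t \<in> \<rat>. 0 < t}. ennreal t * ?H t) \<le> weak_Lp_norm q w g"
    unfolding weak_Lp_norm_def by (intro SUP_subset_mono) auto
qed

lemma level_set_indicator: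
  assumes "t > 0"
  shows "{x. \<bar>g x * indicator A x :: ereal\<bar> > ereal t} = {x \<in> A. \<bar>g x\<bar> > ereal t}"
  using assms by (auto split: split_indicator_asm simp: indicator_def)

text \<open>The outer norm needs this: for \<open>s = \<infinity>\<close> an almost everywhere bound
  passes to the essential supremum by \<open>esssup_I\<close>, which asks for a measurable
  function.\<close>

lemma weak_Lp_norm_cube_measurable:
  fixes g :: "real^'n \<Rightarrow> ereal"
  assumes [measurable]: "g \<in> borel_measurable lebesgue" "w \<in> borel_measurable lebesgue" and q: "q > 0"
  shows "(\<lambda>y. weak_Lp_norm q w (\<lambda>x. g x * indicator (cube y l) x)) \<in> borel_measurable lebesgue"
  unfolding weak_Lp_norm_Rats[OF q]
proof (rule borel_measurable_SUP)
  show "countable {t \<in> \<rat>. 0 < (t::real)}" by (rule countable_subset[OF _ countable_rat]) auto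
  fix t :: real assume "t \<in> {t \<in> \<rat>. 0 < t}"
  then have t: "t > 0" by simp
  have "(\<lambda>y. \<integral>\<^sup>+x. (if x \<in> cube y l \<and> \<bar>g x\<bar> > ereal t then ennreal (w x) else 0) \<partial>lebesgue) \<in> borel_measurable lebesgue"
    by measurable
  then have [measurable]: "(\<lambda>y. wmeas w {x \<in> cube y l. \<bar>g x\<bar> > ereal t}) \<in> borel_measurable lebesgue"
    by (rule back_subst[where P="\<lambda>f. f \<in> borel_measurable lebesgue"])
       (auto simp: wmeas_def intro!: ext nn_integral_cong split: split_indicator)
  show "(\<lambda>y. ennreal t * epowr (wmeas w {x. \<bar>g x * indicator (cube y l) x\<bar> > ereal t}) (1 / q)) \<in> borel_measurable lebesgue"
    unfolding level_set_indicator[OF t] by measurable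
qed

text \<open>The case distinction on integrability is a measurable condition once it is written as
  finiteness of a nonnegative integral, which depends measurably on \<open>x\<close>.\<close>

lemma commutator_measurable:
  fixes b f :: "real^'n \<Rightarrow> real"
  assumes [measurable]: "b \<in> borel_measurable lebesgue" "f \<in> borel_measurable lebesgue"
  shows "commutator b \<gamma> f \<in> borel_measurable lebesgue"
proof -
  have [measurable]: "(\<lambda>t. riesz_kernel \<gamma> (fst t - snd t)) \<in> borel_measurable (lebesgue \<Otimes>\<^sub>M (lebesgue :: (real^'n) measure))"
  proof -
    have [measurable]: "fst \<in> borel_measurable (lebesgue \<Otimes>\<^sub>M (lebesgue :: (real^'n) measure))"
        "snd \<in> borel_measurable ((lebesgue :: (real^'n) measure) \<Otimes>\<^sub>M (lebesgue :: (real^'n) measure))"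
      by (rule measurable_lebesgue_imp_borel[OF measurable_fst], rule measurable_lebesgue_imp_borel[OF measurable_snd])
    show ?thesis unfolding riesz_kernel_def by measurable
  qed
  let ?k = "\<lambda>x y. riesz_kernel \<gamma> (x - y) * ((b x - b y) * f y)"
  have k: "(\<lambda>t. ?k (fst t) (snd t)) \<in> borel_measurable (lebesgue \<Otimes>\<^sub>M lebesgue)" by measurable
  have kx: "(\<lambda>y. ?k x y) \<in> borel_measurable lebesgue" for x
    using measurable_compose[OF measurable_Pair1' k, of x] by simp
  have k': "case_prod ?k \<in> borel_measurable (lebesgue \<Otimes>\<^sub>M lebesgue)"
    using k by (simp add: case_prod_beta')
  then have [measurable]: "(\<lambda>x. LINT y|lebesgue. ?k x y) \<in> borel_measurable lebesgue"
    by (rule lebesgue.borel_measurable_lebesgue_integral)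
  have "case_prod (\<lambda>x y. ennreal (norm (?k x y))) \<in> borel_measurable (lebesgue \<Otimes>\<^sub>M lebesgue)"
    using k unfolding case_prod_beta' by measurable
  then have [measurable]: "(\<lambda>x. \<integral>\<^sup>+y. ennreal (norm (?k x y)) \<partial>lebesgue) \<in> borel_measurable lebesgue"
    by (rule lebesgue.borel_measurable_nn_integral)
  have "commutator b \<gamma> f = (\<lambda>x. if (\<integral>\<^sup>+y. ennreal (norm (?k x y)) \<partial>lebesgue) < \<infinity>
      then ereal (1 / riesz_const TYPE('n) \<gamma> * (LINT y|lebesgue. ?k x y)) else \<infinity>)"
    unfolding commutator_def integrable_iff_bounded using kx by (intro ext) auto
  then show ?thesis by (simp only:) measurable
qed

context cube_bound
begin

text \<open>At points without absolute convergence the commutator is \<open>\<infinity>\<close> by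
  definition, and there the nonnegative integral on the right is infinite as well, so these points
  belong to the level set without harming the bound.\<close>

lemma commutator_level:
  fixes f :: "real^'n \<Rightarrow> real"
  assumes f[measurable]: "f \<in> borel_measurable lebesgue" and t: "t > 0" and gamma0: "0 < \<gamma>"
    and lev: "ereal t < \<bar>commutator b \<gamma> f x\<bar>"
  shows "ennreal t * ennreal (w x) \<le> ennreal (1 / riesz_const TYPE('n) \<gamma>) * (\<integral>\<^sup>+z. ennreal (riesz_kernel \<gamma> (x - z)) * G f x z \<partial>lebesgue)"
proof -
  let ?k = "\<lambda>z. riesz_kernel \<gamma> (x - z) * ((b x - b z) * f z)"
  let ?c = "1 / riesz_const TYPE('n) \<gamma>"
  have c: "?c > 0" using riesz_const_pos[OF gamma0 gamma] by simp
  have [measurable]: "?k \<in> borel_measurable lebesgue" by measurable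
  have kn: "riesz_kernel \<gamma> z \<ge> 0" for z :: "real^'n" by (simp add: riesz_kernel_def)
  have "(\<integral>\<^sup>+z. ennreal (riesz_kernel \<gamma> (x - z)) * G f x z \<partial>lebesgue) = (\<integral>\<^sup>+z. ennreal (w x) * ennreal (norm (?k z)) \<partial>lebesgue)"
    unfolding G_def using kn w_nonneg
    by (intro nn_integral_cong) (simp add: abs_mult mult_ac flip: ennreal_mult)
  also have "\<dots> = ennreal (w x) * (\<integral>\<^sup>+z. ennreal (norm (?k z)) \<partial>lebesgue)"
    by (rule nn_integral_cmult) measurable
  finally have eq: "(\<integral>\<^sup>+z. ennreal (riesz_kernel \<gamma> (x - z)) * G f x z \<partial>lebesgue) = ennreal (w x) * (\<integral>\<^sup>+z. ennreal (norm (?k z)) \<partial>lebesgue)" .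
  have "ennreal t \<le> ennreal ?c * (\<integral>\<^sup>+z. ennreal (norm (?k z)) \<partial>lebesgue)"
  proof (cases "integrable lebesgue ?k")
    case True
    then have "t < \<bar>?c * (LINT z|lebesgue. ?k z)\<bar>" using lev by (simp add: commutator_def)
    also have "\<dots> = ?c * norm (LINT z|lebesgue. ?k z)" using c by (simp only: abs_mult real_norm_def abs_of_pos)
    finally have "ennreal t \<le> ennreal ?c * ennreal (norm (LINT z|lebesgue. ?k z))"
      using c by (simp add: ennreal_leI flip: ennreal_mult)
    also have "\<dots> \<le> ennreal ?c * (\<integral>\<^sup>+z. ennreal (norm (?k z)) \<partial>lebesgue)"
      by (intro mult_left_mono integral_norm_bound_ennreal True) auto
    finally show ?thesis .
  next
    case False
    then have "(\<integral>\<^sup>+z. ennreal (norm (?k z)) \<partial>lebesgue) = \<infinity>"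
      unfolding integrable_iff_bounded by (auto simp: less_top[symmetric])
    then show ?thesis using c by (simp add: ennreal_mult_top)
  qed
  then have "ennreal t * ennreal (w x) \<le> ennreal ?c * (\<integral>\<^sup>+z. ennreal (norm (?k z)) \<partial>lebesgue) * ennreal (w x)"
    by (rule mult_right_mono) simp
  then show ?thesis unfolding eq by (simp only: mult_ac)
qed

text \<open>Integrating the pointwise bound over the level set \<open>E\<close> gives
  \<open>t * u\<close> on the left and \<open>u powr (1 - 1 / q)\<close> on the right; dividing
  leaves \<open>t * u powr (1 / q)\<close>, the quantity in the weak norm. A level set of mass zero
  is treated apart to allow the division.\<close>

lemma weak_estimate:
  assumes gamma0: "0 < \<gamma>"
  obtains C where "C > 0" "\<And>y l f. l > 0 \<Longrightarrow> f \<in> borel_measurable lebesgue \<Longrightarrow>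
    weak_Lp_norm q w (\<lambda>x. commutator b \<gamma> f x * indicator (cube y l) x) \<le> ennreal C * tail_sum f y l"
proof -
  obtain C where C: "C > 0" and pe: "\<And>y l E f u. l > 0 \<Longrightarrow> E \<in> sets lebesgue \<Longrightarrow> E \<subseteq> cube y l \<Longrightarrow> u > 0 \<Longrightarrow>
    wmeas w E = ennreal u \<Longrightarrow> f \<in> borel_measurable lebesgue \<Longrightarrow>
    (\<integral>\<^sup>+x\<in>E. (\<integral>\<^sup>+z. ennreal (riesz_kernel \<gamma> (x - z)) * G f x z \<partial>lebesgue) \<partial>lebesgue) \<le>
    ennreal (C * u powr (1 - 1 / q)) * tail_sum f y l"
    by (rule pair_estimate, rule that)
  define c where "c = 1 / riesz_const TYPE('n) \<gamma>"
  have c: "c > 0" using riesz_const_pos[OF gamma0 gamma] by (simp add: c_def)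
  have q: "q > 1" using exps by simp
  have main: "weak_Lp_norm q w (\<lambda>x. commutator b \<gamma> f x * indicator (cube y l) x) \<le> ennreal (c * C) * tail_sum f y l"
    if l: "l > 0" and f[measurable]: "f \<in> borel_measurable lebesgue" for y l f
    unfolding weak_Lp_norm_def
  proof (rule SUP_least)
    fix t :: real assume "t \<in> {0<..}"
    then have t: "t > 0" by simp
    note [measurable] = commutator_measurable[OF b_measurable f, of \<gamma>]
    define E where "E = {x \<in> cube y l. \<bar>commutator b \<gamma> f x\<bar> > ereal t}"
    have E[measurable]: "E \<in> sets lebesgue"
    proof -
      have "{x \<in> space lebesgue. x \<in> cube y l \<and> \<bar>commutator b \<gamma> f x\<bar> > ereal t} \<in> sets lebesgue" by measurable
      then show ?thesis by (simp add: E_def)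
    qed
    have sub: "E \<subseteq> cube y l" by (auto simp: E_def)
    obtain u where u: "wmeas w E = ennreal u" "u \<ge> 0"
      using wmeas_mono[OF sub, of w] wmeas_cube_finite[OF weight, of y l] by (cases "wmeas w E") auto
    show "ennreal t * epowr (wmeas w {x. \<bar>commutator b \<gamma> f x * indicator (cube y l) x\<bar> > ereal t}) (1 / q) \<le> ennreal (c * C) * tail_sum f y l"
      unfolding level_set_indicator[OF t] E_def[symmetric]
    proof (cases "u = 0")
      case True
      then show "ennreal t * epowr (wmeas w E) (1 / q) \<le> ennreal (c * C) * tail_sum f y l" using u q by simp
    next
      case False
      then have u0: "u > 0" using u by simp
      have [measurable]: "(\<lambda>x. \<integral>\<^sup>+z. ennreal (riesz_kernel \<gamma> (x - z)) * G f x z \<partial>lebesgue) \<in> borel_measurable lebesgue"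
        by measurable
      have "ennreal (t * u) = (\<integral>\<^sup>+x. ennreal t * (ennreal (w x) * indicator E x) \<partial>lebesgue)"
        using t u by (subst nn_integral_cmult) (auto simp: wmeas_def[symmetric] ennreal_mult)
      also have "\<dots> \<le> (\<integral>\<^sup>+x. ennreal c * ((\<integral>\<^sup>+z. ennreal (riesz_kernel \<gamma> (x - z)) * G f x z \<partial>lebesgue) * indicator E x) \<partial>lebesgue)"
      proof (intro nn_integral_mono)
        fix x
        show "ennreal t * (ennreal (w x) * indicator E x) \<le> ennreal c * ((\<integral>\<^sup>+z. ennreal (riesz_kernel \<gamma> (x - z)) * G f x z \<partial>lebesgue) * indicator E x)"
          using commutator_level[OF f t gamma0, of x, folded c_def] by (cases "x \<in> E") (auto simp: E_def)
      qed
      also have "\<dots> = ennreal c * (\<integral>\<^sup>+x\<in>E. (\<integral>\<^sup>+z. ennreal (riesz_kernel \<gamma> (x - z)) * G f x z \<partial>lebesgue) \<partial>lebesgue)"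
        by (rule nn_integral_cmult) measurable
      also have "\<dots> \<le> ennreal c * (ennreal (C * u powr (1 - 1 / q)) * tail_sum f y l)"
        by (intro mult_left_mono pe l E sub u0 u f) simp
      finally have "ennreal (u powr (1 / q - 1)) * ennreal (t * u) \<le> ennreal (u powr (1 / q - 1)) * (ennreal c * (ennreal (C * u powr (1 - 1 / q)) * tail_sum f y l))"
        by (rule mult_left_mono) simp
      also have "\<dots> = ennreal (u powr (1 / q - 1) * (c * (C * u powr (1 - 1 / q)))) * tail_sum f y l"
        using c C by (simp add: ennreal_mult mult.assoc)
      also have "u powr (1 / q - 1) * (c * (C * u powr (1 - 1 / q))) = c * C * (u powr (1 / q - 1) * u powr (1 - 1 / q))"
        by (simp only: mult_ac)
      also have "u powr (1 / q - 1) * u powr (1 - 1 / q) = 1" using u0 by (simp flip: powr_add)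
      also have "ennreal (u powr (1 / q - 1)) * ennreal (t * u) = ennreal t * epowr (wmeas w E) (1 / q)"
        using u0 u t by (simp add: epowr_ennreal powr_diff flip: ennreal_mult)
      finally show "ennreal t * epowr (wmeas w E) (1 / q) \<le> ennreal (c * C) * tail_sum f y l" by simp
    qed
  qed
  have "c * C > 0" using c C by (rule mult_pos_pos)
  from that[OF this main] show thesis .
qed

text \<open>With \<open>A = w(Q)\<close> and \<open>W\<close> the mass of the large cube,
  \<open>A^e (A / W)^\<theta> = (A / W)^(\<theta> + e) W^e\<close>. Thus the power \<open>e\<close>,
  which may be negative, is moved to the large cube, and reverse doubling turns \<open>A / W\<close>
  into \<open>\<rho> ^ j\<close>.\<close>

lemma scaled_tail_sum_le:
  assumes l: "l > 0" and e: "\<theta> + e > 0"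
  shows "epowr (wmeas w (cube y l)) e * tail_sum f y l \<le>
    (\<Sum>j. ennreal ((\<rho> powr (\<theta> + e)) ^ j) * (epowr (wmeas w (cube y (8 * (2 ^ j * l)))) e * epowr (Fp f y (8 * (2 ^ j * l))) (1 / p)))"
proof -
  define A where "A = wq w y l"
  have A: "A > 0" using l w_cube_pos by (simp add: A_def)
  have "epowr (wmeas w (cube y l)) e * tail_sum f y l =
      (\<Sum>j. ennreal (A powr e * (A / wq w y (8 * (2 ^ j * l))) powr \<theta>) * epowr (Fp f y (8 * (2 ^ j * l))) (1 / p))"
    unfolding tail_sum_def wmeas_cube[OF weight] A_def[symmetric]
    using A by (simp add: epowr_ennreal ennreal_suminf_cmult[symmetric] ennreal_mult mult.assoc del: ennreal_suminf_cmult)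
  also have "\<dots> \<le> (\<Sum>j. ennreal ((\<rho> powr (\<theta> + e)) ^ j) * (epowr (wmeas w (cube y (8 * (2 ^ j * l)))) e * epowr (Fp f y (8 * (2 ^ j * l))) (1 / p)))"
  proof (intro suminf_le summableI)
    fix j
    define W where "W = wq w y (8 * (2 ^ j * l))"
    have W: "W > 0" using l w_cube_pos by (simp add: W_def)
    have "A \<le> \<rho> ^ j * wq w y (2 ^ j * l)"
    proof (induction j)
      case (Suc j)
      have "wq w y (2 ^ j * l) \<le> \<rho> * wq w y (2 ^ Suc j * l)"
        using reverse_doubling[of "2 ^ Suc j * l" y] l by simp
      then have "\<rho> ^ j * wq w y (2 ^ j * l) \<le> \<rho> ^ j * (\<rho> * wq w y (2 ^ Suc j * l))"
        using rho by (intro mult_left_mono) auto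
      with Suc show ?case by (simp add: mult_ac)
    qed (simp add: A_def)
    also have "\<dots> \<le> \<rho> ^ j * W"
      unfolding W_def using rho l by (intro mult_left_mono wq_mono weight cube_mono) auto
    finally have "A / W \<le> \<rho> ^ j" using W by (simp add: field_simps)
    then have "(A / W) powr (\<theta> + e) \<le> (\<rho> ^ j) powr (\<theta> + e)" using A W e by (intro powr_mono2) auto
    then have "(A / W) powr (\<theta> + e) * W powr e \<le> (\<rho> powr (\<theta> + e)) ^ j * W powr e"
      using rho by (intro mult_right_mono) (auto simp: powr_nat_mult)
    moreover have "A powr e * (A / W) powr \<theta> = (A / W) powr (\<theta> + e) * W powr e"
      using A W by (simp add: powr_add powr_divide)
    ultimately have "ennreal (A powr e * (A / W) powr \<theta>) \<le> ennreal ((\<rho> powr (\<theta> + e)) ^ j) * ennreal (W powr e)"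
      by (simp add: ennreal_leI flip: ennreal_mult)
    then have "ennreal (A powr e * (A / W) powr \<theta>) * epowr (Fp f y (8 * (2 ^ j * l))) (1 / p) \<le>
       ennreal ((\<rho> powr (\<theta> + e)) ^ j) * ennreal (W powr e) * epowr (Fp f y (8 * (2 ^ j * l))) (1 / p)"
      by (rule mult_right_mono) simp
    then show "ennreal (A powr e * (A / wq w y (8 * (2 ^ j * l))) powr \<theta>) * epowr (Fp f y (8 * (2 ^ j * l))) (1 / p) \<le>
       ennreal ((\<rho> powr (\<theta> + e)) ^ j) * (epowr (wmeas w (cube y (8 * (2 ^ j * l)))) e * epowr (Fp f y (8 * (2 ^ j * l))) (1 / p))"
      using W unfolding wmeas_cube[OF weight] W_def[symmetric] by (simp add: epowr_ennreal mult.assoc)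
  qed
  finally show ?thesis .
qed

lemma Fp_measurable [measurable]:
  assumes [measurable]: "f \<in> borel_measurable lebesgue"
  shows "(\<lambda>y. Fp f y l) \<in> borel_measurable lebesgue"
proof -
  have "(\<lambda>y. \<integral>\<^sup>+z. (if z \<in> cube y l then ennreal (\<bar>f z\<bar> powr p * \<nu> z) else 0) \<partial>lebesgue) \<in> borel_measurable lebesgue"
    by measurable
  then show ?thesis
    by (rule back_subst[where P="\<lambda>f. f \<in> borel_measurable lebesgue"])
       (auto simp: Fp_def intro!: ext nn_integral_cong split: split_indicator)
qed

text \<open>The relation of \<open>\<alpha>\<close> and \<open>\<beta>\<close> makes the exponent of
  the mass the same number \<open>e\<close> in both amalgam norms. The \<open>j\<close>-th term is
  therefore the source integrand for side \<open>8 * (2 ^ j * l)\<close>, and the supremum over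
  sides bounds all terms by one norm of \<open>f\<close>.\<close>

theorem weak_amalgam_bound:
  fixes s :: ennreal and \<alpha> \<beta> :: real and \<mu> :: "real^'n \<Rightarrow> real"
  assumes gamma0: "0 < \<gamma>" and nu: "\<And>x. \<nu> x \<ge> 0" and s: "s > 0" and mu: "\<mu> \<in> borel_measurable lebesgue"
    and \<alpha>\<beta>: "1 / \<beta> = 1 / \<alpha> - (1 / p - 1 / q)" and m: "1 / m < 1 / \<beta> - enn2real (1 / s)"
  obtains C where "C > 0" "\<And>f. f \<in> borel_measurable lebesgue \<Longrightarrow>
    weak_amalgam_norm q s \<beta> w \<mu> (commutator b \<gamma> f) \<le> ennreal C * amalgam_norm p s \<alpha> \<nu> w \<mu> f"
proof -
  define e where "e = 1 / \<beta> - 1 / q - enn2real (1 / s)"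
  have e: "e = 1 / \<alpha> - 1 / p - enn2real (1 / s)" using \<alpha>\<beta> by (simp add: e_def)
  have \<theta>e: "\<theta> + e > 0" using m by (simp add: \<theta>_def e_def)
  define \<eta> where "\<eta> = \<rho> powr (\<theta> + e)"
  have \<eta>: "0 < \<eta>" "\<eta> < 1" using rho \<theta>e powr_less_mono2[of "\<theta> + e" \<rho> 1] by (auto simp: \<eta>_def)
  obtain C1 where C1: "C1 > 0" and weak: "\<And>y l f. l > 0 \<Longrightarrow> f \<in> borel_measurable lebesgue \<Longrightarrow>
    weak_Lp_norm q w (\<lambda>x. commutator b \<gamma> f x * indicator (cube y l) x) \<le> ennreal C1 * tail_sum f y l"
    by (rule weak_estimate[OF gamma0], rule that)
  have q: "q > 0" and p: "p > 0" using exps by auto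
  show thesis
  proof (rule Lp_norm_geometric_sum[OF s \<eta> C1 mu])
    fix C :: real
    assume C: "C > 0" and sum: "\<And>g h A. g \<in> borel_measurable lebesgue \<Longrightarrow> (\<And>j. h j \<in> borel_measurable lebesgue) \<Longrightarrow>
      (\<And>j::nat. Lp_norm s \<mu> (h j) \<le> A) \<Longrightarrow> (\<And>y. g y \<le> ennreal C1 * (\<Sum>j. ennreal (\<eta> ^ j) * h j y)) \<Longrightarrow>
      Lp_norm s \<mu> g \<le> ennreal C * A"
    have main: "weak_amalgam_norm q s \<beta> w \<mu> (commutator b \<gamma> f) \<le> ennreal C * amalgam_norm p s \<alpha> \<nu> w \<mu> f"
      if f[measurable]: "f \<in> borel_measurable lebesgue" for f
      unfolding weak_amalgam_norm_def e_def[symmetric]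
    proof (rule SUP_least)
      fix l :: real assume "l \<in> {0<..}"
      then have l: "l > 0" by simp
      let ?h = "\<lambda>j y. epowr (wmeas w (cube y (8 * (2 ^ j * l)))) e * epowr (Fp f y (8 * (2 ^ j * l))) (1 / p)"
      note [measurable] = weak_Lp_norm_cube_measurable[OF commutator_measurable[OF b_measurable f, of \<gamma>] w_measurable q]
      show "Lp_norm s \<mu> (\<lambda>y. epowr (wmeas w (cube y l)) e * weak_Lp_norm q w (\<lambda>x. commutator b \<gamma> f x * indicator (cube y l) x))
          \<le> ennreal C * amalgam_norm p s \<alpha> \<nu> w \<mu> f"
      proof (rule sum[of _ ?h])
        show "(\<lambda>y. epowr (wmeas w (cube y l)) e * weak_Lp_norm q w (\<lambda>x. commutator b \<gamma> f x * indicator (cube y l) x)) \<in> borel_measurable lebesgue"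
          by measurable
        show "?h j \<in> borel_measurable lebesgue" for j by measurable
        show "Lp_norm s \<mu> (?h j) \<le> amalgam_norm p s \<alpha> \<nu> w \<mu> f" for j
          unfolding amalgam_norm_def e[symmetric] Lp_norm_indicator[of p \<nu>, OF p nu]
          using l by (intro SUP_upper2[of "8 * (2 ^ j * l)"]) (auto simp: Fp_def)
        fix y
        have "epowr (wmeas w (cube y l)) e * weak_Lp_norm q w (\<lambda>x. commutator b \<gamma> f x * indicator (cube y l) x) \<le>
            epowr (wmeas w (cube y l)) e * (ennreal C1 * tail_sum f y l)"
          by (intro mult_left_mono weak l f) simp
        also have "\<dots> = ennreal C1 * (epowr (wmeas w (cube y l)) e * tail_sum f y l)" by (simp only: mult.left_commute)
        also have "\<dots> \<le> ennreal C1 * (\<Sum>j. ennreal (\<eta> ^ j) * ?h j y)"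
          unfolding \<eta>_def by (intro mult_left_mono scaled_tail_sum_le l \<theta>e) simp
        finally show "epowr (wmeas w (cube y l)) e * weak_Lp_norm q w (\<lambda>x. commutator b \<gamma> f x * indicator (cube y l) x) \<le>
            ennreal C1 * (\<Sum>j. ennreal (\<eta> ^ j) * ?h j y)" .
      qed
    qed
    from that[OF C main] show thesis .
  qed
qed

end

text \<open>The power of \<open>w(Q) = 0\<close> may be infinite if its exponent is negative, but it
  multiplies a weak norm equal to zero, and \<open>\<infinity> * 0 = 0\<close>.\<close>

lemma weak_amalgam_norm_null_weight:
  fixes w \<mu> :: "real^'n \<Rightarrow> real"
  assumes w: "AE x in lebesgue. w x = 0" and q: "q > 0" and s: "s > 0"
  shows "weak_amalgam_norm q s \<beta> w \<mu> g = 0"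
proof -
  have "(\<integral>\<^sup>+x\<in>A. ennreal (w x) \<partial>lebesgue) = (\<integral>\<^sup>+x. 0 \<partial>(lebesgue :: (real^'n) measure))" for A
    using w by (intro nn_integral_cong_AE) (auto elim!: eventually_mono)
  then have wm: "wmeas w A = 0" for A by (simp add: wmeas_def)
  have "weak_Lp_norm q w g' = 0" for g' using q by (simp add: weak_Lp_norm_def wm)
  moreover have "Lp_norm s \<mu> (\<lambda>_. 0) = 0"
  proof (cases "s = \<infinity>")
    case True
    have "esssup (density lebesgue (\<lambda>x. ennreal (\<mu> x))) (\<lambda>_. 0 :: ennreal) \<le> 0" by (rule esssup_I) auto
    then show ?thesis using True by (simp add: Lp_norm_def)
  next
    case False
    then have "enn2real s > 0" using s by (cases s) auto
    then show ?thesis using False by (simp add: Lp_norm_def)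
  qed
  ultimately show ?thesis by (simp add: weak_amalgam_norm_def)
qed

theorem theorem2p4:
  fixes \<gamma> p q \<alpha> \<beta> :: real and s :: ennreal
    and w \<nu> \<mu> b :: "real^'n \<Rightarrow> real"
  assumes "0 < \<gamma>" "\<gamma> < real CARD('n)"
    and "1 < p" "p < q"
    and "doubling \<mu>"
    and "b \<in> BMO"
    and "weight w" "weight \<nu>"
    and bump: "\<exists>r>1. \<exists>C::real. \<forall>y. \<forall>l>0.
      epowr (emeasure lebesgue (cube y l)) (\<gamma> / real CARD('n) + 1 / q - 1 / p) *
      epowr (avg (cube y l) (\<lambda>x. epowr (ennreal (w x)) r)) (1 / (r * q)) *
      luxemburg (log_bump p) (cube y l) (\<lambda>x. epowr (ennreal (\<nu> x)) (- (1 / p)))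
      \<le> ennreal C"
    and "p \<le> \<alpha>" "\<alpha> < \<beta>" "ennreal \<beta> < s"
    and "A_infinity w"
    and "1 / \<beta> = 1 / \<alpha> - (1 / p - 1 / q)"
  shows "\<exists>C::real. \<forall>f \<in> amalgam_space p s \<alpha> \<nu> w \<mu>.
    commutator b \<gamma> f \<in> weak_amalgam_space q s \<beta> w \<mu> \<and>
    weak_amalgam_norm q s \<beta> w \<mu> (commutator b \<gamma> f) \<le> ennreal C * amalgam_norm p s \<alpha> \<nu> w \<mu> f"
proof -
  have b: "b \<in> borel_measurable lebesgue" and mu: "\<mu> \<in> borel_measurable lebesgue"
    using assms(5,6) by (auto simp: BMO_def doubling_def weight_def loc_integrable_measurable)
  have s: "s > 0" using \<open>ennreal \<beta> < s\<close> by (rule le_less_trans[rotated]) simp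
  have "\<exists>C::real. \<forall>f. f \<in> borel_measurable lebesgue \<longrightarrow>
     weak_amalgam_norm q s \<beta> w \<mu> (commutator b \<gamma> f) \<le> ennreal C * amalgam_norm p s \<alpha> \<nu> w \<mu> f"
  \<comment> \<open>A null weight passes the Muckenhoupt condition through
    \<open>0 * \<infinity> = 0\<close>, yet satisfies no reverse positivity, so it is settled
    directly.\<close>
  proof (cases "AE x in lebesgue. w x = 0")
    case True
    then show ?thesis using assms(3,4) s by (auto simp: weak_amalgam_norm_null_weight)
  next
    case False
    obtain p0 where p0: "p0 > 1" "A_class p0 w" using \<open>A_infinity w\<close> by (auto simp: A_infinity_def)
    have pos: "AE x in lebesgue. w x > 0" by (rule A_class_AE_pos[OF p0 False])
    obtain \<rho> where \<rho>: "0 < \<rho>" "\<rho> < 1" "\<And>c l. l > 0 \<Longrightarrow> wq w c (l / 2) \<le> \<rho> * wq w c l"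
      by (rule A_class_reverse_doubling[OF p0 pos], rule that)
    obtain r C where r: "r > 1" and C: "\<And>y l. l > 0 \<Longrightarrow>
      epowr (emeasure lebesgue (cube y l)) (\<gamma> / real CARD('n) + 1 / q - 1 / p) *
      epowr (avg (cube y l) (\<lambda>x. epowr (ennreal (w x)) r)) (1 / (r * q)) *
      luxemburg (log_bump p) (cube y l) (\<lambda>x. epowr (ennreal (\<nu> x)) (- (1 / p))) \<le> ennreal C"
      using bump by metis
    \<comment> \<open>The room for the loss \<open>1/m\<close>; it is positive by
      \<open>\<beta> < s\<close>, and equals \<open>1 / \<beta>\<close> when
      \<open>s = \<infinity>\<close>.\<close>
    define \<delta> where "\<delta> = 1 / \<beta> - enn2real (1 / s)"
    have \<beta>: "\<beta> > 0" using assms(3,10,11) by simp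
    have \<delta>: "\<delta> > 0"
    proof (cases s)
      case (real t)
      then have "t > \<beta>" using \<open>ennreal \<beta> < s\<close> \<beta> by (simp add: ennreal_less_iff)
      then have "1 / s = ennreal (1 / t)" using real \<beta> by (simp add: divide_ennreal flip: ennreal_1)
      then show ?thesis using \<open>t > \<beta>\<close> \<beta> by (simp add: \<delta>_def field_simps)
    next
      case top
      then show ?thesis using \<beta> by (simp add: \<delta>_def)
    qed
    \<comment> \<open>The first entry gives \<open>\<theta> > 0\<close>; the second gives
      \<open>1 / m \<le> \<delta> / 2\<close>, so \<open>\<theta> + e\<close>, which equals
      \<open>\<delta> - 1 / m\<close>, is positive.\<close>
    define m where "m = max (q + 1) (2 / \<delta>)"
    have m: "q < m" "1 / m < \<delta>"
    proof -
      show "q < m" by (simp add: m_def)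
      have "2 / \<delta> \<le> m" by (simp add: m_def)
      moreover have "m > 0" using \<delta> \<open>2 / \<delta> \<le> m\<close> by (meson divide_pos_pos less_le_trans zero_less_numeral)
      ultimately show "1 / m < \<delta>" using \<delta> by (simp add: field_simps)
    qed
    have q: "1 < q" using assms(3,4) by simp
    obtain K where K: "K > 0" and est: "\<And>c l E f. l > 0 \<Longrightarrow> E \<in> sets lebesgue \<Longrightarrow> E \<subseteq> cube c l \<Longrightarrow> f \<in> borel_measurable lebesgue \<Longrightarrow>
      (\<integral>\<^sup>+x\<in>E. (\<integral>\<^sup>+z\<in>cube c l. ennreal (\<bar>b x - b z\<bar> * \<bar>f z\<bar> * w x) \<partial>lebesgue) \<partial>lebesgue) \<le>
      ennreal (K * l powr (real CARD('n) - \<gamma>) * wq w c l powr (1 / m - 1 / q)) * epowr (wmeas w E) (1 - 1 / m) *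
      epowr (\<integral>\<^sup>+z\<in>cube c l. ennreal (\<bar>f z\<bar> powr p * \<nu> z) \<partial>lebesgue) (1 / p)"
      by (rule cube_estimate[OF \<open>1 < p\<close> q m(1) r \<open>b \<in> BMO\<close> \<open>weight w\<close> pos \<open>weight \<nu>\<close> C], assumption, rule that)
    interpret cube_bound w \<rho> b \<nu> \<gamma> p q m K
    proof
      show "\<exists>D>0. \<forall>c d l. l > 0 \<longrightarrow> cube c l \<subseteq> cube d (L * l) \<longrightarrow> wq w d (L * l) \<le> D * wq w c l" if L: "L > 0" for L
        by (rule A_class_doubling[OF p0 pos L]) blast
    qed (use assms \<rho> pos b m K est weight_measurable in auto)
    have nu: "\<nu> x \<ge> 0" for x using \<open>weight \<nu>\<close> by (simp add: weight_def)
    have m': "1 / m < 1 / \<beta> - enn2real (1 / s)" using m(2) by (simp add: \<delta>_def)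
    show ?thesis
      by (rule weak_amalgam_bound[OF \<open>0 < \<gamma>\<close> nu s mu \<open>1 / \<beta> = 1 / \<alpha> - (1 / p - 1 / q)\<close> m']) blast
  qed
  then obtain C :: real where C: "\<And>f. f \<in> borel_measurable lebesgue \<Longrightarrow>
     weak_amalgam_norm q s \<beta> w \<mu> (commutator b \<gamma> f) \<le> ennreal C * amalgam_norm p s \<alpha> \<nu> w \<mu> f"
    by blast
  show ?thesis
  proof (intro exI ballI conjI)
    fix f assume "f \<in> amalgam_space p s \<alpha> \<nu> w \<mu>"
    then have f: "f \<in> borel_measurable lebesgue" and fin: "amalgam_norm p s \<alpha> \<nu> w \<mu> f < \<infinity>"
      by (auto simp: amalgam_space_def loc_integrable_measurable)
    show le: "weak_amalgam_norm q s \<beta> w \<mu> (commutator b \<gamma> f) \<le> ennreal C * amalgam_norm p s \<alpha> \<nu> w \<mu> f"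
      by (rule C[OF f])
    also have "\<dots> < \<infinity>" using fin by (simp add: ennreal_mult_less_top)
    finally show "commutator b \<gamma> f \<in> weak_amalgam_space q s \<beta> w \<mu>"
      using commutator_measurable[OF b f] by (simp add: weak_amalgam_space_def)
  qed
qed

end
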